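(* Let $r\in\mathbb R$ and let $\mathcal E,\mathcal F$ be finite sequences of complex numbers with $0<|x|\le r<1$ for all their elements $x$. Then $$\int_{U(N)}\prod_{\varepsilon\in\mathcal E}\frac{\chi_g'(\varepsilon)}{\chi_g(\varepsilon)}\prod_{\varphi\in\mathcal F}\frac{\chi_{g^{-1}}'(\varphi)}{\chi_{g^{-1}}(\varphi)}\,dg=M+O_{r,l(\mathcal E),l(\mathcal F)}\!\left(r^{2N}N^{(l(\mathcal E)-1)^++(l(\mathcal F)-1)^++(l(\mathcal E)+l(\mathcal F)-1)^++2}\right),$$ where $M=\sum_{\lambda:\,l(\lambda)=l(\mathcal E)}z_\lambda\,\mathfrak m_{\lambda-\langle 1^{l(\mathcal E)}\rangle}(\mathcal E)\,\mathfrak m_{\lambda-\langle 1^{l(\mathcal E)}\rangle}(\mathcal F)$ if $l(\mathcal E)=l(\mathcal F)$, and $M=0$ otherwise.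
   Context: $U(N)$ is the unitary group with normalized Haar measure; $\chi_g(z)=\det(I-zg^{-1})$. $l(\cdot)$ denotes length (number of entries of a sequence; number of positive parts of a partition); $x^+=\max\{x,0\}$. For a partition $\lambda$ of length $p$, $\lambda-\langle1^p\rangle$ is the partition obtained by subtracting $1$ from each of its $p$ positive parts. $z_\lambda=\prod_i i^{m_i(\lambda)}m_i(\lambda)!$ with $m_i(\lambda)$ the multiplicity of $i$ in $\lambda$; $\mathfrak m_\lambda$ is the monomial symmetric polynomial (zero if $l(\lambda)$ exceeds the number of variables). *)

theory Defs
  imports
    "HOL-Analysis.Analysis"
    "HOL-Probability.Probability_Measure"
    "HOL-Algebra.Coset"
    "Jordan_Normal_Form.Schur_Decomposition"
    "Jordan_Normal_Form.Determinant"
begin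

definition unitary_group :: "nat \<Rightarrow> complex mat monoid" where
  "unitary_group N =
    \<lparr>carrier = {g \<in> carrier_mat N N. g * mat_adjoint g = 1\<^sub>m N \<and> mat_adjoint g * g = 1\<^sub>m N},
     monoid.mult = (*), one = 1\<^sub>m N\<rparr>"

lemma mat_adjoint_eq: "mat_adjoint A = mat (dim_col A) (dim_row A) (\<lambda>(i,j). cnj (A $$ (j,i)))"
  by (rule eq_matI) (auto simp: mat_adjoint_def mat_of_rows_def)

lemma mat_adjoint_carrier:
  assumes "(A :: complex mat) \<in> carrier_mat n m"
  shows "mat_adjoint A \<in> carrier_mat m n"
  using assms by (auto simp: mat_adjoint_eq)

lemma mat_adjoint_adjoint: "mat_adjoint (mat_adjoint (A :: complex mat)) = A"
  by (rule eq_matI) (auto simp: mat_adjoint_eq)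

lemma mat_adjoint_mult:
  assumes "(A :: complex mat) \<in> carrier_mat n m" "B \<in> carrier_mat m k"
  shows "mat_adjoint (A * B) = mat_adjoint B * mat_adjoint A"
  using assms by (intro eq_matI) (auto simp: mat_adjoint_eq scalar_prod_def mult.commute)

lemma group_unitary_group: "group (unitary_group N)"
proof (rule groupI)
  fix x y assume x: "x \<in> carrier (unitary_group N)" and y: "y \<in> carrier (unitary_group N)"
  from x have X: "x \<in> carrier_mat N N" "x * mat_adjoint x = 1\<^sub>m N" "mat_adjoint x * x = 1\<^sub>m N"
    by (auto simp: unitary_group_def)
  from y have Y: "y \<in> carrier_mat N N" "y * mat_adjoint y = 1\<^sub>m N" "mat_adjoint y * y = 1\<^sub>m N"
    by (auto simp: unitary_group_def)
  note AX = mat_adjoint_carrier[OF X(1)] note AY = mat_adjoint_carrier[OF Y(1)]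
  have xy: "x * y \<in> carrier_mat N N" using X Y by auto
  have "(x * y) * (mat_adjoint y * mat_adjoint x) = x * (y * (mat_adjoint y * mat_adjoint x))"
    using X Y AX AY by (intro assoc_mult_mat) auto
  also have "y * (mat_adjoint y * mat_adjoint x) = (y * mat_adjoint y) * mat_adjoint x"
    using X Y AX AY by (intro assoc_mult_mat[symmetric]) auto
  finally have 1: "(x * y) * (mat_adjoint y * mat_adjoint x) = 1\<^sub>m N"
    using X Y AX by simp
  have "(mat_adjoint y * mat_adjoint x) * (x * y) = mat_adjoint y * (mat_adjoint x * (x * y))"
    using X Y AX AY xy by (intro assoc_mult_mat) auto
  also have "mat_adjoint x * (x * y) = (mat_adjoint x * x) * y"
    using X Y AX AY by (intro assoc_mult_mat[symmetric]) auto
  finally have 2: "(mat_adjoint y * mat_adjoint x) * (x * y) = 1\<^sub>m N"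
    using X Y AX by simp
  show "x \<otimes>\<^bsub>unitary_group N\<^esub> y \<in> carrier (unitary_group N)"
    using 1 2 xy mat_adjoint_mult[OF X(1) Y(1)] by (simp add: unitary_group_def)
next
  have "mat_adjoint (1\<^sub>m N :: complex mat) = 1\<^sub>m N"
    by (rule eq_matI) (auto simp: mat_adjoint_eq)
  then show "\<one>\<^bsub>unitary_group N\<^esub> \<in> carrier (unitary_group N)"
    by (simp add: unitary_group_def)
next
  fix x assume x: "x \<in> carrier (unitary_group N)"
  show "\<one>\<^bsub>unitary_group N\<^esub> \<otimes>\<^bsub>unitary_group N\<^esub> x = x"
    using x by (auto simp: unitary_group_def)
  show "\<exists>y\<in>carrier (unitary_group N). y \<otimes>\<^bsub>unitary_group N\<^esub> x = \<one>\<^bsub>unitary_group N\<^esub>"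
    using x by (intro bexI[of _ "mat_adjoint x"])
      (auto simp: unitary_group_def mat_adjoint_adjoint intro: mat_adjoint_carrier)
qed (auto simp: unitary_group_def)

lemma inv_unitary_group:
  assumes "g \<in> carrier (unitary_group N)"
  shows "inv\<^bsub>unitary_group N\<^esub> g = mat_adjoint g"
proof -
  interpret group "unitary_group N" by (rule group_unitary_group)
  show ?thesis
    using assms by (intro inv_equality)
      (auto simp: unitary_group_def mat_adjoint_adjoint intro: mat_adjoint_carrier)
qed

text \<open>The Borel sigma-algebra of U(N), as a subspace of the N-by-N complex matrices identified
  with a finite power of the complex plane via their entries.\<close>
definition unitary_borel :: "nat \<Rightarrow> complex mat measure" where
  "unitary_borel N = vimage_algebra (carrier (unitary_group N))
     (\<lambda>g. \<lambda>ij\<in>{..<N} \<times> {..<N}. g $$ ij) (\<Pi>\<^sub>M ij\<in>{..<N} \<times> {..<N}. borel)"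

text \<open>As U(N) is compact, there is exactly one such measure.\<close>
definition normalized_haar_measure :: "nat \<Rightarrow> complex mat measure \<Rightarrow> bool" where
  "normalized_haar_measure N \<mu> \<longleftrightarrow>
     prob_space \<mu> \<and> sets \<mu> = sets (unitary_borel N) \<and>
     (\<forall>g \<in> carrier (unitary_group N). \<forall>A \<in> sets \<mu>.
        emeasure \<mu> (g <#\<^bsub>unitary_group N\<^esub> A) = emeasure \<mu> A)"

definition chi :: "nat \<Rightarrow> complex mat \<Rightarrow> complex \<Rightarrow> complex" where
  "chi N g z = Determinant.det (1\<^sub>m N - z \<cdot>\<^sub>m inv\<^bsub>unitary_group N\<^esub> g)"

text \<open>A partition is represented by the multiset of its positive parts; its length is the size.\<close>
definition partitions :: "nat multiset set" where
  "partitions = {pt. 0 \<notin># pt}"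

definition z_part :: "nat multiset \<Rightarrow> nat" where
  "z_part pt = (\<Prod>i\<in>set_mset pt. i ^ count pt i * fact (count pt i))"

definition subtract_ones :: "nat multiset \<Rightarrow> nat multiset" where
  "subtract_ones pt = filter_mset (\<lambda>i. 0 < i) (image_mset (\<lambda>i. i - 1) pt)"

text \<open>The sum ranges over the distinct rearrangements of the partition padded with zeros to the
  number of variables; there are none if the partition is too long.\<close>
definition monomial_sym :: "nat multiset \<Rightarrow> complex list \<Rightarrow> complex" where
  "monomial_sym pt xs =
     (\<Sum>\<alpha> | length \<alpha> = length xs \<and> filter_mset (\<lambda>i. 0 < i) (mset \<alpha>) = pt.
        \<Prod>i<length xs. (xs ! i) ^ (\<alpha> ! i))"

end

theory Submission
  imports Defs
begin

text \<open>
  Expanding the logarithmic derivatives as \<open>- \<Sum>\<^sub>k tr(g\<^sup>-\<^sup>k) z\<^sup>k\<^sup>-\<^sup>1\<close> reduces the integral to the mixed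
  moments \<open>E(R, S)\<close> of the power sums \<open>p\<^sub>R(g)\<close> and \<open>p\<^sub>S(g)\<close> conjugated.  Invariance under scalars kills
  the moments with \<open>|R| \<noteq> |S|\<close>.  Infinitesimal left invariance, applied to
  \<open>(g\<^sup>k)\<^sub>c\<^sub>d p\<^sub>R\<close> times the conjugate of \<open>p\<^sub>S\<close> and summed over all matrix units, gives a linear recursion
  for \<open>E(R, S)\<close> which \<open>\<delta>\<^sub>R\<^sub>S z\<^sub>R\<close> also satisfies; in degree \<open>n \<le> N\<close> it is diagonally dominant, so
  \<open>E(R, S) = \<delta>\<^sub>R\<^sub>S z\<^sub>R\<close> there, which matches the main term.  In each degree \<open>n > N\<close> there are at most
  \<open>n\<^sup>p\<^sup>-\<^sup>1 n\<^sup>q\<^sup>-\<^sup>1\<close> terms left on either side, each of size \<open>O(n\<^sup>p\<^sup>+\<^sup>q r\<^sup>2\<^sup>n)\<close>.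
\<close>

section \<open>The loop equation for power sums\<close>

text \<open>In degree n the off-diagonal coefficients of the recursion add up to n - 1 against the
  diagonal coefficient N, so the dominance argument stops at n = N. Beyond it only |p_k(g)| <= N is
  available, which is affordable because N^(p+q) <= n^(p+q) there. As p + q <= (p+q-1)^+ + 1, the
  stated exponent leaves a spare power of N. Matrix units are not tangent to U(N), only
  skew-Hermitian matrices are. Derivatives are therefore taken along i times a rank-one projection,
  extended complex linearly, and polarization recovers each matrix unit. The expansions are
  infinite, so moments are compared for series cut at K, with bounds uniform in K. Letting K grow
  uses dominated convergence for the integral and unconditional summability for the main
  term.\<close>

lemma z_part_empty [simp]: "z_part {#} = 1"
  by (simp add: z_part_def)

lemma z_part_add_mset: "z_part (add_mset a R) = a * Suc (count R a) * z_part R"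
proof (cases "a \<in># R")
  case True
  define A where "A = set_mset R - {a}"
  have R: "set_mset R = insert a A" and A: "finite A" "a \<notin> A"
    using True by (auto simp: A_def)
  have "(\<Prod>i\<in>A. i ^ count (add_mset a R) i * fact (count (add_mset a R) i)) =
        (\<Prod>i\<in>A. i ^ count R i * fact (count R i))"
    using A by (intro prod.cong) auto
  with R A show ?thesis
    by (simp add: z_part_def algebra_simps)
next
  case False
  have "(\<Prod>i\<in>set_mset R. i ^ count (add_mset a R) i * fact (count (add_mset a R) i)) =
        (\<Prod>i\<in>set_mset R. i ^ count R i * fact (count R i))"
    using False by (intro prod.cong) auto
  with False show ?thesis
    by (simp add: z_part_def not_in_iff algebra_simps)
qed

lemma z_part_diff: "a \<in># S \<Longrightarrow> z_part S = a * count S a * z_part (S - {#a#})"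
  using z_part_add_mset[of a "S - {#a#}"] by (simp add: Suc_diff_Suc)

lemma z_part_le:
  assumes "\<And>x. x \<in># R \<Longrightarrow> x \<le> n"
  shows "z_part R \<le> fact (size R) * n ^ size R"
  using assms
proof (induction R)
  case (add a R)
  have "z_part (add_mset a R) = a * Suc (count R a) * z_part R"
    by (rule z_part_add_mset)
  also have "\<dots> \<le> n * Suc (size R) * (fact (size R) * n ^ size R)"
    using add by (intro mult_mono) (auto intro: count_le_size)
  finally show ?case by (simp add: algebra_simps)
qed auto

lemma sum_mset_eq_sum_count:
  fixes h :: "'a \<Rightarrow> 'b::comm_semiring_1"
  shows "(\<Sum>x\<in>#S. h x) = (\<Sum>x\<in>set_mset S. of_nat (count S x) * h x)"
proof (induction S)
  case (add a S)
  show ?case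
  proof (cases "a \<in># S")
    case True
    define A where "A = set_mset S - {a}"
    have S: "set_mset S = insert a A" and A: "finite A" "a \<notin> A"
      using True by (auto simp: A_def)
    have "(\<Sum>x\<in>A. of_nat (count (add_mset a S) x) * h x) = (\<Sum>x\<in>A. of_nat (count S x) * h x)"
      using A by (intro sum.cong) auto
    with S A add show ?thesis by (simp add: algebra_simps)
  next
    case False
    have "(\<Sum>x\<in>set_mset S. of_nat (count (add_mset a S) x) * h x) =
          (\<Sum>x\<in>set_mset S. of_nat (count S x) * h x)"
      using False by (intro sum.cong) auto
    with False add show ?thesis by (simp add: not_in_iff)
  qed
qed simp

text \<open>With \<open>F R S\<close> read as the moment of p_R and the conjugate of p_S, these are
  the cut and join terms: \<open>k\<close> splits when g^k is differentiated, and merges with a part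
  \<open>i\<close> of \<open>R\<close> when p_R is.\<close>

definition loop_sum :: "(nat multiset \<Rightarrow> nat multiset \<Rightarrow> 'a::comm_ring_1) \<Rightarrow> nat \<Rightarrow> nat multiset \<Rightarrow> nat multiset \<Rightarrow> 'a" where
  "loop_sum F k R S = (\<Sum>j\<in>{1..<k}. F (add_mset j (add_mset (k - j) R)) S)
     + (\<Sum>i\<in>#R. of_nat i * F (add_mset (k + i) (R - {#i#})) S)"

text \<open>Annihilation terms, from differentiating the conjugated p_S: g^k meets the adjoint of
  g^m and only the excess of one exponent over the other survives. For \<open>m = k\<close> the
  identity matrix is left, whose trace is the factor \<open>N\<close>.\<close>

definition loop_rhs :: "'a::comm_ring_1 \<Rightarrow> (nat multiset \<Rightarrow> nat multiset \<Rightarrow> 'a) \<Rightarrow> nat \<Rightarrow> nat multiset \<Rightarrow> nat multiset \<Rightarrow> 'a" where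
  "loop_rhs N F k R S = (\<Sum>m\<in>#S. of_nat m *
     (if m = k then N * F R (S - {#m#})
      else if m < k then F (add_mset (k - m) R) (S - {#m#})
      else F R (add_mset (m - k) (S - {#m#}))))"

definition loop_equation :: "'a::comm_ring_1 \<Rightarrow> (nat multiset \<Rightarrow> nat multiset \<Rightarrow> 'a) \<Rightarrow> bool" where
  "loop_equation N F \<longleftrightarrow> (\<forall>k R S. 0 < k \<longrightarrow> 0 \<notin># R \<longrightarrow> 0 \<notin># S \<longrightarrow>
     N * F (add_mset k R) S + loop_sum F k R S = loop_rhs N F k R S)"

definition orth :: "nat multiset \<Rightarrow> nat multiset \<Rightarrow> complex" where
  "orth R S = (if R = S then of_nat (z_part S) else 0)"

text \<open>The three ranges of a part m of \<open>S\<close> match the left side piece by piece: m =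
  k the leading term, m < k the cuts, m > k the joins. In each range \<open>z_part_diff\<close>
  accounts for the weight m times multiplicity.\<close>

lemma loop_equation_orth: "loop_equation N orth"
  unfolding loop_equation_def
proof (intro allI impI)
  fix k :: nat and R S :: "nat multiset"
  assume k: "0 < k" and R: "0 \<notin># R" and S: "0 \<notin># S"
  define T where "T m = of_nat (count S m) * (of_nat m *
     (if m = k then N * orth R (S - {#m#})
      else if m < k then orth (add_mset (k - m) R) (S - {#m#})
      else orth R (add_mset (m - k) (S - {#m#}))))" for m
  have "loop_rhs N orth k R S = (\<Sum>m\<in>set_mset S. T m)"
    unfolding loop_rhs_def T_def by (rule sum_mset_eq_sum_count)
  also have "set_mset S = (set_mset S \<inter> {k}) \<union> (set_mset S \<inter> {1..<k}) \<union> (set_mset S \<inter> {k<..})"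
  proof -
    have "m > 0" if "m \<in># S" for m using S that by (cases m) auto
    thus ?thesis by (auto simp: not_less_eq_eq Suc_le_eq)
  qed
  also have "(\<Sum>m\<in>\<dots>. T m) = (\<Sum>m\<in>set_mset S \<inter> {k}. T m) +
      (\<Sum>m\<in>set_mset S \<inter> {1..<k}. T m) + (\<Sum>m\<in>set_mset S \<inter> {k<..}. T m)"
    by (subst sum.union_disjoint, force, force, force, subst sum.union_disjoint) auto
  also have "(\<Sum>m\<in>set_mset S \<inter> {k}. T m) = N * orth (add_mset k R) S"
  proof (cases "k \<in># S")
    case True
    hence "(R = S - {#k#}) = (add_mset k R = S)" by auto
    with True z_part_diff[OF True] show ?thesis by (auto simp: T_def orth_def)
  qed (auto simp: orth_def)
  \<comment> \<open>A cut at \<open>j\<close> contributes only if \<open>j\<close> is itself a part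
    of \<open>S\<close>, so restricting to the distinct parts below \<open>k\<close> loses
    nothing.\<close>
  also have "(\<Sum>m\<in>set_mset S \<inter> {1..<k}. T m) = (\<Sum>j\<in>{1..<k}. orth (add_mset j (add_mset (k - j) R)) S)"
  proof -
    have "T m = orth (add_mset m (add_mset (k - m) R)) S" if "m \<in># S" "m < k" for m
    proof -
      have "(add_mset (k - m) R = S - {#m#}) = (add_mset m (add_mset (k - m) R) = S)"
        using that by (metis add_mset_remove_trivial insert_DiffM)
      with that z_part_diff[OF that(1)] show ?thesis by (auto simp: T_def orth_def)
    qed
    hence "(\<Sum>m\<in>set_mset S \<inter> {1..<k}. T m) =
        (\<Sum>j\<in>set_mset S \<inter> {1..<k}. orth (add_mset j (add_mset (k - j) R)) S)"
      by (intro sum.cong) auto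
    also have "\<dots> = (\<Sum>j\<in>{1..<k}. orth (add_mset j (add_mset (k - j) R)) S)"
      by (intro sum.mono_neutral_left) (auto simp: orth_def)
    finally show ?thesis .
  qed
  also have "(\<Sum>m\<in>set_mset S \<inter> {k<..}. T m) =
      (\<Sum>i\<in>#R. of_nat i * orth (add_mset (k + i) (R - {#i#})) S)"
  proof -
    \<comment> \<open>Joining \<open>k\<close> with \<open>i\<close> can give \<open>S\<close> only
      if \<open>k + i\<close> is a part of \<open>S\<close>; \<open>m = k + i\<close> then matches
      these \<open>i\<close> with the contributing parts above \<open>k\<close>.\<close>
    define I where "I = {i. i \<in># R \<and> k + i \<in># S}"
    have I: "finite I" unfolding I_def by (rule finite_subset[of _ "set_mset R"]) auto
    have "(\<Sum>i\<in>#R. of_nat i * orth (add_mset (k + i) (R - {#i#})) S) =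
        (\<Sum>i\<in>set_mset R. of_nat (count R i) * (of_nat i * orth (add_mset (k + i) (R - {#i#})) S))"
      by (rule sum_mset_eq_sum_count)
    also have "\<dots> = (\<Sum>i\<in>I. of_nat (count R i) * (of_nat i * orth (add_mset (k + i) (R - {#i#})) S))"
      by (intro sum.mono_neutral_right) (auto simp: orth_def I_def)
    also have "\<dots> = (\<Sum>i\<in>I. T (k + i))"
    proof (intro sum.cong refl)
      fix i assume i: "i \<in> I"
      hence iR: "i \<in># R" and iS: "k + i \<in># S" by (auto simp: I_def)
      have "i > 0" using R iR by (cases i) auto
      have eq: "(add_mset (k + i) (R - {#i#}) = S) \<longleftrightarrow> R = add_mset i (S - {#k + i#})"
        using iR iS by (metis add_mset_remove_trivial insert_DiffM)
      show "of_nat (count R i) * (of_nat i * orth (add_mset (k + i) (R - {#i#})) S) = T (k + i)"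
      proof (cases "R = add_mset i (S - {#k + i#})")
        case True
        \<comment> \<open>\<open>R\<close> and \<open>S\<close> share the remainder left after
          deleting \<open>i\<close> and \<open>k + i\<close>. Each z-value is that of the remainder
          times the weight which the other side of the identity carries.\<close>
        hence W: "R - {#i#} = S - {#k + i#}" by simp
        show ?thesis
          using True eq z_part_diff[OF iR] z_part_diff[OF iS] \<open>i > 0\<close> unfolding T_def orth_def W
          by (simp flip: True)
      next
        case False
        thus ?thesis using eq \<open>i > 0\<close> by (auto simp: T_def orth_def)
      qed
    qed
    also have "\<dots> = (\<Sum>m\<in>(\<lambda>i. k + i) ` I. T m)"
      by (subst sum.reindex) (auto simp: o_def)
    also have "\<dots> = (\<Sum>m\<in>set_mset S \<inter> {k<..}. T m)"
    proof (intro sum.mono_neutral_left ballI)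
      show "(\<lambda>i. k + i) ` I \<subseteq> set_mset S \<inter> {k<..}" using R by (auto simp: I_def intro!: gr0I)
      fix m assume m: "m \<in> set_mset S \<inter> {k<..} - (\<lambda>i. k + i) ` I"
      hence "m - k \<notin># R" by (force simp: I_def image_iff)
      with m show "T m = 0" by (auto simp: T_def orth_def)
    qed auto
    finally show ?thesis ..
  qed
  finally show "N * orth (add_mset k R) S + loop_sum orth k R S = loop_rhs N orth k R S"
    by (simp add: loop_sum_def)
qed

text \<open>Makes a maximum over all \<open>R\<close> of one degree available to the uniqueness
  argument. Positivity of the parts bounds their number by the degree.\<close>

lemma finite_partitions_of: "finite {R :: nat multiset. 0 \<notin># R \<and> \<Sum>\<^sub># R = n}"
proof (rule finite_subset)
  show "{R. 0 \<notin># R \<and> \<Sum>\<^sub># R = n} \<subseteq> mset ` {xs. set xs \<subseteq> {..n} \<and> length xs \<le> n}"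
  proof safe
    fix R :: "nat multiset" assume R: "0 \<notin># R" "n = \<Sum>\<^sub># R"
    obtain xs where xs: "R = mset xs" by (metis ex_mset)
    have "length xs \<le> sum_list xs" if "0 \<notin> set xs" for xs :: "nat list"
      using that by (induction xs) auto
    moreover have "x \<le> sum_list xs" if "x \<in> set xs" for x
      using that by (intro member_le_sum_list) auto
    ultimately show "R \<in> mset ` {xs. set xs \<subseteq> {..\<Sum>\<^sub># R} \<and> length xs \<le> \<Sum>\<^sub># R}"
      using R xs by (auto simp: sum_mset_sum_list)
  qed
  show "finite (mset ` {xs. set xs \<subseteq> {..n} \<and> length xs \<le> n})"
    using finite_lists_length_le[of "{..n}" n] by auto
qed

lemma sum_mset_subtractf:
  fixes f g :: "'a \<Rightarrow> 'b::ab_group_add"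
  shows "(\<Sum>x\<in>#A. f x - g x) = (\<Sum>x\<in>#A. f x) - (\<Sum>x\<in>#A. g x)"
  by (induction A) (auto simp: algebra_simps)

lemma norm_sum_mset_le:
  fixes f :: "'a \<Rightarrow> 'b::real_normed_vector"
  shows "norm (\<Sum>x\<in>#A. f x) \<le> (\<Sum>x\<in>#A. norm (f x))"
  by (induction A) (auto intro: order_trans[OF norm_triangle_ineq])

text \<open>For total degree \<open>n \<le> N\<close> the coefficients of \<^const>\<open>loop_sum\<close> add up to \<open>n - 1 < N\<close>, so the loop
  equation is a diagonally dominant linear system.\<close>
lemma loop_equation_unique:
  fixes F G :: "nat multiset \<Rightarrow> nat multiset \<Rightarrow> complex"
  assumes F: "loop_equation (of_nat N) F" and G: "loop_equation (of_nat N) G"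
    and FG0: "F {#} {#} = G {#} {#}"
  shows "0 \<notin># R \<Longrightarrow> 0 \<notin># S \<Longrightarrow> \<Sum>\<^sub># R = n \<Longrightarrow> \<Sum>\<^sub># S = n \<Longrightarrow> n \<le> N \<Longrightarrow> F R S = G R S"
proof (induction n arbitrary: R S rule: less_induct)
  case (less n R0 S)
  define P where "P = {R :: nat multiset. 0 \<notin># R \<and> \<Sum>\<^sub># R = n}"
  have finP: "finite P" unfolding P_def by (rule finite_partitions_of)
  define D where "D R = norm (F R S - G R S)" for R
  \<comment> \<open>\<open>S\<close> stays fixed and \<open>B\<close> is the worst discrepancy over
    all \<open>R\<close> of degree \<open>n\<close>; the equation at a maximizer will force
    \<open>B <= 0\<close>.\<close>
  define B where "B = Max (D ` P)"
  have R0: "R0 \<in> P" using less by (auto simp: P_def)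
  have B: "D R \<le> B" if "R \<in> P" for R unfolding B_def using finP that by simp
  obtain R where R: "R \<in> P" "D R = B"
    unfolding B_def using finP R0 Max_in[of "D ` P"] by fastforce
  have "B \<le> 0"
  proof (cases "R = {#}")
    \<comment> \<open>Degree 0 has no part to split off, and the normalization \<open>FG0\<close>
      settles it.\<close>
    case True
    hence "n = 0" using R by (auto simp: P_def)
    hence "S = {#}" using less.prems(2,4) by (cases S) simp_all
    thus ?thesis using R True FG0 by (auto simp: D_def)
  next
    case False
    then obtain k R' where Rk: "R = add_mset k R'" by (meson multiset_cases)
    have k: "0 < k" "0 \<notin># R'" "n = k + \<Sum>\<^sub># R'" using R by (auto simp: P_def Rk)
    \<comment> \<open>Every term on the right has degree n - k or n - m, so the induction hypothesis
      identifies the two right sides.\<close>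
    have rhs: "loop_rhs (of_nat N) F k R' S = loop_rhs (of_nat N) G k R' S"
      unfolding loop_rhs_def
    proof (intro arg_cong[of _ _ sum_mset] image_mset_cong)
      fix m assume m: "m \<in># S"
      have mp: "m > 0" "0 \<notin># S - {#m#}"
        using m less.prems(2) by - (metis not_gr_zero, metis in_diffD)
      have sm: "m + \<Sum>\<^sub># (S - {#m#}) = n"
        using sum_mset.remove[OF m] less.prems(4) by simp
      have facts: "\<Sum>\<^sub># R' = n - k" "k \<le> n" "0 < k" "0 \<notin># R'" "\<Sum>\<^sub># (S - {#m#}) = n - m" "m \<le> n"
        using k sm by - (linarith | assumption | simp only: k)+
      have 1: "F R' (S - {#m#}) = G R' (S - {#m#})" if "m = k"
        by (rule less.IH[of "n - k"]) (use that facts mp less.prems(5) in \<open>simp_all\<close>)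
      have 2: "F (add_mset (k - m) R') (S - {#m#}) = G (add_mset (k - m) R') (S - {#m#})" if "m < k"
        by (rule less.IH[of "n - m"]) (use that facts mp less.prems(5) in \<open>simp_all\<close>)
      have 3: "F R' (add_mset (m - k) (S - {#m#})) = G R' (add_mset (m - k) (S - {#m#}))" if "k < m"
        by (rule less.IH[of "n - k"]) (use that facts mp less.prems(5) in \<open>simp_all\<close>)
      show "of_nat m *
         (if m = k then of_nat N * F R' (S - {#m#})
          else if m < k then F (add_mset (k - m) R') (S - {#m#})
               else F R' (add_mset (m - k) (S - {#m#}))) =
         of_nat m *
         (if m = k then of_nat N * G R' (S - {#m#})
          else if m < k then G (add_mset (k - m) R') (S - {#m#})
               else G R' (add_mset (m - k) (S - {#m#})))"
        using 1 2 3 by auto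
    qed
    have "of_nat N * F R S + loop_sum F k R' S = of_nat N * G R S + loop_sum G k R' S"
      using F G k less.prems(2) rhs unfolding loop_equation_def Rk by metis
    hence "of_nat N * (F R S - G R S) = loop_sum G k R' S - loop_sum F k R' S"
      by (simp add: algebra_simps)
    also have "\<dots> = - (\<Sum>j\<in>{1..<k}. F (add_mset j (add_mset (k - j) R')) S - G (add_mset j (add_mset (k - j) R')) S)
       - (\<Sum>i\<in>#R'. of_nat i * (F (add_mset (k + i) (R' - {#i#})) S - G (add_mset (k + i) (R' - {#i#})) S))"
      by (simp add: loop_sum_def sum_subtractf right_diff_distrib sum_mset_subtractf)
    finally have "norm (of_nat N * (F R S - G R S)) = norm \<dots>" by simp
    \<comment> \<open>There are k - 1 cuts, and the joins have total weight n - k: together n -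
      1.\<close>
    also have "\<dots> \<le> (\<Sum>j\<in>{1..<k}. B) + (\<Sum>i\<in>#R'. of_nat i * B)"
    proof (rule order_trans[OF norm_triangle_ineq4], intro add_mono)
      have "D (add_mset j (add_mset (k - j) R')) \<le> B" if "j \<in> {1..<k}" for j
        by (rule B) (use that k in \<open>auto simp: P_def\<close>)
      thus "norm (- (\<Sum>j\<in>{1..<k}. F (add_mset j (add_mset (k - j) R')) S - G (add_mset j (add_mset (k - j) R')) S)) \<le> (\<Sum>j\<in>{1..<k}. B)"
        unfolding norm_minus_cancel by (intro sum_norm_le) (auto simp: D_def)
      have DB: "D (add_mset (k + i) (R' - {#i#})) \<le> B" if "i \<in># R'" for i
      proof (rule B)
        have "i + \<Sum>\<^sub># (R' - {#i#}) = \<Sum>\<^sub># R'" using sum_mset.remove[OF that] by simp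
        thus "add_mset (k + i) (R' - {#i#}) \<in> P" using k by (auto simp: P_def dest: in_diffD)
      qed
      show "norm (\<Sum>i\<in>#R'. of_nat i * (F (add_mset (k + i) (R' - {#i#})) S - G (add_mset (k + i) (R' - {#i#})) S))
          \<le> (\<Sum>i\<in>#R'. of_nat i * B)"
        by (rule order_trans[OF norm_sum_mset_le], rule sum_mset_mono)
           (use DB in \<open>auto simp: D_def norm_mult intro!: mult_left_mono\<close>)
    qed
    also have "(\<Sum>i\<in>#R'. of_nat i * B) = (of_nat n - of_nat k) * B"
    proof -
      have "(\<Sum>i\<in>#R'. of_nat i * B) = of_nat (\<Sum>\<^sub># R') * B"
        by (induction R') (auto simp: algebra_simps)
      also have "\<Sum>\<^sub># R' = n - k" using k by simp
      finally show ?thesis using k(3) by (simp add: of_nat_diff)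
    qed
    also have "(\<Sum>j\<in>{1..<k}. B) = (of_nat k - 1) * B" using k by (simp add: of_nat_diff)
    also have "norm (of_nat N * (F R S - G R S)) = of_nat N * B"
      unfolding norm_mult norm_of_nat using R(2) by (simp add: D_def)
    finally have "of_nat N * B \<le> (of_nat n - 1) * B"
      by (simp add: algebra_simps)
    hence "(of_nat N - of_nat n + 1) * B \<le> 0" by (simp add: algebra_simps)
    moreover have "of_nat N - of_nat n + (1::real) > 0" using less.prems by simp
    ultimately show ?thesis by (simp add: mult_le_0_iff)
  qed
  from order_trans[OF B[OF R0] this] show ?case by (simp add: D_def)
qed

section \<open>Traces of powers of unitary matrices\<close>

text \<open>The power sum p_k of the eigenvalues. Written through entries it is directly open to
  measurability and differentiation; \<open>spectrum_ptr_det\<close> supplies the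
  eigenvalues.\<close>

definition ptr :: "complex mat \<Rightarrow> nat \<Rightarrow> complex" where
  "ptr A k = (\<Sum>i<dim_row A. (A ^\<^sub>m k) $$ (i, i))"

lemma index_mult_mat_sum:
  assumes "A \<in> carrier_mat n m" "B \<in> carrier_mat m l" "i < n" "j < l"
  shows "(A * B) $$ (i, j) = (\<Sum>k<m. A $$ (i, k) * B $$ (k, j))"
  using assms by (simp add: scalar_prod_def lessThan_atLeast0)

lemma upper_triangular_mult:
  assumes A: "(A :: 'a::semiring_0 mat) \<in> carrier_mat n n" "upper_triangular A"
    and B: "B \<in> carrier_mat n n" "upper_triangular B"
  shows "upper_triangular (A * B)"
    and "i < n \<Longrightarrow> (A * B) $$ (i, i) = A $$ (i, i) * B $$ (i, i)"
proof -
  show "upper_triangular (A * B)"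
  proof
    fix i j assume ij: "j < i" "i < dim_row (A * B)"
    hence "(A * B) $$ (i, j) = (\<Sum>k<n. A $$ (i, k) * B $$ (k, j))"
      using A B by (intro index_mult_mat_sum[of _ n n _ n]) auto
    also have "\<dots> = 0"
    proof (intro sum.neutral ballI)
      fix k assume "k \<in> {..<n}"
      show "A $$ (i, k) * B $$ (k, j) = 0"
        using A B ij \<open>k \<in> _\<close> upper_triangularD[of A k i] upper_triangularD[of B j k]
        by (cases "k < i") auto
    qed
    finally show "(A * B) $$ (i, j) = 0" .
  qed
next
  assume i: "i < n"
  hence "(A * B) $$ (i, i) = (\<Sum>k<n. A $$ (i, k) * B $$ (k, i))"
    using A B by (intro index_mult_mat_sum[of _ n n _ n]) auto
  also have "\<dots> = (\<Sum>k\<in>{i}. A $$ (i, k) * B $$ (k, i))"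
  proof (intro sum.mono_neutral_right ballI)
    fix k assume "k \<in> {..<n} - {i}"
    thus "A $$ (i, k) * B $$ (k, i) = 0"
      using A B i upper_triangularD[of A k i] upper_triangularD[of B i k]
      by (cases "k < i") auto
  qed (use i in auto)
  finally show "(A * B) $$ (i, i) = A $$ (i, i) * B $$ (i, i)" by simp
qed

lemma upper_triangular_pow:
  assumes "(A :: 'a::semiring_1 mat) \<in> carrier_mat n n" "upper_triangular A"
  shows "upper_triangular (A ^\<^sub>m k) \<and> (\<forall>i<n. (A ^\<^sub>m k) $$ (i, i) = A $$ (i, i) ^ k)"
proof (induction k)
  case (Suc k)
  with upper_triangular_mult[of "A ^\<^sub>m k" n A] assms show ?case
    by (simp add: power_commutes)
qed (use assms in \<open>auto simp: upper_triangular_def\<close>)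

lemma trace_mult_commute:
  assumes "(A :: 'a::comm_semiring_0 mat) \<in> carrier_mat n m" "B \<in> carrier_mat m n"
  shows "(\<Sum>i<n. (A * B) $$ (i, i)) = (\<Sum>i<m. (B * A) $$ (i, i))"
proof -
  have "(\<Sum>i<n. (A * B) $$ (i, i)) = (\<Sum>i<n. \<Sum>k<m. A $$ (i, k) * B $$ (k, i))"
    using assms by (intro sum.cong refl index_mult_mat_sum[of _ n m _ n]) auto
  also have "\<dots> = (\<Sum>k<m. \<Sum>i<n. B $$ (k, i) * A $$ (i, k))"
    by (subst sum.swap) (simp add: mult.commute)
  also have "\<dots> = (\<Sum>i<m. (B * A) $$ (i, i))"
    using assms by (intro sum.cong refl index_mult_mat_sum[of _ m n _ m, symmetric]) auto
  finally show ?thesis .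
qed

text \<open>One list must serve all traces and the determinant at once. Schur triangularization A =
  P B Q with Q inverse to P provides it: both quantities are invariant under similarity and are read
  off the diagonal of the triangular \<open>B\<close>.\<close>

lemma spectrum_ptr_det:
  assumes A: "A \<in> carrier_mat n n"
  obtains es where "length es = n" "\<And>k. ptr A k = (\<Sum>e\<leftarrow>es. e ^ k)"
    "\<And>z. Determinant.det (1\<^sub>m n - z \<cdot>\<^sub>m A) = (\<Prod>e\<leftarrow>es. 1 - z * e)"
    "\<And>e. e \<in> set es \<Longrightarrow> eigenvalue A e"
proof -
  obtain es where es: "char_poly A = (\<Prod>e\<leftarrow>es. [:- e, 1:])" "length es = n"
    using char_poly_factorized[OF A] by blast
  obtain B P Q where BPQ: "schur_decomposition A es = (B, P, Q)"
    by (metis prod_cases3)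
  from schur_decomposition[OF A es(1) BPQ]
  have wit: "similar_mat_wit A B P Q" and ut: "upper_triangular B" and dg: "diag_mat B = es"
    by auto
  note c = similar_mat_witD2[OF A wit]
  have dgi: "es ! i = B $$ (i, i)" if "i < n" for i
    using dg that c by (auto simp: diag_mat_def)
  have "ptr A k = (\<Sum>e\<leftarrow>es. e ^ k)" for k
  proof -
    have Bk: "B ^\<^sub>m k \<in> carrier_mat n n" using c by simp
    have "A ^\<^sub>m k = P * (B ^\<^sub>m k * Q)"
      unfolding similar_mat_wit_pow_id[OF wit, of k] using c Bk by (intro assoc_mult_mat) auto
    hence "ptr A k = (\<Sum>i<n. (P * (B ^\<^sub>m k * Q)) $$ (i, i))"
      unfolding ptr_def using A by simp
    also have "\<dots> = (\<Sum>i<n. ((B ^\<^sub>m k * Q) * P) $$ (i, i))"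
      using c Bk by (intro trace_mult_commute) auto
    also have "(B ^\<^sub>m k * Q) * P = B ^\<^sub>m k"
      using c Bk by (simp add: assoc_mult_mat[of "B ^\<^sub>m k" n n Q n P n])
    also have "(\<Sum>i<n. (B ^\<^sub>m k) $$ (i, i)) = (\<Sum>i<n. es ! i ^ k)"
      using upper_triangular_pow[of B n k] c ut dgi by (intro sum.cong) auto
    also have "\<dots> = (\<Sum>e\<leftarrow>es. e ^ k)"
      using es(2) by (simp add: sum_list_sum_nth lessThan_atLeast0)
    finally show ?thesis .
  qed
  moreover have "Determinant.det (1\<^sub>m n - z \<cdot>\<^sub>m A) = (\<Prod>e\<leftarrow>es. 1 - z * e)" for z
  proof -
    have "1\<^sub>m n - z \<cdot>\<^sub>m A = P * (1\<^sub>m n - z \<cdot>\<^sub>m B) * Q"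
    proof -
      have zB: "z \<cdot>\<^sub>m B \<in> carrier_mat n n" using c by simp
      have "P * (1\<^sub>m n - z \<cdot>\<^sub>m B) = P * 1\<^sub>m n - P * (z \<cdot>\<^sub>m B)"
        using c zB by (intro mult_minus_distrib_mat) auto
      also have "\<dots> * Q = P * 1\<^sub>m n * Q - P * (z \<cdot>\<^sub>m B) * Q"
        using c zB by (intro minus_mult_distrib_mat) auto
      finally have "P * (1\<^sub>m n - z \<cdot>\<^sub>m B) * Q = P * 1\<^sub>m n * Q - P * (z \<cdot>\<^sub>m B) * Q" .
      also have "P * 1\<^sub>m n * Q = 1\<^sub>m n" using c by simp
      also have "P * (z \<cdot>\<^sub>m B) * Q = z \<cdot>\<^sub>m (P * B * Q)"
        using c mult_smult_distrib[of P n n B n z] mult_smult_assoc_mat[of "P * B" n n Q n z] by simp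
      finally show ?thesis using c by simp
    qed
    hence "similar_mat_wit (1\<^sub>m n - z \<cdot>\<^sub>m A) (1\<^sub>m n - z \<cdot>\<^sub>m B) P Q"
      using c by (intro similar_mat_witI[of _ _ n] minus_carrier_mat smult_carrier_mat) auto
    hence "Determinant.det (1\<^sub>m n - z \<cdot>\<^sub>m A) = Determinant.det (1\<^sub>m n - z \<cdot>\<^sub>m B)"
      by (intro det_similar) (auto simp: similar_mat_def)
    also have "\<dots> = prod_list (diag_mat (1\<^sub>m n - z \<cdot>\<^sub>m B))"
      using c ut by (intro det_upper_triangular[of _ n]) (auto simp: upper_triangular_def)
    also have "diag_mat (1\<^sub>m n - z \<cdot>\<^sub>m B) = map (\<lambda>e. 1 - z * e) es"
      using c es(2) dgi by (intro nth_equalityI) (auto simp: diag_mat_def)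
    finally show ?thesis .
  qed
  moreover have "eigenvalue A e" if "e \<in> set es" for e
    unfolding eigenvalue_root_char_poly[OF A] es(1) poly_prod_list
    using that by (auto simp: prod_list_zero_iff o_def)
  ultimately show ?thesis using that es(2) by blast
qed

text \<open>\<open>g\<close> preserves the norm of an eigenvector because its adjoint inverts it,
  yet also scales that norm by |e|.\<close>

lemma eigenvalue_unitary_norm:
  assumes g: "g \<in> carrier (unitary_group N)" and ev: "eigenvalue g e"
  shows "norm e = 1"
proof -
  have G: "g \<in> carrier_mat N N" "mat_adjoint g * g = 1\<^sub>m N"
    using g by (auto simp: unitary_group_def)
  obtain v where v: "v \<in> carrier_vec N" "v \<noteq> 0\<^sub>v N" "g *\<^sub>v v = e \<cdot>\<^sub>v v"
    using ev G by (auto simp: eigenvalue_def eigenvector_def)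
  \<comment> \<open>The eigenvector becomes a one-column matrix, so that adjoints and associativity
    of matrix products apply to it.\<close>
  define V where "V = mat N 1 (\<lambda>(i, j). v $ i)"
  have V: "V \<in> carrier_mat N 1" by (simp add: V_def)
  have gV: "g * V = e \<cdot>\<^sub>m V"
  proof (rule eq_matI)
    fix i j assume ij: "i < dim_row (e \<cdot>\<^sub>m V)" "j < dim_col (e \<cdot>\<^sub>m V)"
    hence "(g * V) $$ (i, j) = (g *\<^sub>v v) $ i"
      using G v(1) by (auto simp: V_def scalar_prod_def)
    thus "(g * V) $$ (i, j) = (e \<cdot>\<^sub>m V) $$ (i, j)" using v ij by (simp add: V_def)
  qed (use G V in auto)
  have ad: "mat_adjoint g \<in> carrier_mat N N" "mat_adjoint V \<in> carrier_mat 1 N"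
    using G V by (auto intro: mat_adjoint_carrier)
  have nrm: "(mat_adjoint X * X) $$ (0, 0) = of_real (\<Sum>i<N. (norm (X $$ (i, 0)))\<^sup>2)"
    if "X \<in> carrier_mat N 1" for X :: "complex mat"
    using that
    by (subst index_mult_mat_sum[of _ 1 N _ 1])
       (auto simp: mat_adjoint_eq complex_norm_square mult.commute simp del: of_real_power)
  have gV': "g * V \<in> carrier_mat N 1" using G V by simp
  have "mat_adjoint (g * V) * (g * V) = mat_adjoint V * (mat_adjoint g * (g * V))"
    unfolding mat_adjoint_mult[OF G(1) V] by (rule assoc_mult_mat[OF ad(2,1) gV'])
  also have "mat_adjoint g * (g * V) = mat_adjoint g * g * V"
    by (rule assoc_mult_mat[OF ad(1) G(1) V, symmetric])
  also have "\<dots> = V" unfolding G(2) using V by simp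
  finally have "(\<Sum>i<N. (norm ((e \<cdot>\<^sub>m V) $$ (i, 0)))\<^sup>2) = (\<Sum>i<N. (norm (V $$ (i, 0)))\<^sup>2)"
    using nrm[OF V] nrm[OF gV'] unfolding gV by (metis of_real_eq_iff)
  also have "(\<Sum>i<N. (norm ((e \<cdot>\<^sub>m V) $$ (i, 0)))\<^sup>2) = (norm e)\<^sup>2 * (\<Sum>i<N. (norm (V $$ (i, 0)))\<^sup>2)"
    using V by (simp add: norm_mult power_mult_distrib sum_distrib_left)
  finally have *: "((norm e)\<^sup>2 - 1) * (\<Sum>i<N. (norm (V $$ (i, 0)))\<^sup>2) = 0" by (simp add: algebra_simps)
  have "(\<Sum>i<N. (norm (V $$ (i, 0)))\<^sup>2) \<noteq> 0"
  proof
    assume "(\<Sum>i<N. (norm (V $$ (i, 0)))\<^sup>2) = 0"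
    hence "\<forall>i<N. v $ i = 0" by (subst (asm) sum_nonneg_eq_0_iff) (auto simp: V_def)
    with v show False by (auto intro!: eq_vecI)
  qed
  with * have "(norm e)\<^sup>2 = 1" by simp
  thus ?thesis by (simp add: power2_eq_1_iff) (metis norm_ge_zero not_one_le_zero neg_0_le_iff_le)
qed

text \<open>Serves twice: as the crude bound on moments of large degree and as the source of the
  dominating constant in the passage to the limit.\<close>

lemma norm_ptr_unitary_le:
  assumes g: "g \<in> carrier (unitary_group N)"
  shows "norm (ptr g k) \<le> N"
proof -
  have "g \<in> carrier_mat N N" using g by (auto simp: unitary_group_def)
  then obtain es where es: "length es = N" "\<And>k. ptr g k = (\<Sum>e\<leftarrow>es. e ^ k)"
    "\<And>e. e \<in> set es \<Longrightarrow> eigenvalue g e"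
    using spectrum_ptr_det by metis
  have "norm (ptr g k) \<le> (\<Sum>e\<leftarrow>es. norm (e ^ k))"
    unfolding es(2) by (induction es) (auto intro: order_trans[OF norm_triangle_ineq])
  also have "\<dots> = (\<Sum>e\<leftarrow>es. 1)"
    using eigenvalue_unitary_norm[OF g es(3)]
    by (intro arg_cong[of _ _ sum_list] map_cong) (auto simp: norm_power)
  finally show ?thesis using es(1) by (simp add: sum_list_triv)
qed

lemma pow_mat_Suc_left:
  assumes "A \<in> carrier_mat n n"
  shows "A ^\<^sub>m Suc k = A * A ^\<^sub>m k"
proof (induction k)
  case (Suc k)
  have "A ^\<^sub>m Suc (Suc k) = A * A ^\<^sub>m k * A" using Suc by simp
  also have "\<dots> = A * A ^\<^sub>m Suc k"
    using assms by (simp add: assoc_mult_mat[of A n n "A ^\<^sub>m k" n A n])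
  finally show ?case .
qed (use assms in auto)

lemma mat_adjoint_pow:
  assumes A: "A \<in> carrier_mat n n"
  shows "mat_adjoint (A ^\<^sub>m k :: complex mat) = mat_adjoint A ^\<^sub>m k"
proof (induction k)
  case 0
  show ?case using A by (intro eq_matI) (auto simp: mat_adjoint_eq)
next
  case (Suc k)
  have "mat_adjoint (A ^\<^sub>m Suc k) = mat_adjoint A * mat_adjoint (A ^\<^sub>m k)"
    using A mat_adjoint_mult[of "A ^\<^sub>m k" n n A n] by simp
  also have "\<dots> = mat_adjoint A ^\<^sub>m Suc k"
    unfolding Suc by (rule pow_mat_Suc_left[symmetric, OF mat_adjoint_carrier[OF A]])
  finally show ?case .
qed

lemma ptr_adjoint:
  assumes A: "A \<in> carrier_mat n n"
  shows "ptr (mat_adjoint A) k = cnj (ptr A k)"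
  using A unfolding ptr_def mat_adjoint_pow[OF A, symmetric]
  by (auto simp: mat_adjoint_eq intro!: sum.cong)

section \<open>Power series of the logarithmic derivative\<close>

lemma has_field_derivative_prod_list_linear:
  fixes z :: complex
  assumes "\<And>e. e \<in> set es \<Longrightarrow> 1 - z * e \<noteq> 0"
  shows "((\<lambda>z. \<Prod>e\<leftarrow>es. 1 - z * e) has_field_derivative
           (\<Prod>e\<leftarrow>es. 1 - z * e) * (\<Sum>e\<leftarrow>es. - e / (1 - z * e))) (at z)"
  using assms
proof (induction es)
  case (Cons e es)
  hence nz: "1 - z * e \<noteq> 0" by simp
  from Cons have IH: "((\<lambda>z. \<Prod>e\<leftarrow>es. 1 - z * e) has_field_derivative
           (\<Prod>e\<leftarrow>es. 1 - z * e) * (\<Sum>e\<leftarrow>es. - e / (1 - z * e))) (at z)" by simp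
  have "((\<lambda>z. (1 - z * e) * (\<Prod>e\<leftarrow>es. 1 - z * e)) has_field_derivative
         (- e) * (\<Prod>e\<leftarrow>es. 1 - z * e) +
         (\<Prod>e\<leftarrow>es. 1 - z * e) * (\<Sum>e\<leftarrow>es. - e / (1 - z * e)) * (1 - z * e)) (at z)"
    by (rule DERIV_mult'[OF _ IH, THEN DERIV_cong]) (auto intro!: derivative_eq_intros)
  moreover have "(- e) * (\<Prod>e\<leftarrow>es. 1 - z * e) +
         (\<Prod>e\<leftarrow>es. 1 - z * e) * (\<Sum>e\<leftarrow>es. - e / (1 - z * e)) * (1 - z * e)
     = (\<Prod>e\<leftarrow>e # es. 1 - z * e) * (\<Sum>e\<leftarrow>e # es. - e / (1 - z * e))"
    using nz by (simp add: field_simps)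
  ultimately show ?case by simp
qed simp

lemma sums_sum_list:
  fixes f :: "'a \<Rightarrow> nat \<Rightarrow> 'b::real_normed_vector"
  assumes "\<And>x. x \<in> set xs \<Longrightarrow> f x sums s x"
  shows "(\<lambda>k. \<Sum>x\<leftarrow>xs. f x k) sums (\<Sum>x\<leftarrow>xs. s x)"
  using assms by (induction xs) (auto intro: sums_add)

text \<open>\<open>chi N g\<close> is the product of 1 - z e over the eigenvalues e of the inverse
  of \<open>g\<close>. These lie on the unit circle, so inside the disc no factor vanishes and each
  -e / (1 - z e) is a geometric series. Traces of powers of the inverse are conjugates of those of
  \<open>g\<close>, and differentiation shifts the index by one.\<close>

lemma logderiv_chi_sums:
  assumes g: "g \<in> carrier (unitary_group N)" and z: "norm z < 1"
  shows "(\<lambda>k. - cnj (ptr g (Suc k)) * z ^ k) sums (deriv (chi N g) z / chi N g z)"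
proof -
  have G: "g \<in> carrier_mat N N" using g by (auto simp: unitary_group_def)
  define h where "h = inv\<^bsub>unitary_group N\<^esub> g"
  have hg: "h = mat_adjoint g" unfolding h_def by (rule inv_unitary_group[OF g])
  have h: "h \<in> carrier (unitary_group N)"
    unfolding h_def by (rule group.inv_closed[OF group_unitary_group g])
  hence H: "h \<in> carrier_mat N N" by (auto simp: unitary_group_def)
  obtain es where es: "\<And>k. ptr h k = (\<Sum>e\<leftarrow>es. e ^ k)"
    "\<And>z. Determinant.det (1\<^sub>m N - z \<cdot>\<^sub>m h) = (\<Prod>e\<leftarrow>es. 1 - z * e)"
    "\<And>e. e \<in> set es \<Longrightarrow> eigenvalue h e"
    using spectrum_ptr_det[OF H] by metis
  have e1: "norm (z * e) < 1" if "e \<in> set es" for e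
    using eigenvalue_unitary_norm[OF h es(3)[OF that]] z by (simp add: norm_mult)
  have nz: "1 - z * e \<noteq> 0" if "e \<in> set es" for e
    using e1[OF that] by auto
  have chi: "chi N g = (\<lambda>z. \<Prod>e\<leftarrow>es. 1 - z * e)"
    by (rule ext) (simp add: chi_def es(2) flip: h_def)
  have nz': "(\<Prod>e\<leftarrow>es. 1 - z * e) \<noteq> 0" using nz by (auto simp: prod_list_zero_iff)
  have "deriv (chi N g) z = (\<Prod>e\<leftarrow>es. 1 - z * e) * (\<Sum>e\<leftarrow>es. - e / (1 - z * e))"
    unfolding chi using nz by (intro DERIV_imp_deriv has_field_derivative_prod_list_linear) auto
  hence "deriv (chi N g) z / chi N g z = (\<Sum>e\<leftarrow>es. - e / (1 - z * e))"
    using nz' by (simp add: chi)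
  moreover have "(\<lambda>k. \<Sum>e\<leftarrow>es. - e * (z * e) ^ k) sums (\<Sum>e\<leftarrow>es. - e / (1 - z * e))"
  proof (rule sums_sum_list)
    fix e assume "e \<in> set es"
    from sums_mult[OF geometric_sums[OF e1[OF this]], of "- e"]
    show "(\<lambda>k. - e * (z * e) ^ k) sums (- e / (1 - z * e))" by simp
  qed
  moreover have "(\<Sum>e\<leftarrow>es. - e * (z * e) ^ k) = - cnj (ptr g (Suc k)) * z ^ k" for k
  proof -
    have "(\<Sum>e\<leftarrow>es. - e * (z * e) ^ k) = - (\<Sum>e\<leftarrow>es. e ^ Suc k) * z ^ k"
      by (induction es) (auto simp: algebra_simps power_mult_distrib)
    also have "(\<Sum>e\<leftarrow>es. e ^ Suc k) = cnj (ptr g (Suc k))"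
      using es(1)[of "Suc k"] ptr_adjoint[OF G, of "Suc k"] by (simp add: hg)
    finally show ?thesis .
  qed
  ultimately show ?thesis by simp
qed

section \<open>Invariance of Haar measure\<close>

lemma pow_mat_add:
  assumes "A \<in> carrier_mat n n"
  shows "A ^\<^sub>m (i + j) = A ^\<^sub>m i * A ^\<^sub>m j"
proof (induction j)
  case (Suc j)
  thus ?case using assms by (simp add: assoc_mult_mat[of "A ^\<^sub>m i" n n "A ^\<^sub>m j" n A n])
qed (use assms in auto)

lemma pow_mat_smult:
  assumes "(A :: 'a::comm_ring_1 mat) \<in> carrier_mat n n"
  shows "(c \<cdot>\<^sub>m A) ^\<^sub>m k = c ^ k \<cdot>\<^sub>m A ^\<^sub>m k"
proof (induction k)
  case 0
  show ?case using assms by (intro eq_matI) auto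
next
  case (Suc k)
  have "(c \<cdot>\<^sub>m A) ^\<^sub>m Suc k = (c ^ k \<cdot>\<^sub>m A ^\<^sub>m k) * (c \<cdot>\<^sub>m A)" using Suc by simp
  also have "\<dots> = c \<cdot>\<^sub>m (c ^ k \<cdot>\<^sub>m (A ^\<^sub>m k * A))"
    using assms mult_smult_distrib[of "c ^ k \<cdot>\<^sub>m A ^\<^sub>m k" n n A n c] mult_smult_assoc_mat[of "A ^\<^sub>m k" n n A n "c ^ k"]
    by simp
  also have "\<dots> = c ^ Suc k \<cdot>\<^sub>m A ^\<^sub>m Suc k" using assms by (intro eq_matI) (auto simp: mult_ac)
  finally show ?case .
qed

text \<open>Testing on e_c gives the diagonal entries; testing on (e_c + w e_d) / sqrt 2 with w = 1
  and w = i then separates \<open>H c d\<close> from \<open>H d c\<close>. It passes from directions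
  tangent to U(N) to single matrix units.\<close>

lemma polarization_zero:
  fixes H :: "nat \<Rightarrow> nat \<Rightarrow> complex"
  assumes H: "\<And>v. (\<Sum>i<N. v i * cnj (v i)) = 1 \<Longrightarrow> (\<Sum>c<N. \<Sum>d<N. v c * cnj (v d) * H c d) = 0"
    and cd: "c < N" "d < N"
  shows "H c d = 0"
proof -
  have delta: "(\<Sum>k<N. (if k = c then a else 0) * F k) = a * F c"
    if "c < N" for c a and F :: "nat \<Rightarrow> complex"
  proof -
    have "(\<Sum>k<N. (if k = c then a else 0) * F k) = (\<Sum>k<N. if k = c then a * F c else 0)"
      by (intro sum.cong) auto
    thus ?thesis using that by simp
  qed
  \<comment> \<open>The inner sum is the conjugate of a sum linear in \<open>v\<close>, so one
    evaluation rule for linear sums (\<open>delta\<close>, later \<open>s\<close>) handles both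
    summations.\<close>
  have regroup: "(\<Sum>c<N. \<Sum>d<N. v c * cnj (v d) * H c d) = (\<Sum>c<N. v c * cnj (\<Sum>d<N. v d * cnj (H c d)))" for v
    by (simp add: sum_distrib_left mult.assoc)
  have diag: "H c c = 0" if "c < N" for c
    using H[of "\<lambda>k. if k = c then 1 else 0"] that unfolding regroup by (simp only: delta) simp
  show ?thesis
  proof (cases "c = d")
    case False
    define \<sigma> where "\<sigma> = complex_of_real (1 / sqrt 2)"
    have \<sigma>': "cnj \<sigma> = \<sigma>" by (simp add: \<sigma>_def)
    have eq: "cnj w * H c d + w * H d c = 0" if w: "w * cnj w = 1" for w
    proof -
      define v where "v = (\<lambda>k. (if k = c then \<sigma> else 0) + (if k = d then \<sigma> * w else 0))"
      have s: "(\<Sum>k<N. v k * F k) = \<sigma> * (F c + w * F d)" for F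
        unfolding v_def distrib_right sum.distrib by (simp only: delta cd) (simp add: algebra_simps)
      have h: "\<sigma> * \<sigma> = 1 / 2"
        by (simp add: \<sigma>_def complex_eq_iff)
      have vc: "v c = \<sigma>" "v d = \<sigma> * w"
        using False by (auto simp: v_def)
      have "(\<Sum>i<N. v i * cnj (v i)) = \<sigma> * \<sigma> * (1 + w * cnj w)"
        unfolding s vc by (simp add: \<sigma>' algebra_simps)
      also have "\<dots> = 1" unfolding h w by simp
      finally have "0 = (\<Sum>c<N. \<Sum>d<N. v c * cnj (v d) * H c d)" using H by simp
      also have "\<dots> = \<sigma> * \<sigma> *
          (H c c + cnj w * H c d + w * H d c + w * cnj w * H d d)"
        unfolding regroup s by (simp add: \<sigma>' algebra_simps)
      finally show ?thesis using diag[OF cd(1)] diag[OF cd(2)] unfolding h by simp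
    qed
    from eq[of 1] eq[of \<i>] show ?thesis by (simp add: complex_eq_iff)
  qed (use diag cd in auto)
qed

section \<open>Integration against Haar measure\<close>

locale haar =
  fixes N :: nat and \<mu> :: "complex mat measure"
  assumes haar: "normalized_haar_measure N \<mu>"
begin

abbreviation "U \<equiv> carrier (unitary_group N)"

sublocale prob_space \<mu>
  using haar by (simp add: normalized_haar_measure_def)

lemma sets_haar: "sets \<mu> = sets (unitary_borel N)"
  using haar by (simp add: normalized_haar_measure_def)

lemma space_haar [simp]: "space \<mu> = U"
  using sets_eq_imp_space_eq[OF sets_haar] by (simp add: unitary_borel_def)

lemma U_carrier: "g \<in> U \<Longrightarrow> g \<in> carrier_mat N N"
  by (simp add: unitary_group_def)

lemma U_mult: "u \<in> U \<Longrightarrow> g \<in> U \<Longrightarrow> u * g \<in> U"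
  using monoid.m_closed[OF group.is_monoid[OF group_unitary_group]] by (fastforce simp: unitary_group_def)

lemma entry_measurable:
  assumes "i < N" "j < N"
  shows "(\<lambda>g. g $$ (i, j)) \<in> borel_measurable \<mu>"
proof -
  have "(\<lambda>g. \<lambda>ij\<in>{..<N} \<times> {..<N}. g $$ ij) \<in> \<mu> \<rightarrow>\<^sub>M (\<Pi>\<^sub>M ij\<in>{..<N} \<times> {..<N}. borel)"
    unfolding measurable_cong_sets[OF sets_haar refl] unitary_borel_def
    by (rule measurable_vimage_algebra1) (auto simp: space_PiM)
  from measurable_compose[OF this measurable_component_singleton[of "(i, j)"]] assms
  show ?thesis by simp
qed

lemma mult_left_measurable:
  assumes u: "u \<in> U"
  shows "(\<lambda>g. u * g) \<in> \<mu> \<rightarrow>\<^sub>M \<mu>"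
proof -
  have "(\<lambda>g. u * g) \<in> \<mu> \<rightarrow>\<^sub>M unitary_borel N"
    unfolding unitary_borel_def
  proof (rule measurable_vimage_algebra2)
    show "(\<lambda>g. u * g) \<in> space \<mu> \<rightarrow> U" using u by (auto intro: U_mult)
    show "(\<lambda>g. \<lambda>ij\<in>{..<N} \<times> {..<N}. (u * g) $$ ij) \<in> \<mu> \<rightarrow>\<^sub>M (\<Pi>\<^sub>M ij\<in>{..<N} \<times> {..<N}. borel)"
    proof (rule measurable_restrict)
      fix ij assume "ij \<in> {..<N} \<times> {..<N}"
      then obtain i j where ij: "ij = (i, j)" "i < N" "j < N" by auto
      have "(\<lambda>g. (u * g) $$ (i, j)) \<in> borel_measurable \<mu> \<longleftrightarrow>
            (\<lambda>g. \<Sum>k<N. u $$ (i, k) * g $$ (k, j)) \<in> borel_measurable \<mu>"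
        using u ij by (intro measurable_cong index_mult_mat_sum[of _ N N _ N]) (auto dest: U_carrier)
      also have "\<dots>"
        by (intro borel_measurable_sum borel_measurable_times borel_measurable_const entry_measurable)
           (use ij in auto)
      finally show "(\<lambda>g. (u * g) $$ ij) \<in> borel_measurable \<mu>" using ij by simp
    qed
  qed
  thus ?thesis using measurable_cong_sets[OF refl sets_haar] by blast
qed

text \<open>Invariance is given for translates of sets, whereas a pushforward uses preimages. The
  two meet because \<open>A\<close> is the translate by \<open>u\<close> of its own preimage under
  left multiplication by \<open>u\<close>.\<close>

lemma distr_mult_left:
  assumes u: "u \<in> U"
  shows "distr \<mu> \<mu> (\<lambda>g. u * g) = \<mu>"
proof (rule measure_eqI)
  fix A assume "A \<in> sets (distr \<mu> \<mu> (\<lambda>g. u * g))"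
  hence A: "A \<in> sets \<mu>" by simp
  define B where "B = (\<lambda>g. u * g) -` A \<inter> space \<mu>"
  have B: "B \<in> sets \<mu>" unfolding B_def by (rule measurable_sets[OF mult_left_measurable[OF u] A])
  define w where "w = inv\<^bsub>unitary_group N\<^esub> u"
  interpret G: group "unitary_group N" by (rule group_unitary_group)
  have w: "w \<in> U" unfolding w_def using u by simp
  have uw: "u * (w * g) = g" "w * (u * g) = g" if "g \<in> U" for g
    using G.inv_solve_left[of "w * g" u g] G.inv_solve_left'[of g w "u * g"] u w that U_mult
      G.m_assoc[of u w g] G.m_assoc[of w u g] G.r_inv[OF u] G.l_inv[OF u] G.l_one[OF that]
    unfolding w_def by (auto simp: unitary_group_def)
  have "A = u <#\<^bsub>unitary_group N\<^esub> B"
  proof (intro equalityI subsetI)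
    fix g assume g: "g \<in> A"
    hence gU: "g \<in> U" using sets.sets_into_space[OF A] by auto
    hence "w * g \<in> B" using g w uw by (auto simp: B_def intro: U_mult)
    thus "g \<in> u <#\<^bsub>unitary_group N\<^esub> B"
      using uw(1)[OF gU] unfolding l_coset_def
      by (auto simp: unitary_group_def intro!: bexI[of _ "w * g"])
  next
    fix g assume "g \<in> u <#\<^bsub>unitary_group N\<^esub> B"
    thus "g \<in> A" by (auto simp: l_coset_def unitary_group_def B_def)
  qed
  hence "emeasure \<mu> A = emeasure \<mu> B"
    using haar u B by (auto simp: normalized_haar_measure_def)
  thus "emeasure (distr \<mu> \<mu> (\<lambda>g. u * g)) A = emeasure \<mu> A"
    using A mult_left_measurable[OF u] by (simp add: emeasure_distr B_def)
qed simp

lemma integral_mult_left: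
  fixes f :: "complex mat \<Rightarrow> complex"
  assumes u: "u \<in> U" and f: "f \<in> borel_measurable \<mu>"
  shows "(\<integral>g. f (u * g) \<partial>\<mu>) = (\<integral>g. f g \<partial>\<mu>)"
  using integral_distr[OF mult_left_measurable[OF u] f] distr_mult_left[OF u] by simp

lemma integrable_bounded:
  fixes f :: "complex mat \<Rightarrow> complex"
  assumes "f \<in> borel_measurable \<mu>" "\<And>g. g \<in> U \<Longrightarrow> norm (f g) \<le> C"
  shows "integrable \<mu> f"
  using assms by (intro integrable_const_bound[of _ C] AE_I2) auto

lemma entry_le_1:
  assumes g: "g \<in> U" and "i < N" "j < N"
  shows "norm (g $$ (i, j)) \<le> 1"
proof -
  have G: "g \<in> carrier_mat N N" "g * mat_adjoint g = 1\<^sub>m N"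
    using g by (auto simp: unitary_group_def)
  have "(g * mat_adjoint g) $$ (i, i) = (\<Sum>k<N. g $$ (i, k) * mat_adjoint g $$ (k, i))"
    using G assms by (intro index_mult_mat_sum[of _ N N _ N]) (auto intro: mat_adjoint_carrier)
  also have "\<dots> = of_real (\<Sum>k<N. (norm (g $$ (i, k)))\<^sup>2)"
    using G assms by (simp add: mat_adjoint_eq complex_norm_square del: of_real_power)
  finally have "1 = (\<Sum>k<N. (norm (g $$ (i, k)))\<^sup>2)"
    using G assms by (metis index_one_mat(1) of_real_eq_1_iff)
  moreover have "(norm (g $$ (i, j)))\<^sup>2 \<le> (\<Sum>k<N. (norm (g $$ (i, k)))\<^sup>2)"
    using assms by (intro member_le_sum) auto
  ultimately show ?thesis by (simp add: power_le_one_iff)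
qed

section \<open>One-parameter subgroups and the gradient calculus\<close>

definition unit_length :: "(nat \<Rightarrow> complex) \<Rightarrow> bool" where
  "unit_length v \<longleftrightarrow> (\<Sum>i<N. v i * cnj (v i)) = 1"

lemma unit_le_1: "unit_length v \<Longrightarrow> i < N \<Longrightarrow> norm (v i) \<le> 1"
proof -
  assume v: "unit_length v" and i: "i < N"
  have "1 = (\<Sum>k<N. complex_of_real ((norm (v k))\<^sup>2))"
    using v unfolding unit_length_def complex_norm_square by simp
  hence "1 = (\<Sum>k<N. (norm (v k))\<^sup>2)"
    by (metis of_real_sum of_real_eq_1_iff)
  moreover have "(norm (v i))\<^sup>2 \<le> (\<Sum>k<N. (norm (v k))\<^sup>2)"
    using i by (intro member_le_sum) auto
  ultimately show ?thesis by (simp add: power_le_one_iff)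
qed

text \<open>For a unit vector \<open>v\<close> this is exp(i t P), with P the orthogonal projection
  onto \<open>v\<close>: P^2 = P collapses the exponential series.\<close>

definition rot :: "(nat \<Rightarrow> complex) \<Rightarrow> real \<Rightarrow> complex mat" where
  "rot v t = mat N N (\<lambda>(i, j). (if i = j then 1 else 0) + (cis t - 1) * v i * cnj (v j))"

lemma rot_carrier: "rot v t \<in> carrier_mat N N"
  by (simp add: rot_def)

lemma rot_mult:
  assumes v: "unit_length v"
  shows "rot v s * rot v t = rot v (s + t)"
proof (rule eq_matI)
  fix i j assume "i < dim_row (rot v (s + t))" "j < dim_col (rot v (s + t))"
  hence ij: "i < N" "j < N" by (auto simp: rot_def)
  define a where "a = cis s - 1"
  define b where "b = cis t - 1"
  have "(rot v s * rot v t) $$ (i, j) =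
      (\<Sum>k<N. ((if i = k then 1 else 0) + a * v i * cnj (v k)) * ((if k = j then 1 else 0) + b * v k * cnj (v j)))"
    using ij by (subst index_mult_mat_sum[of _ N N _ N]) (auto simp: rot_def a_def b_def)
  also have "\<dots> = (\<Sum>k<N. if k = i then (if i = j then 1 else 0) + b * v i * cnj (v j) else 0)
       + (\<Sum>k<N. if k = j then a * v i * cnj (v j) else 0)
       + a * b * v i * cnj (v j) * (\<Sum>k<N. v k * cnj (v k))"
    unfolding sum_distrib_left sum.distrib[symmetric] by (intro sum.cong) (auto simp: algebra_simps)
  also have "\<dots> = (if i = j then 1 else 0) + (b + a + a * b) * v i * cnj (v j)"
    using ij v by (simp add: unit_length_def algebra_simps)
  also have "b + a + a * b = cis (s + t) - 1"
    by (simp add: a_def b_def algebra_simps flip: cis_mult)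
  finally show "(rot v s * rot v t) $$ (i, j) = rot v (s + t) $$ (i, j)"
    using ij by (simp add: rot_def)
qed (auto simp: rot_def)

lemma rot_0: "rot v 0 = 1\<^sub>m N"
  by (rule eq_matI) (auto simp: rot_def)

lemma rot_U:
  assumes v: "unit_length v"
  shows "rot v t \<in> U"
proof -
  have "mat_adjoint (rot v t) = rot v (- t)"
    by (rule eq_matI) (auto simp: rot_def mat_adjoint_eq cis_cnj)
  thus ?thesis
    using rot_mult[OF v, of t "- t"] rot_mult[OF v, of "- t" t]
    by (simp add: unitary_group_def rot_0 rot_carrier)
qed

text \<open>The derivative in the direction i P with P as in \<open>rot\<close>: expanding P into
  the v_c conj(v_d) E_cd turns it into this combination of the \<open>G c d\<close>.\<close>

definition form :: "(nat \<Rightarrow> complex) \<Rightarrow> (nat \<Rightarrow> nat \<Rightarrow> complex mat \<Rightarrow> complex) \<Rightarrow> complex mat \<Rightarrow> complex" where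
  "form v G g = \<i> * (\<Sum>c<N. \<Sum>d<N. v c * cnj (v d) * G c d g)"

text \<open>Such functions are integrable here and, unlike integrable functions in general, closed
  under products, as the product rule for gradients requires.\<close>

definition bdd_meas :: "(complex mat \<Rightarrow> complex) \<Rightarrow> bool" where
  "bdd_meas f \<longleftrightarrow> f \<in> borel_measurable \<mu> \<and> (\<exists>C. \<forall>g\<in>U. norm (f g) \<le> C)"

lemma bdd_meas_integrable: "bdd_meas f \<Longrightarrow> integrable \<mu> f"
  unfolding bdd_meas_def using integrable_bounded by blast

lemma bdd_meas_bound: "bdd_meas f \<Longrightarrow> \<exists>C\<ge>0. \<forall>g\<in>U. norm (f g) \<le> C"
  unfolding bdd_meas_def by (meson norm_ge_zero order_trans linear)

lemma bdd_meas_const: "bdd_meas (\<lambda>_. c)"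
  by (auto simp: bdd_meas_def)

lemma bdd_meas_add: "bdd_meas f \<Longrightarrow> bdd_meas h \<Longrightarrow> bdd_meas (\<lambda>g. f g + h g)"
  unfolding bdd_meas_def
  by (auto intro!: borel_measurable_add) (metis norm_triangle_le add_mono)

lemma bdd_meas_mult:
  assumes f: "bdd_meas f" and h: "bdd_meas h"
  shows "bdd_meas (\<lambda>g. f g * h g)"
proof -
  obtain C1 C2 where "C1 \<ge> 0" and C: "\<forall>g\<in>U. norm (f g) \<le> C1" "\<forall>g\<in>U. norm (h g) \<le> C2"
    using bdd_meas_bound[OF f] bdd_meas_bound[OF h] by blast
  hence "\<forall>g\<in>U. norm (f g * h g) \<le> C1 * C2"
    unfolding norm_mult by (intro ballI mult_mono) auto
  with f h show ?thesis unfolding bdd_meas_def by (auto intro!: borel_measurable_times)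
qed

lemma bdd_meas_cnj:
  assumes "bdd_meas f"
  shows "bdd_meas (\<lambda>g. cnj (f g))"
proof -
  have "cnj \<in> borel_measurable borel"
    by (intro borel_measurable_continuous_onI continuous_on_cnj continuous_on_id)
  with assms show ?thesis
    unfolding bdd_meas_def using measurable_compose[of f \<mu> borel cnj borel] by simp
qed

lemma bdd_meas_uminus: "bdd_meas f \<Longrightarrow> bdd_meas (\<lambda>g. - f g)"
  unfolding bdd_meas_def by auto

lemma bdd_meas_sum: "(\<And>x. x \<in> A \<Longrightarrow> bdd_meas (f x)) \<Longrightarrow> bdd_meas (\<lambda>g. \<Sum>x\<in>A. f x g)"
  by (induction A rule: infinite_finite_induct) (auto intro: bdd_meas_const bdd_meas_add)

lemma bdd_meas_cong: "(\<And>g. g \<in> U \<Longrightarrow> f g = h g) \<Longrightarrow> bdd_meas f = bdd_meas h"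
  unfolding bdd_meas_def by (subst measurable_cong[of \<mu> f h]) auto

lemma bdd_meas_entry: "i < N \<Longrightarrow> j < N \<Longrightarrow> bdd_meas (\<lambda>g. g $$ (i, j))"
  unfolding bdd_meas_def using entry_le_1 entry_measurable by blast

text \<open>\<open>G c d\<close> is the complexified derivative of \<open>f\<close> along the elementary matrix \<open>E\<^bsub>c d\<^esub>\<close>; it is defined through
  the derivatives along the one-parameter groups \<^term>\<open>rot v\<close> generated by \<open>\<i> v v\<^sup>*\<close>, with a remainder
  that is uniform in \<open>g\<close>, so that it survives integration.\<close>
definition has_gradient :: "(complex mat \<Rightarrow> complex) \<Rightarrow> (nat \<Rightarrow> nat \<Rightarrow> complex mat \<Rightarrow> complex) \<Rightarrow> bool" where
  "has_gradient f G \<longleftrightarrow> bdd_meas f \<and> (\<forall>c<N. \<forall>d<N. bdd_meas (G c d)) \<and>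
     (\<exists>C\<ge>0. \<forall>g\<in>U. \<forall>v t. unit_length v \<longrightarrow> \<bar>t\<bar> \<le> 1 \<longrightarrow>
        norm (f (rot v t * g) - f g - of_real t * form v G g) \<le> C * t\<^sup>2)"

lemma has_gradientI:
  assumes "bdd_meas f" "\<And>c d. c < N \<Longrightarrow> d < N \<Longrightarrow> bdd_meas (G c d)" "C \<ge> 0"
    "\<And>g v t. g \<in> U \<Longrightarrow> unit_length v \<Longrightarrow> \<bar>t\<bar> \<le> 1 \<Longrightarrow>
        norm (f (rot v t * g) - f g - of_real t * form v G g) \<le> C * t\<^sup>2"
  shows "has_gradient f G"
  unfolding has_gradient_def using assms by blast

lemma has_gradientD:
  assumes "has_gradient f G"
  shows "bdd_meas f" "\<And>c d. c < N \<Longrightarrow> d < N \<Longrightarrow> bdd_meas (G c d)" "\<forall>c<N. \<forall>d<N. bdd_meas (G c d)"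
  using assms unfolding has_gradient_def by blast+

lemma has_gradientE:
  assumes "has_gradient f G"
  obtains C where "C \<ge> 0" "\<And>g v t. g \<in> U \<Longrightarrow> unit_length v \<Longrightarrow> \<bar>t\<bar> \<le> 1 \<Longrightarrow>
        norm (f (rot v t * g) - f g - of_real t * form v G g) \<le> C * t\<^sup>2"
  using assms unfolding has_gradient_def by blast

text \<open>Uniformity in both the direction and the point lets the product rule absorb its mixed
  term into a quadratic remainder.\<close>

lemma form_bound:
  assumes "\<forall>c<N. \<forall>d<N. bdd_meas (G c d)"
  obtains C where "C \<ge> 0" "\<And>v g. unit_length v \<Longrightarrow> g \<in> U \<Longrightarrow> norm (form v G g) \<le> C"
proof -
  have "\<forall>c. \<exists>f. \<forall>d. c < N \<longrightarrow> d < N \<longrightarrow> f d \<ge> 0 \<and> (\<forall>g\<in>U. norm (G c d g) \<le> f d)"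
    using bdd_meas_bound assms by (intro allI choice) blast
  then obtain C where C: "\<And>c d. c < N \<Longrightarrow> d < N \<Longrightarrow> C c d \<ge> 0"
      "\<And>c d g. c < N \<Longrightarrow> d < N \<Longrightarrow> g \<in> U \<Longrightarrow> norm (G c d g) \<le> C c d"
    using choice[of "\<lambda>c f. \<forall>d. c < N \<longrightarrow> d < N \<longrightarrow> f d \<ge> 0 \<and> (\<forall>g\<in>U. norm (G c d g) \<le> f d)"] by metis
  show ?thesis
  proof (rule that[of "\<Sum>c<N. \<Sum>d<N. C c d"])
    show "(\<Sum>c<N. \<Sum>d<N. C c d) \<ge> 0" using C by (intro sum_nonneg) auto
    fix v g assume v: "unit_length v" and g: "g \<in> U"
    have "norm (form v G g) \<le> (\<Sum>c<N. \<Sum>d<N. norm (v c * cnj (v d) * G c d g))"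
      unfolding form_def norm_mult norm_ii mult_1
      by (intro order_trans[OF norm_sum] sum_mono) (simp add: norm_mult flip: complex_cnj_mult)
    also have "\<dots> \<le> (\<Sum>c<N. \<Sum>d<N. C c d)"
    proof (intro sum_mono)
      fix c d assume "c \<in> {..<N}" "d \<in> {..<N}"
      hence "norm (v c) * norm (v d) * norm (G c d g) \<le> 1 * 1 * C c d"
        using C v g by (intro mult_mono mult_nonneg_nonneg) (auto intro: unit_le_1)
      thus "norm (v c * cnj (v d) * G c d g) \<le> C c d" by (simp add: norm_mult)
    qed
    finally show "norm (form v G g) \<le> (\<Sum>c<N. \<Sum>d<N. C c d)" .
  qed
qed

lemma has_gradient_const: "has_gradient (\<lambda>_. a) (\<lambda>_ _ _. 0)"
  by (rule has_gradientI[of _ _ 0]) (auto simp: bdd_meas_const form_def)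

lemma has_gradient_add:
  assumes "has_gradient f G" "has_gradient h H"
  shows "has_gradient (\<lambda>g. f g + h g) (\<lambda>c d g. G c d g + H c d g)"
proof -
  obtain C1 where C1: "C1 \<ge> 0"
    "\<And>g v t. g \<in> U \<Longrightarrow> unit_length v \<Longrightarrow> \<bar>t\<bar> \<le> 1 \<Longrightarrow>
        norm (f (rot v t * g) - f g - of_real t * form v G g) \<le> C1 * t\<^sup>2"
    using has_gradientE[OF assms(1)] by blast
  obtain C2 where C2: "C2 \<ge> 0"
    "\<And>g v t. g \<in> U \<Longrightarrow> unit_length v \<Longrightarrow> \<bar>t\<bar> \<le> 1 \<Longrightarrow>
        norm (h (rot v t * g) - h g - of_real t * form v H g) \<le> C2 * t\<^sup>2"
    using has_gradientE[OF assms(2)] by blast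
  have "norm ((f (rot v t * g) + h (rot v t * g)) - (f g + h g) - of_real t * form v (\<lambda>c d g. G c d g + H c d g) g)
     \<le> (C1 + C2) * t\<^sup>2" if "g \<in> U" "unit_length v" "\<bar>t\<bar> \<le> 1" for g v t
  proof -
    have "(f (rot v t * g) + h (rot v t * g)) - (f g + h g) - of_real t * form v (\<lambda>c d g. G c d g + H c d g) g
      = (f (rot v t * g) - f g - of_real t * form v G g) + (h (rot v t * g) - h g - of_real t * form v H g)"
      by (simp add: form_def algebra_simps sum.distrib)
    thus ?thesis using norm_triangle_le[OF add_mono[OF C1(2)[OF that] C2(2)[OF that]]]
      by (simp add: algebra_simps)
  qed
  thus ?thesis
    using C1 C2 by (intro has_gradientI[of _ _ "C1 + C2"] bdd_meas_add has_gradientD[OF assms(1)]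
        has_gradientD[OF assms(2)]) auto
qed

lemma has_gradient_sum:
  "(\<And>x. x \<in> A \<Longrightarrow> has_gradient (f x) (G x)) \<Longrightarrow>
    has_gradient (\<lambda>g. \<Sum>x\<in>A. f x g) (\<lambda>c d g. \<Sum>x\<in>A. G x c d g)"
  by (induction A rule: infinite_finite_induct) (auto intro: has_gradient_const has_gradient_add)

lemma has_gradient_mult:
  assumes f: "has_gradient f G" and h: "has_gradient h H"
  shows "has_gradient (\<lambda>g. f g * h g) (\<lambda>c d g. G c d g * h g + f g * H c d g)"
proof -
  obtain C1 where C1: "C1 \<ge> 0"
    "\<And>g v t. g \<in> U \<Longrightarrow> unit_length v \<Longrightarrow> \<bar>t\<bar> \<le> 1 \<Longrightarrow>
        norm (f (rot v t * g) - f g - of_real t * form v G g) \<le> C1 * t\<^sup>2"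
    using has_gradientE[OF f] by blast
  obtain C2 where C2: "C2 \<ge> 0"
    "\<And>g v t. g \<in> U \<Longrightarrow> unit_length v \<Longrightarrow> \<bar>t\<bar> \<le> 1 \<Longrightarrow>
        norm (h (rot v t * g) - h g - of_real t * form v H g) \<le> C2 * t\<^sup>2"
    using has_gradientE[OF h] by blast
  obtain A1 where A1: "A1 \<ge> 0" "\<And>g. g \<in> U \<Longrightarrow> norm (f g) \<le> A1"
    using bdd_meas_bound[OF has_gradientD(1)[OF f]] by blast
  obtain A2 where A2: "A2 \<ge> 0" "\<And>g. g \<in> U \<Longrightarrow> norm (h g) \<le> A2"
    using bdd_meas_bound[OF has_gradientD(1)[OF h]] by blast
  obtain B1 where B1: "B1 \<ge> 0" "\<And>v g. unit_length v \<Longrightarrow> g \<in> U \<Longrightarrow> norm (form v G g) \<le> B1"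
    using form_bound[OF has_gradientD(3)[OF f]] by blast
  obtain B2 where B2: "B2 \<ge> 0" "\<And>v g. unit_length v \<Longrightarrow> g \<in> U \<Longrightarrow> norm (form v H g) \<le> B2"
    using form_bound[OF has_gradientD(3)[OF h]] by blast
  \<comment> \<open>\<open>A1\<close>, \<open>A2\<close> bound the functions, \<open>B1\<close>,
    \<open>B2\<close> their directional derivatives, and \<open>C1\<close>, \<open>C2\<close> come
    from the two remainders. The summands of \<open>C\<close> bound the three terms into which the
    remainder of the product is split below.\<close>
  define C where "C = A1 * C2 + C1 * A2 + (B1 + C1) * B2"
  have "norm (f (rot v t * g) * h (rot v t * g) - f g * h g
      - of_real t * form v (\<lambda>c d g. G c d g * h g + f g * H c d g) g) \<le> C * t\<^sup>2"
    if g: "g \<in> U" and v: "unit_length v" and t: "\<bar>t\<bar> \<le> 1" for g v t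
  proof -
    define a where "a = f (rot v t * g)"
    define b where "b = h (rot v t * g)"
    have ug: "rot v t * g \<in> U" using rot_U[OF v] g by (rule U_mult)
    have fm: "form v (\<lambda>c d g. G c d g * h g + f g * H c d g) g = form v G g * h g + f g * form v H g"
      by (simp add: form_def algebra_simps sum.distrib sum_distrib_left sum_distrib_right)
    \<comment> \<open>This makes the increment of \<open>f\<close> of order |t|, hence the mixed
      term of order t^2.\<close>
    have t2: "t\<^sup>2 \<le> \<bar>t\<bar>" using t by (metis abs_ge_zero mult_left_le power2_abs power2_eq_square)
    have "norm (a - f g) \<le> norm (a - f g - of_real t * form v G g) + norm (of_real t * form v G g)"
      by (metis diff_add_cancel norm_triangle_ineq)
    also have "\<dots> \<le> C1 * t\<^sup>2 + \<bar>t\<bar> * B1"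
      using C1(2)[OF g v t] B1(2)[OF v g] by (intro add_mono) (auto simp: a_def norm_mult intro!: mult_left_mono)
    also have "\<dots> \<le> (B1 + C1) * \<bar>t\<bar>"
      using t2 C1(1) by (simp add: algebra_simps mult_left_mono)
    finally have af: "norm (a - f g) \<le> (B1 + C1) * \<bar>t\<bar>" .
    have "a * b - f g * h g - of_real t * (form v G g * h g + f g * form v H g)
      = a * (b - h g - of_real t * form v H g) + (a - f g - of_real t * form v G g) * h g
        + (a - f g) * (of_real t * form v H g)"
      by (simp add: algebra_simps)
    also have "norm \<dots> \<le> A1 * (C2 * t\<^sup>2) + (C1 * t\<^sup>2) * A2 + ((B1 + C1) * \<bar>t\<bar>) * (\<bar>t\<bar> * B2)"
    proof (intro order_trans[OF norm_triangle_ineq] add_mono)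
      show "norm (a * (b - h g - of_real t * form v H g)) \<le> A1 * (C2 * t\<^sup>2)"
        unfolding norm_mult using A1 C2(2)[OF g v t] ug
        by (intro mult_mono) (auto simp: a_def b_def)
      show "norm ((a - f g - of_real t * form v G g) * h g) \<le> (C1 * t\<^sup>2) * A2"
        unfolding norm_mult using A2 C1(1) C1(2)[OF g v t] g
        by (intro mult_mono) (auto simp: a_def b_def)
      show "norm ((a - f g) * (of_real t * form v H g)) \<le> ((B1 + C1) * \<bar>t\<bar>) * (\<bar>t\<bar> * B2)"
        unfolding norm_mult using af B2 B1 C1(1) v g
        by (intro mult_mono) (auto intro!: mult_left_mono)
    qed
    also have "\<dots> = C * t\<^sup>2"
      by (simp add: C_def algebra_simps power2_eq_square abs_mult_self_eq)
    finally show ?thesis unfolding fm a_def b_def .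
  qed
  moreover have "C \<ge> 0" using A1(1) A2(1) B1(1) B2(1) C1(1) C2(1) by (auto simp: C_def)
  ultimately show ?thesis
    by (intro has_gradientI[of _ _ C] bdd_meas_add bdd_meas_mult has_gradientD[OF f] has_gradientD[OF h])
qed

text \<open>The time parameter is real, so the directional derivative is simply conjugated;
  conjugating the coefficients i v_c conj(v_d) changes the sign and exchanges \<open>c\<close> and
  \<open>d\<close>.\<close>

lemma has_gradient_cnj:
  assumes f: "has_gradient f G"
  shows "has_gradient (\<lambda>g. cnj (f g)) (\<lambda>c d g. - cnj (G d c g))"
proof -
  have fm: "form v (\<lambda>c d g. - cnj (G d c g)) g = cnj (form v G g)" for v g
  proof -
    have "cnj (form v G g) = - \<i> * (\<Sum>c<N. \<Sum>d<N. v d * cnj (v c) * cnj (G c d g))"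
      unfolding form_def complex_cnj_mult complex_cnj_i cnj_sum complex_cnj_cnj
      by (intro arg_cong[of _ _ "(*) (- \<i>)"] sum.cong refl) (simp only: mult_ac)
    also have "(\<Sum>c<N. \<Sum>d<N. v d * cnj (v c) * cnj (G c d g)) = (\<Sum>d<N. \<Sum>c<N. v d * cnj (v c) * cnj (G c d g))"
      by (rule sum.swap)
    finally show ?thesis by (simp add: form_def sum_negf)
  qed
  have "cnj (f (rot v t * g)) - cnj (f g) - of_real t * cnj (form v G g) =
        cnj (f (rot v t * g) - f g - of_real t * form v G g)" for v t g
    by simp
  hence "norm (cnj (f (rot v t * g)) - cnj (f g) - of_real t * cnj (form v G g)) =
        norm (f (rot v t * g) - f g - of_real t * form v G g)" for v t g
    by (simp only: complex_mod_cnj)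
  with has_gradientE[OF f] obtain C where "C \<ge> 0"
    "\<And>g v t. g \<in> U \<Longrightarrow> unit_length v \<Longrightarrow> \<bar>t\<bar> \<le> 1 \<Longrightarrow>
        norm (cnj (f (rot v t * g)) - cnj (f g) - of_real t * cnj (form v G g)) \<le> C * t\<^sup>2"
    by metis
  thus ?thesis
    by (intro has_gradientI[of _ _ C] bdd_meas_uminus bdd_meas_cnj has_gradientD[OF f]) (auto simp: fm)
qed

lemma has_gradient_cong:
  assumes f: "has_gradient f G"
    and "\<And>g. g \<in> U \<Longrightarrow> f g = f' g" "\<And>c d g. c < N \<Longrightarrow> d < N \<Longrightarrow> g \<in> U \<Longrightarrow> G c d g = G' c d g"
  shows "has_gradient f' G'"
proof -
  have "form v G g = form v G' g" if "g \<in> U" for v g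
    using assms that by (simp add: form_def)
  moreover obtain C where "C \<ge> 0"
    "\<And>g v t. g \<in> U \<Longrightarrow> unit_length v \<Longrightarrow> \<bar>t\<bar> \<le> 1 \<Longrightarrow>
        norm (f (rot v t * g) - f g - of_real t * form v G g) \<le> C * t\<^sup>2"
    using has_gradientE[OF f] by blast
  moreover have "bdd_meas f'" using has_gradientD(1)[OF f] bdd_meas_cong[of f f'] assms(2) by blast
  moreover have "bdd_meas (G' c d)" if "c < N" "d < N" for c d
    using has_gradientD(2)[OF f that] bdd_meas_cong[of "G c d" "G' c d"] assms(3) that by blast
  ultimately show ?thesis
    using assms(2) U_mult[OF rot_U] by (intro has_gradientI[of _ _ C]) auto
qed

lemma norm_cis_minus_linear: "norm (cis t - 1 - \<i> * of_real t) \<le> t\<^sup>2"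
  using Taylor_exp[of "\<i> * of_real t" 1]
  by (simp add: cis_conv_exp norm_mult algebra_simps power2_eq_square flip: abs_mult)

text \<open>E_cd g has row \<open>d\<close> of \<open>g\<close> as its row \<open>c\<close> and
  zeros elsewhere. The remainder constant \<open>N\<close> arises because entries of
  \<open>v\<close> and \<open>g\<close> have modulus at most 1.\<close>

lemma has_gradient_entry:
  assumes x: "x < N" and y: "y < N"
  shows "has_gradient (\<lambda>g. g $$ (x, y)) (\<lambda>c d g. if c = x then g $$ (d, y) else 0)"
proof -
  have "norm ((rot v t * g) $$ (x, y) - g $$ (x, y) -
      of_real t * form v (\<lambda>c d g. if c = x then g $$ (d, y) else 0) g) \<le> real N * t\<^sup>2"
    if g: "g \<in> U" and v: "unit_length v" for g v t
  proof -
    define s where "s = (\<Sum>d<N. cnj (v d) * g $$ (d, y))"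
    have "norm s \<le> (\<Sum>d<N. 1 * 1)"
      unfolding s_def
      by (intro order_trans[OF norm_sum] sum_mono, unfold norm_mult, intro mult_mono)
         (use g v y in \<open>auto intro: unit_le_1 entry_le_1\<close>)
    hence s: "norm s \<le> real N" by simp
    have "(rot v t * g) $$ (x, y) = (\<Sum>k<N. (if k = x then g $$ (x, y) else 0) + (cis t - 1) * v x * (cnj (v k) * g $$ (k, y)))"
      using x y U_carrier[OF g]
      by (subst index_mult_mat_sum[of _ N N _ N]) (auto simp: rot_def algebra_simps intro!: sum.cong)
    also have "\<dots> = g $$ (x, y) + (cis t - 1) * v x * s"
      using x unfolding s_def by (simp add: sum.distrib sum_distrib_left)
    finally have 1: "(rot v t * g) $$ (x, y) = g $$ (x, y) + (cis t - 1) * v x * s" .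
    have "form v (\<lambda>c d g. if c = x then g $$ (d, y) else 0) g =
        \<i> * (\<Sum>c<N. if c = x then v x * s else 0)"
      unfolding form_def s_def
      by (intro arg_cong[of _ _ "(*) \<i>"] sum.cong) (auto simp: sum_distrib_left mult_ac)
    hence 2: "form v (\<lambda>c d g. if c = x then g $$ (d, y) else 0) g = \<i> * v x * s"
      using x by simp
    have "norm ((cis t - 1 - \<i> * of_real t) * v x * s) \<le> t\<^sup>2 * 1 * real N"
      unfolding norm_mult by (intro mult_mono norm_cis_minus_linear s unit_le_1[OF v x]) auto
    thus ?thesis unfolding 1 2 by (simp add: algebra_simps)
  qed
  moreover have "bdd_meas (\<lambda>g. if c = x then g $$ (d, y) else 0)" if "d < N" for c d
    using that y by (cases "c = x") (auto intro: bdd_meas_entry bdd_meas_const)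
  ultimately show ?thesis using x y
    by (intro has_gradientI[of _ _ "real N"] bdd_meas_entry) auto
qed

lemma integral_double_sum:
  fixes F :: "nat \<Rightarrow> nat \<Rightarrow> complex mat \<Rightarrow> complex"
  assumes i: "\<And>c d. c < N \<Longrightarrow> d < N \<Longrightarrow> integrable \<mu> (F c d)"
  shows "(\<integral>g. (\<Sum>c<N. \<Sum>d<N. F c d g) \<partial>\<mu>) = (\<Sum>c<N. \<Sum>d<N. \<integral>g. F c d g \<partial>\<mu>)"
proof -
  have "(\<integral>g. (\<Sum>c<N. \<Sum>d<N. F c d g) \<partial>\<mu>) = (\<Sum>c<N. \<integral>g. (\<Sum>d<N. F c d g) \<partial>\<mu>)"
    by (intro Bochner_Integration.integral_sum Bochner_Integration.integrable_sum i) auto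
  also have "\<dots> = (\<Sum>c<N. \<Sum>d<N. \<integral>g. F c d g \<partial>\<mu>)"
    by (intro sum.cong refl Bochner_Integration.integral_sum i) auto
  finally show ?thesis .
qed

text \<open>Integration by parts on U(N). Left invariance makes the increment of \<open>f\<close>
  integrate to 0, so after division by t the integral of the linear part is bounded by C t. Letting
  t tend to 0 kills it in every direction i P, and polarization isolates each pair \<open>c\<close>,
  \<open>d\<close>.\<close>

lemma integral_gradient:
  assumes f: "has_gradient f G" and cd: "c < N" "d < N"
  shows "(\<integral>g. G c d g \<partial>\<mu>) = 0"
proof (rule polarization_zero[where N = N, OF _ cd])
  fix v :: "nat \<Rightarrow> complex" assume "(\<Sum>i<N. v i * cnj (v i)) = 1"
  hence v: "unit_length v" by (simp add: unit_length_def)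
  obtain C where C0: "C \<ge> 0" and C1: "\<And>g v t. g \<in> U \<Longrightarrow> unit_length v \<Longrightarrow> \<bar>t\<bar> \<le> 1 \<Longrightarrow>
        norm (f (rot v t * g) - f g - of_real t * form v G g) \<le> C * t\<^sup>2"
    using has_gradientE[OF f] by blast
  note C = C0 C1[OF _ v]
  have fm: "f \<in> borel_measurable \<mu>"
    using has_gradientD(1)[OF f] by (simp add: bdd_meas_def)
  have fi: "integrable \<mu> f"
    by (rule bdd_meas_integrable[OF has_gradientD(1)[OF f]])
  have Gi: "integrable \<mu> (G c d)" if "c < N" "d < N" for c d
    by (rule bdd_meas_integrable[OF has_gradientD(2)[OF f that]])
  have Fi: "integrable \<mu> (form v G)"
    unfolding form_def
    by (intro integrable_mult_right Bochner_Integration.integrable_sum Gi) auto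
  have "norm (\<integral>g. form v G g \<partial>\<mu>) \<le> C * t" if t: "0 < t" "t \<le> 1" for t
  proof -
    have ui: "integrable \<mu> (\<lambda>g. f (rot v t * g))"
      using fi distr_mult_left[OF rot_U[OF v]] mult_left_measurable[OF rot_U[OF v]] fm
      by (subst integrable_distr_eq[symmetric, of "\<lambda>g. rot v t * g" \<mu> \<mu> f]) auto
    have "(\<integral>g. f (rot v t * g) - f g - of_real t * form v G g \<partial>\<mu>) = - of_real t * (\<integral>g. form v G g \<partial>\<mu>)"
      using ui fi Fi integral_mult_left[OF rot_U[OF v] fm] by simp
    hence "t * norm (\<integral>g. form v G g \<partial>\<mu>) = norm (\<integral>g. f (rot v t * g) - f g - of_real t * form v G g \<partial>\<mu>)"
      using t by (simp add: norm_mult)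
    also have "\<dots> \<le> (\<integral>g. norm (f (rot v t * g) - f g - of_real t * form v G g) \<partial>\<mu>)"
      by (rule integral_norm_bound)
    also have "\<dots> \<le> (\<integral>g. C * t\<^sup>2 \<partial>\<mu>)"
      using C t ui fi Fi by (intro integral_mono) auto
    also have "\<dots> = t * (C * t)" using prob_space by (simp add: power2_eq_square)
    finally show ?thesis using t by simp
  qed
  hence "((\<lambda>t. C * t) \<longlongrightarrow> C * 0) (at_right 0) \<Longrightarrow> norm (\<integral>g. form v G g \<partial>\<mu>) \<le> C * 0"
    by (intro tendsto_lowerbound[of _ _ "at_right (0::real)"])
       (auto simp: eventually_at_right_field intro!: exI[of _ 1])
  moreover have "((\<lambda>t. C * t) \<longlongrightarrow> C * 0) (at_right 0)" by (intro tendsto_intros)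
  ultimately have "(\<integral>g. form v G g \<partial>\<mu>) = 0" by simp
  moreover have "(\<integral>g. form v G g \<partial>\<mu>) = \<i> * (\<Sum>c<N. \<Sum>d<N. v c * cnj (v d) * (\<integral>g. G c d g \<partial>\<mu>))"
  proof -
    have "integrable \<mu> (\<lambda>g. v c * cnj (v d) * G c d g)" if "c < N" "d < N" for c d
      by (intro integrable_mult_right Gi that)
    from integral_double_sum[of "\<lambda>c d g. v c * cnj (v d) * G c d g", OF this] show ?thesis
      by (simp add: form_def)
  qed
  ultimately show "(\<Sum>c<N. \<Sum>d<N. v c * cnj (v d) * (\<integral>g. G c d g \<partial>\<mu>)) = 0" by simp
qed

end

section \<open>Moments of power traces\<close>

context haar
begin

lemma pow_U: "g \<in> U \<Longrightarrow> g ^\<^sub>m k \<in> U"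
proof (induction k)
  case 0
  then show ?case
    using monoid.one_closed[OF group.is_monoid[OF group_unitary_group[of N]]] U_carrier[OF 0]
    by (auto simp: unitary_group_def)
qed (auto intro: U_mult)

text \<open>Leibniz rule: E_cd is inserted in front of each of the \<open>k\<close> factors in turn,
  giving g^j E_cd g^(k-j) with at least one factor on its right.\<close>

lemma has_gradient_pow:
  "x < N \<Longrightarrow> y < N \<Longrightarrow> has_gradient (\<lambda>g. (g ^\<^sub>m k) $$ (x, y))
     (\<lambda>c d g. \<Sum>j<k. (g ^\<^sub>m j) $$ (x, c) * (g ^\<^sub>m (k - j)) $$ (d, y))"
proof (induction k arbitrary: y)
  case 0
  show ?case
    by (rule has_gradient_cong[OF has_gradient_const[of "if x = y then 1 else 0"]])
       (use 0 in \<open>auto dest: U_carrier\<close>)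
next
  case (Suc k)
  have "has_gradient (\<lambda>g. \<Sum>z<N. (g ^\<^sub>m k) $$ (x, z) * g $$ (z, y))
     (\<lambda>c d g. \<Sum>z<N. (\<Sum>j<k. (g ^\<^sub>m j) $$ (x, c) * (g ^\<^sub>m (k - j)) $$ (d, z)) * g $$ (z, y)
        + (g ^\<^sub>m k) $$ (x, z) * (if c = z then g $$ (d, y) else 0))"
    using Suc by (intro has_gradient_sum has_gradient_mult has_gradient_entry Suc.IH) auto
  thus ?case
  proof (rule has_gradient_cong)
    fix g assume g: "g \<in> U"
    note G = U_carrier[OF g]
    show "(\<Sum>z<N. (g ^\<^sub>m k) $$ (x, z) * g $$ (z, y)) = (g ^\<^sub>m Suc k) $$ (x, y)"
      using G Suc.prems by (simp add: index_mult_mat_sum[of _ N N _ N] del: index_mult_mat)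
  next
    fix c d g assume cd: "c < N" "d < N" and g: "g \<in> U"
    note G = U_carrier[OF g]
    have "(\<Sum>z<N. (\<Sum>j<k. (g ^\<^sub>m j) $$ (x, c) * (g ^\<^sub>m (k - j)) $$ (d, z)) * g $$ (z, y)
        + (g ^\<^sub>m k) $$ (x, z) * (if c = z then g $$ (d, y) else 0))
      = (\<Sum>j<k. \<Sum>z<N. (g ^\<^sub>m j) $$ (x, c) * ((g ^\<^sub>m (k - j)) $$ (d, z) * g $$ (z, y)))
        + (\<Sum>z<N. if z = c then (g ^\<^sub>m k) $$ (x, c) * g $$ (d, y) else 0)"
      unfolding sum.distrib
      by (subst sum.swap, intro arg_cong2[of _ _ _ _ "(+)"] sum.cong)
         (auto simp: sum_distrib_right sum_distrib_left mult.assoc)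
    also have "(\<Sum>z<N. if z = c then (g ^\<^sub>m k) $$ (x, c) * g $$ (d, y) else 0) = (g ^\<^sub>m k) $$ (x, c) * (g ^\<^sub>m (Suc k - k)) $$ (d, y)"
      using cd G by simp
    also have "(\<Sum>j<k. \<Sum>z<N. (g ^\<^sub>m j) $$ (x, c) * ((g ^\<^sub>m (k - j)) $$ (d, z) * g $$ (z, y)))
      = (\<Sum>j<k. (g ^\<^sub>m j) $$ (x, c) * (g ^\<^sub>m (Suc k - j)) $$ (d, y))"
    proof (intro sum.cong refl)
      fix j assume "j \<in> {..<k}"
      hence "Suc k - j = Suc (k - j)" by auto
      thus "(\<Sum>z<N. (g ^\<^sub>m j) $$ (x, c) * ((g ^\<^sub>m (k - j)) $$ (d, z) * g $$ (z, y)))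
          = (g ^\<^sub>m j) $$ (x, c) * (g ^\<^sub>m (Suc k - j)) $$ (d, y)"
        using G cd Suc.prems
        by (simp add: index_mult_mat_sum[of _ N N _ N] sum_distrib_left del: index_mult_mat)
    qed
    finally show "(\<Sum>z<N. (\<Sum>j<k. (g ^\<^sub>m j) $$ (x, c) * (g ^\<^sub>m (k - j)) $$ (d, z)) * g $$ (z, y)
        + (g ^\<^sub>m k) $$ (x, z) * (if c = z then g $$ (d, y) else 0))
      = (\<Sum>j<Suc k. (g ^\<^sub>m j) $$ (x, c) * (g ^\<^sub>m (Suc k - j)) $$ (d, y))"
      by simp
  qed
qed

lemma ptr_U: "g \<in> U \<Longrightarrow> ptr g k = (\<Sum>i<N. (g ^\<^sub>m k) $$ (i, i))"
  by (auto simp: ptr_def dest: U_carrier)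

lemma ptr_0: "g \<in> U \<Longrightarrow> ptr g 0 = of_nat N"
  by (auto simp: ptr_U dest: U_carrier)

lemma pow_add_entry:
  assumes "g \<in> U" "x < N" "y < N"
  shows "(\<Sum>z<N. (g ^\<^sub>m i) $$ (x, z) * (g ^\<^sub>m j) $$ (z, y)) = (g ^\<^sub>m (i + j)) $$ (x, y)"
  using U_carrier[OF assms(1)] assms(2,3)
  by (simp add: pow_mat_add[OF U_carrier[OF assms(1)]] index_mult_mat_sum[of _ N N _ N] del: index_mult_mat)

text \<open>By cyclicity of the trace all \<open>k\<close> insertions of E_cd contribute the
  same.\<close>

lemma has_gradient_ptr:
  "has_gradient (\<lambda>g. ptr g k) (\<lambda>c d g. of_nat k * (g ^\<^sub>m k) $$ (d, c))"
proof -
  have "has_gradient (\<lambda>g. \<Sum>x<N. (g ^\<^sub>m k) $$ (x, x))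
     (\<lambda>c d g. \<Sum>x<N. \<Sum>j<k. (g ^\<^sub>m j) $$ (x, c) * (g ^\<^sub>m (k - j)) $$ (d, x))"
    by (intro has_gradient_sum has_gradient_pow) auto
  thus ?thesis
  proof (rule has_gradient_cong)
    fix c d g assume cd: "c < N" "d < N" and g: "g \<in> U"
    have "(\<Sum>x<N. \<Sum>j<k. (g ^\<^sub>m j) $$ (x, c) * (g ^\<^sub>m (k - j)) $$ (d, x))
      = (\<Sum>j<k. \<Sum>x<N. (g ^\<^sub>m (k - j)) $$ (d, x) * (g ^\<^sub>m j) $$ (x, c))"
      by (subst sum.swap) (simp add: mult.commute)
    also have "\<dots> = (\<Sum>j<k. (g ^\<^sub>m k) $$ (d, c))"
      using g cd by (intro sum.cong refl) (simp add: pow_add_entry)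
    finally show "(\<Sum>x<N. \<Sum>j<k. (g ^\<^sub>m j) $$ (x, c) * (g ^\<^sub>m (k - j)) $$ (d, x))
       = of_nat k * (g ^\<^sub>m k) $$ (d, c)" by simp
  qed (simp add: ptr_U)
qed

definition pms :: "nat multiset \<Rightarrow> complex mat \<Rightarrow> complex" where
  "pms R g = (\<Prod>k\<in>#R. ptr g k)"

lemma pms_empty [simp]: "pms {#} g = 1" and pms_add_mset [simp]: "pms (add_mset k R) g = ptr g k * pms R g"
  by (simp_all add: pms_def)

lemma has_gradient_pms:
  "has_gradient (pms R) (\<lambda>c d g. \<Sum>i\<in>#R. of_nat i * (g ^\<^sub>m i) $$ (d, c) * pms (R - {#i#}) g)"
proof (induction R)
  case empty
  show ?case using has_gradient_const[of 1] by (simp add: pms_def)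
next
  case (add k R)
  show ?case
  proof (rule has_gradient_cong[OF has_gradient_mult[OF has_gradient_ptr[of k] add.IH]])
    fix c d g
    have "(\<Sum>i\<in>#R. of_nat i * (g ^\<^sub>m i) $$ (d, c) * pms (add_mset k R - {#i#}) g)
        = (\<Sum>i\<in>#R. ptr g k * (of_nat i * (g ^\<^sub>m i) $$ (d, c) * pms (R - {#i#}) g))"
      by (intro arg_cong[of _ _ sum_mset] image_mset_cong) (auto simp: mult_ac)
    thus "of_nat k * (g ^\<^sub>m k) $$ (d, c) * pms R g +
        ptr g k * (\<Sum>i\<in>#R. of_nat i * (g ^\<^sub>m i) $$ (d, c) * pms (R - {#i#}) g)
      = (\<Sum>i\<in>#add_mset k R. of_nat i * (g ^\<^sub>m i) $$ (d, c) * pms (add_mset k R - {#i#}) g)"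
      by (simp add: sum_mset_distrib_left image_mset.compositionality comp_def)
  qed simp
qed

lemma bdd_meas_pms: "bdd_meas (pms R)"
  by (rule has_gradientD(1)[OF has_gradient_pms])

definition Ev :: "nat multiset \<Rightarrow> nat multiset \<Rightarrow> complex" where
  "Ev R S = (\<integral>g. pms R g * cnj (pms S g) \<partial>\<mu>)"

lemma norm_pms_le: "g \<in> U \<Longrightarrow> norm (pms R g) \<le> real N ^ size R"
  by (induction R) (auto simp: norm_mult intro!: mult_mono norm_ptr_unitary_le)

lemma bdd_meas_pair: "bdd_meas (\<lambda>g. pms R g * cnj (pms S g))"
  by (intro bdd_meas_mult bdd_meas_cnj bdd_meas_pms)

lemma norm_Ev_le: "norm (Ev R S) \<le> real N ^ (size R + size S)"
proof -
  have "norm (Ev R S) \<le> (\<integral>g. norm (pms R g * cnj (pms S g)) \<partial>\<mu>)"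
    unfolding Ev_def by (rule integral_norm_bound)
  also have "\<dots> \<le> (\<integral>g. real N ^ (size R + size S) \<partial>\<mu>)"
  proof (intro integral_mono)
    show "integrable \<mu> (\<lambda>g. norm (pms R g * cnj (pms S g)))"
      by (intro integrable_norm bdd_meas_integrable bdd_meas_pair)
    fix g assume "g \<in> space \<mu>"
    thus "norm (pms R g * cnj (pms S g)) \<le> real N ^ (size R + size S)"
      unfolding norm_mult power_add complex_mod_cnj by (intro mult_mono norm_pms_le) auto
  qed auto
  also have "\<dots> = real N ^ (size R + size S)" using prob_space by simp
  finally show ?thesis .
qed

lemma integral_sum_mset:
  fixes f :: "'i \<Rightarrow> complex mat \<Rightarrow> complex"
  assumes "\<And>x. x \<in># A \<Longrightarrow> integrable \<mu> (f x)"
  shows "integrable \<mu> (\<lambda>g. \<Sum>x\<in>#A. f x g)" "(\<integral>g. (\<Sum>x\<in>#A. f x g) \<partial>\<mu>) = (\<Sum>x\<in>#A. \<integral>g. f x g \<partial>\<mu>)"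
proof -
  have "integrable \<mu> (\<lambda>g. \<Sum>x\<in>#A. f x g) \<and> (\<integral>g. (\<Sum>x\<in>#A. f x g) \<partial>\<mu>) = (\<Sum>x\<in>#A. \<integral>g. f x g \<partial>\<mu>)"
    using assms by (induction A) auto
  thus "integrable \<mu> (\<lambda>g. \<Sum>x\<in>#A. f x g)" "(\<integral>g. (\<Sum>x\<in>#A. f x g) \<partial>\<mu>) = (\<Sum>x\<in>#A. \<integral>g. f x g \<partial>\<mu>)"
    by auto
qed

text \<open>The double sum is the trace of g^k times the adjoint of g^m. By unitarity that adjoint
  is the inverse of g^m, so a single net power is left, conjugated if it is negative.\<close>

lemma ptr_pow_adjoint:
  assumes g: "g \<in> U"
  shows "(\<Sum>c<N. \<Sum>d<N. (g ^\<^sub>m k) $$ (c, d) * cnj ((g ^\<^sub>m m) $$ (c, d))) =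
    (if m \<le> k then ptr g (k - m) else cnj (ptr g (m - k)))"
proof -
  define T where "T k m = (\<Sum>c<N. \<Sum>d<N. (g ^\<^sub>m k) $$ (c, d) * cnj ((g ^\<^sub>m m) $$ (c, d)))" for k m
  have *: "T (j + m) m = ptr g j" for j m
  proof -
    note G = U_carrier[OF g] U_carrier[OF pow_U[OF g]]
    have mm: "g ^\<^sub>m m * mat_adjoint (g ^\<^sub>m m) = 1\<^sub>m N"
      using pow_U[OF g, of m] by (simp add: unitary_group_def)
    have ad: "mat_adjoint (g ^\<^sub>m m) \<in> carrier_mat N N"
      using G by (intro mat_adjoint_carrier)
    have "T (j + m) m = (\<Sum>c<N. \<Sum>d<N. (g ^\<^sub>m (j + m)) $$ (c, d) * mat_adjoint (g ^\<^sub>m m) $$ (d, c))"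
      unfolding T_def using G by (intro sum.cong) (auto simp: mat_adjoint_eq)
    also have "\<dots> = (\<Sum>c<N. (g ^\<^sub>m (j + m) * mat_adjoint (g ^\<^sub>m m)) $$ (c, c))"
      using G ad by (intro sum.cong refl index_mult_mat_sum[of _ N N _ N, symmetric]) auto
    also have "g ^\<^sub>m (j + m) * mat_adjoint (g ^\<^sub>m m) = g ^\<^sub>m j * (g ^\<^sub>m m * mat_adjoint (g ^\<^sub>m m))"
      using G ad by (simp add: pow_mat_add[OF G(1)] assoc_mult_mat[of _ N N _ N _ N])
    also have "\<dots> = g ^\<^sub>m j" unfolding mm using G by simp
    finally show ?thesis by (simp add: ptr_U[OF g])
  qed
  show ?thesis
  proof (cases "m \<le> k")
    case True
    thus ?thesis using *[of "k - m" m] by (simp add: T_def)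
  next
    case False
    have "T k m = cnj (T m k)" by (simp add: T_def mult.commute)
    thus ?thesis using *[of "m - k" k] False unfolding T_def[symmetric] by simp
  qed
qed

text \<open>Integration by parts for the entry (c, d) of g^k times p_R conj(p_S), in the direction
  E_cd with the same indices. Summing over c and d closes all contractions to traces:
  differentiating g^k gives \<open>P\<close>, p_R gives \<open>Q\<close>, and conj(p_S) gives minus
  \<open>W\<close>.\<close>

lemma loop_equation_Ev: "loop_equation (of_nat N) Ev"
  unfolding loop_equation_def
proof (intro allI impI)
  fix k :: nat and R S :: "nat multiset"
  assume k: "0 < k"
  \<comment> \<open>Here the indices of the entry and of the direction are already identified;
    \<open>gr\<close> keeps them apart, since the entry has to be fixed before
    differentiating.\<close>
  define G where "G c d g =
      (\<Sum>j<k. (g ^\<^sub>m j) $$ (c, c) * (g ^\<^sub>m (k - j)) $$ (d, d)) * (pms R g * cnj (pms S g)) +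
      (g ^\<^sub>m k) $$ (c, d) *
        ((\<Sum>i\<in>#R. of_nat i * (g ^\<^sub>m i) $$ (d, c) * pms (R - {#i#}) g) * cnj (pms S g) +
         pms R g * - cnj (\<Sum>m\<in>#S. of_nat m * (g ^\<^sub>m m) $$ (c, d) * pms (S - {#m#}) g))" for c d g
  have gr: "has_gradient (\<lambda>g. (g ^\<^sub>m k) $$ (x, y) * (pms R g * cnj (pms S g)))
     (\<lambda>c d g. (\<Sum>j<k. (g ^\<^sub>m j) $$ (x, c) * (g ^\<^sub>m (k - j)) $$ (d, y)) * (pms R g * cnj (pms S g)) +
      (g ^\<^sub>m k) $$ (x, y) *
        ((\<Sum>i\<in>#R. of_nat i * (g ^\<^sub>m i) $$ (d, c) * pms (R - {#i#}) g) * cnj (pms S g) +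
         pms R g * - cnj (\<Sum>m\<in>#S. of_nat m * (g ^\<^sub>m m) $$ (c, d) * pms (S - {#m#}) g)))"
    if "x < N" "y < N" for x y
    using that by (intro has_gradient_mult has_gradient_pow has_gradient_cnj has_gradient_pms)
  have int0: "(\<integral>g. G c d g \<partial>\<mu>) = 0" "integrable \<mu> (G c d)" if "c < N" "d < N" for c d
    using integral_gradient[OF gr[OF that] that] bdd_meas_integrable[OF has_gradientD(2)[OF gr[OF that] that]]
    unfolding G_def by auto
  define P where "P g = (\<Sum>j<k. pms (add_mset j (add_mset (k - j) R)) g * cnj (pms S g))" for g
  define Q where "Q g = (\<Sum>i\<in>#R. of_nat i * (pms (add_mset (k + i) (R - {#i#})) g * cnj (pms S g)))" for g
  define W where "W g = (\<Sum>m\<in>#S. of_nat m *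
     (if m = k then of_nat N * (pms R g * cnj (pms (S - {#m#}) g))
      else if m < k then pms (add_mset (k - m) R) g * cnj (pms (S - {#m#}) g)
      else pms R g * cnj (pms (add_mset (m - k) (S - {#m#})) g)))" for g
  have sum_G: "(\<Sum>c<N. \<Sum>d<N. G c d g) = P g + Q g - W g" if g: "g \<in> U" for g
  proof -
    have 1: "(\<Sum>c<N. \<Sum>d<N. (\<Sum>j<k. (g ^\<^sub>m j) $$ (c, c) * (g ^\<^sub>m (k - j)) $$ (d, d)) * (pms R g * cnj (pms S g))) = P g"
    proof -
      have "(\<Sum>c<N. \<Sum>d<N. (\<Sum>j<k. (g ^\<^sub>m j) $$ (c, c) * (g ^\<^sub>m (k - j)) $$ (d, d)) * (pms R g * cnj (pms S g)))
        = (\<Sum>c<N. \<Sum>j<k. \<Sum>d<N. (g ^\<^sub>m j) $$ (c, c) * (g ^\<^sub>m (k - j)) $$ (d, d) * (pms R g * cnj (pms S g)))"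
        unfolding sum_distrib_right by (intro sum.cong refl sum.swap)
      also have "\<dots> = (\<Sum>j<k. \<Sum>c<N. \<Sum>d<N. (g ^\<^sub>m j) $$ (c, c) * (g ^\<^sub>m (k - j)) $$ (d, d) * (pms R g * cnj (pms S g)))"
        by (rule sum.swap)
      also have "\<dots> = P g"
        unfolding P_def
      proof (intro sum.cong refl)
        fix j
        show "(\<Sum>c<N. \<Sum>d<N. (g ^\<^sub>m j) $$ (c, c) * (g ^\<^sub>m (k - j)) $$ (d, d) * (pms R g * cnj (pms S g))) =
           pms (add_mset j (add_mset (k - j) R)) g * cnj (pms S g)"
          unfolding sum_distrib_right[symmetric] sum_distrib_left[symmetric] ptr_U[OF g, symmetric]
          by (simp add: mult.assoc)
      qed
      finally show ?thesis .
    qed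
    have swap: "(\<Sum>c<N. \<Sum>d<N. \<Sum>i\<in>#A. f c d i) = (\<Sum>i\<in>#A. \<Sum>c<N. \<Sum>d<N. f c d i)"
      for A :: "nat multiset" and f :: "nat \<Rightarrow> nat \<Rightarrow> nat \<Rightarrow> complex"
      by (induction A) (auto simp: sum.distrib)
    have 2: "(\<Sum>c<N. \<Sum>d<N. (g ^\<^sub>m k) $$ (c, d) *
        ((\<Sum>i\<in>#R. of_nat i * (g ^\<^sub>m i) $$ (d, c) * pms (R - {#i#}) g) * cnj (pms S g))) = Q g"
    proof -
      have "(\<Sum>c<N. \<Sum>d<N. (g ^\<^sub>m k) $$ (c, d) *
        ((\<Sum>i\<in>#R. of_nat i * (g ^\<^sub>m i) $$ (d, c) * pms (R - {#i#}) g) * cnj (pms S g)))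
        = (\<Sum>i\<in>#R. \<Sum>c<N. \<Sum>d<N. (g ^\<^sub>m k) $$ (c, d) *
            (of_nat i * (g ^\<^sub>m i) $$ (d, c) * pms (R - {#i#}) g * cnj (pms S g)))"
        unfolding swap[symmetric] sum_mset_distrib_left sum_mset_distrib_right ..
      also have "\<dots> = Q g"
        unfolding Q_def
      proof (intro arg_cong[of _ _ sum_mset] image_mset_cong)
        fix i
        have "(\<Sum>c<N. \<Sum>d<N. (g ^\<^sub>m k) $$ (c, d) *
            (of_nat i * (g ^\<^sub>m i) $$ (d, c) * pms (R - {#i#}) g * cnj (pms S g)))
          = of_nat i * pms (R - {#i#}) g * cnj (pms S g) *
             (\<Sum>c<N. \<Sum>d<N. (g ^\<^sub>m k) $$ (c, d) * (g ^\<^sub>m i) $$ (d, c))"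
          unfolding sum_distrib_left by (intro sum.cong refl) (simp only: mult_ac)
        also have "(\<Sum>c<N. \<Sum>d<N. (g ^\<^sub>m k) $$ (c, d) * (g ^\<^sub>m i) $$ (d, c)) = ptr g (k + i)"
          unfolding ptr_U[OF g] by (intro sum.cong refl pow_add_entry[OF g]) auto
        finally show "(\<Sum>c<N. \<Sum>d<N. (g ^\<^sub>m k) $$ (c, d) *
            (of_nat i * (g ^\<^sub>m i) $$ (d, c) * pms (R - {#i#}) g * cnj (pms S g))) =
            of_nat i * (pms (add_mset (k + i) (R - {#i#})) g * cnj (pms S g))"
          by (simp add: mult_ac)
      qed
      finally show ?thesis .
    qed
    have 3: "(\<Sum>c<N. \<Sum>d<N. (g ^\<^sub>m k) $$ (c, d) *
        (pms R g * cnj (\<Sum>m\<in>#S. of_nat m * (g ^\<^sub>m m) $$ (c, d) * pms (S - {#m#}) g))) = W g"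
    proof -
      have cs: "cnj (\<Sum>m\<in>#A. f m) = (\<Sum>m\<in>#A. cnj (f m))" for A :: "nat multiset" and f
        by (induction A) auto
      have "(\<Sum>c<N. \<Sum>d<N. (g ^\<^sub>m k) $$ (c, d) *
        (pms R g * cnj (\<Sum>m\<in>#S. of_nat m * (g ^\<^sub>m m) $$ (c, d) * pms (S - {#m#}) g)))
        = (\<Sum>m\<in>#S. \<Sum>c<N. \<Sum>d<N. (g ^\<^sub>m k) $$ (c, d) *
            (pms R g * cnj (of_nat m * (g ^\<^sub>m m) $$ (c, d) * pms (S - {#m#}) g)))"
        unfolding swap[symmetric] cs sum_mset_distrib_left ..
      also have "\<dots> = W g"
        unfolding W_def
      proof (intro arg_cong[of _ _ sum_mset] image_mset_cong)
        fix m
        have "(\<Sum>c<N. \<Sum>d<N. (g ^\<^sub>m k) $$ (c, d) *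
            (pms R g * cnj (of_nat m * (g ^\<^sub>m m) $$ (c, d) * pms (S - {#m#}) g)))
          = of_nat m * pms R g * cnj (pms (S - {#m#}) g) *
             (\<Sum>c<N. \<Sum>d<N. (g ^\<^sub>m k) $$ (c, d) * cnj ((g ^\<^sub>m m) $$ (c, d)))"
          unfolding sum_distrib_left complex_cnj_mult complex_cnj_of_nat
          by (intro sum.cong refl) (simp only: mult_ac)
        thus "(\<Sum>c<N. \<Sum>d<N. (g ^\<^sub>m k) $$ (c, d) *
            (pms R g * cnj (of_nat m * (g ^\<^sub>m m) $$ (c, d) * pms (S - {#m#}) g))) =
            of_nat m * (if m = k then of_nat N * (pms R g * cnj (pms (S - {#m#}) g))
              else if m < k then pms (add_mset (k - m) R) g * cnj (pms (S - {#m#}) g)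
              else pms R g * cnj (pms (add_mset (m - k) (S - {#m#})) g))"
          unfolding ptr_pow_adjoint[OF g] by (auto simp: ptr_0[OF g])
      qed
      finally show ?thesis .
    qed
    show ?thesis
      unfolding G_def sum.distrib distrib_left mult_minus_right sum_negf 1 2 3 by simp
  qed
  have iEv: "integrable \<mu> (\<lambda>g. pms R g * cnj (pms S g))" for R S
    by (intro bdd_meas_integrable bdd_meas_pair)
  have iT: "integrable \<mu> (\<lambda>g. of_nat m *
     (if m = k then of_nat N * (pms R g * cnj (pms (S - {#m#}) g))
      else if m < k then pms (add_mset (k - m) R) g * cnj (pms (S - {#m#}) g)
      else pms R g * cnj (pms (add_mset (m - k) (S - {#m#})) g)))" for m
    by (cases "m = k"; cases "m < k"; simp add: iEv del: pms_add_mset)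
  have iP: "integrable \<mu> P" and iQ: "integrable \<mu> Q" and iW: "integrable \<mu> W"
  proof -
    show "integrable \<mu> P" unfolding P_def by (intro Bochner_Integration.integrable_sum iEv)
    show "integrable \<mu> Q" unfolding Q_def by (intro integral_sum_mset(1) integrable_mult_right iEv)
    show "integrable \<mu> W" unfolding W_def
      by (intro integral_sum_mset(1) iT)
  qed
  have "(\<integral>g. P g \<partial>\<mu>) = (\<Sum>j<k. Ev (add_mset j (add_mset (k - j) R)) S)"
    unfolding P_def Ev_def by (intro Bochner_Integration.integral_sum iEv)
  \<comment> \<open>The insertion at \<open>j = 0\<close> leaves the trace of the identity and so
    supplies the diagonal term of the recursion; the other \<open>j\<close> are the cuts.\<close>
  also have "{..<k} = insert 0 {1..<k}" using k by auto
  also have "(\<Sum>j\<in>insert 0 {1..<k}. Ev (add_mset j (add_mset (k - j) R)) S)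
      = Ev (add_mset 0 (add_mset k R)) S + (\<Sum>j\<in>{1..<k}. Ev (add_mset j (add_mset (k - j) R)) S)"
    by (subst sum.insert) auto
  also have "Ev (add_mset 0 (add_mset k R)) S = of_nat N * Ev (add_mset k R) S"
  proof -
    have "Ev (add_mset 0 (add_mset k R)) S = (\<integral>g. of_nat N * (pms (add_mset k R) g * cnj (pms S g)) \<partial>\<mu>)"
      unfolding Ev_def by (rule Bochner_Integration.integral_cong) (simp_all add: ptr_0)
    thus ?thesis unfolding Ev_def by simp
  qed
  finally have EP: "(\<integral>g. P g \<partial>\<mu>) = of_nat N * Ev (add_mset k R) S + (\<Sum>j\<in>{1..<k}. Ev (add_mset j (add_mset (k - j) R)) S)" .
  have EQ: "(\<integral>g. Q g \<partial>\<mu>) = (\<Sum>i\<in>#R. of_nat i * Ev (add_mset (k + i) (R - {#i#})) S)"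
    unfolding Q_def Ev_def
    by (subst integral_sum_mset(2), intro integrable_mult_right iEv)
       (intro arg_cong[of _ _ sum_mset] image_mset_cong integral_mult_right_zero)
  have EW: "(\<integral>g. W g \<partial>\<mu>) = loop_rhs (of_nat N) Ev k R S"
  proof -
    have "(\<integral>g. W g \<partial>\<mu>) = (\<Sum>m\<in>#S. \<integral>g. of_nat m *
     (if m = k then of_nat N * (pms R g * cnj (pms (S - {#m#}) g))
      else if m < k then pms (add_mset (k - m) R) g * cnj (pms (S - {#m#}) g)
      else pms R g * cnj (pms (add_mset (m - k) (S - {#m#})) g)) \<partial>\<mu>)"
      unfolding W_def by (rule integral_sum_mset(2), rule iT)
    also have "\<dots> = loop_rhs (of_nat N) Ev k R S"
      unfolding loop_rhs_def
    proof (intro arg_cong[of _ _ sum_mset] image_mset_cong)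
      fix m
      show "(\<integral>g. of_nat m *
         (if m = k then of_nat N * (pms R g * cnj (pms (S - {#m#}) g))
          else if m < k then pms (add_mset (k - m) R) g * cnj (pms (S - {#m#}) g)
          else pms R g * cnj (pms (add_mset (m - k) (S - {#m#})) g)) \<partial>\<mu>) =
         of_nat m *
          (if m = k then of_nat N * Ev R (S - {#m#})
           else if m < k then Ev (add_mset (k - m) R) (S - {#m#})
           else Ev R (add_mset (m - k) (S - {#m#})))"
        unfolding Ev_def integral_mult_right_zero
        by (cases "m = k"; cases "m < k") (simp_all del: pms_add_mset)
    qed
    finally show ?thesis .
  qed
  have "0 = (\<Sum>c<N. \<Sum>d<N. \<integral>g. G c d g \<partial>\<mu>)" using int0(1) by simp
  also have "\<dots> = (\<integral>g. (\<Sum>c<N. \<Sum>d<N. G c d g) \<partial>\<mu>)"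
    by (rule integral_double_sum[OF int0(2), symmetric])
  also have "\<dots> = (\<integral>g. P g + Q g - W g \<partial>\<mu>)"
    by (rule Bochner_Integration.integral_cong) (simp_all add: sum_G)
  also have "\<dots> = (\<integral>g. P g \<partial>\<mu>) + (\<integral>g. Q g \<partial>\<mu>) - (\<integral>g. W g \<partial>\<mu>)"
    using iP iQ iW by simp
  finally show "of_nat N * Ev (add_mset k R) S + loop_sum Ev k R S = loop_rhs (of_nat N) Ev k R S"
    unfolding EP EQ EW loop_sum_def by (simp add: algebra_simps)
qed

lemma Ev_eq_orth:
  assumes "0 \<notin># R" "0 \<notin># S" "\<Sum>\<^sub># R = n" "\<Sum>\<^sub># S = n" "n \<le> N"
  shows "Ev R S = orth R S"
proof -
  have "Ev {#} {#} = orth {#} {#}" using prob_space by (simp add: Ev_def orth_def)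
  with loop_equation_unique[OF loop_equation_Ev loop_equation_orth] assms show ?thesis by blast
qed

lemma Ev_eq_0:
  assumes "\<Sum>\<^sub># R \<noteq> \<Sum>\<^sub># S"
  shows "Ev R S = 0"
proof -
  define m where "m = \<Sum>\<^sub># R"
  define n where "n = \<Sum>\<^sub># S"
  define a where "a = real m - real n"
  have "m \<noteq> n" using assms by (simp add: m_def n_def)
  hence a: "a \<noteq> 0" by (simp add: a_def)
  \<comment> \<open>Chosen so that w^(m - n) = -1: translation by this scalar turns the moment into
    its negative. \<open>a\<close> is real, so either sign of m - n is covered.\<close>
  define w where "w = cis (pi / a)"
  define u where "u = w \<cdot>\<^sub>m 1\<^sub>m N"
  have "mat_adjoint u = cnj w \<cdot>\<^sub>m 1\<^sub>m N"
    by (rule eq_matI) (auto simp: mat_adjoint_eq u_def)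
  moreover have "w * cnj w = 1" by (simp add: w_def cis_cnj cis_mult)
  ultimately have u: "u \<in> U"
    by (auto simp: unitary_group_def u_def mult_smult_distrib[of _ N N _ N] mult.commute
        intro!: eq_matI)
  have pt: "ptr (u * g) k = w ^ k * ptr g k" if g: "g \<in> U" for g k
  proof -
    have "u * g = w \<cdot>\<^sub>m g" using U_carrier[OF g] by (simp add: u_def mult_smult_assoc_mat[of _ N N _ N])
    thus ?thesis using U_carrier[OF g]
      by (simp add: ptr_def pow_mat_smult[of g N] sum_distrib_left)
  qed
  have pm: "pms R (u * g) = w ^ (\<Sum>\<^sub># R) * pms R g" if g: "g \<in> U" for g R
    by (induction R) (auto simp: pt[OF g] power_add mult_ac)
  have "Ev R S = (\<integral>g. pms R (u * g) * cnj (pms S (u * g)) \<partial>\<mu>)"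
    unfolding Ev_def using bdd_meas_pair[of R S]
    by (intro integral_mult_left[OF u, symmetric]) (simp add: bdd_meas_def)
  also have "\<dots> = (\<integral>g. (w ^ m * cnj w ^ n) * (pms R g * cnj (pms S g)) \<partial>\<mu>)"
    by (rule Bochner_Integration.integral_cong) (simp_all add: pm m_def n_def mult_ac)
  also have "\<dots> = (w ^ m * cnj w ^ n) * Ev R S"
    by (simp add: Ev_def)
  also have "w ^ m * cnj w ^ n = cis (pi / a * a)"
  proof -
    have "real m * (pi / a) + real n * - (pi / a) = pi / a * a"
      by (subst (3) a_def) (simp add: algebra_simps)
    thus ?thesis unfolding w_def cis_cnj Complex.DeMoivre cis_mult by simp
  qed
  also have "\<dots> = -1" using a by simp
  finally show ?thesis by simp
qed

end

section \<open>Truncation and tail bound\<close>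

text \<open>Ordered tuples of exponents, one for each factor of the integrand. The cap
  \<open>K\<close> comes from truncating each series.\<close>

definition part_lists :: "nat \<Rightarrow> nat \<Rightarrow> nat list set" where
  "part_lists p K = {ks. set ks \<subseteq> {1..K} \<and> length ks = p}"

lemma finite_part_lists: "finite (part_lists p K)"
  unfolding part_lists_def by (rule finite_lists_length_eq) simp

lemma prod_list_sum_expand:
  fixes f :: "'a \<Rightarrow> nat \<Rightarrow> 'b::comm_semiring_1"
  shows "(\<Prod>x\<leftarrow>xs. \<Sum>k\<in>{1..K}. f x k) =
    (\<Sum>ks\<in>part_lists (length xs) K. \<Prod>i<length xs. f (xs ! i) (ks ! i))"
proof (induction xs)
  case Nil
  have "part_lists 0 K = {[]}" by (auto simp: part_lists_def)
  thus ?case by simp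
next
  case (Cons x xs)
  have part_lists: "part_lists (Suc n) K = (\<lambda>(k, ks). k # ks) ` ({1..K} \<times> part_lists n K)" for n
    by (auto simp: part_lists_def length_Suc_conv image_iff)
  have "(\<Sum>ks\<in>part_lists (length (x # xs)) K. \<Prod>i<length (x # xs). f ((x # xs) ! i) (ks ! i)) =
    (\<Sum>(k, ks)\<in>{1..K} \<times> part_lists (length xs) K. f x k * (\<Prod>i<length xs. f (xs ! i) (ks ! i)))"
    unfolding list.size add_Suc_right add_0_right part_lists
    by (subst sum.reindex)
       (auto simp: inj_on_def prod.lessThan_Suc_shift case_prod_beta simp del: prod.lessThan_Suc intro!: sum.cong)
  also have "\<dots> = (\<Sum>k\<in>{1..K}. f x k) * (\<Sum>ks\<in>part_lists (length xs) K. \<Prod>i<length xs. f (xs ! i) (ks ! i))"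
    by (simp add: sum_product sum.cartesian_product)
  finally show ?case using Cons by simp
qed

text \<open>The shift by 1 is the index lost to differentiation; it is what produces
  \<open>subtract_ones\<close> in the main term.\<close>

definition shifted_monom :: "complex list \<Rightarrow> nat list \<Rightarrow> complex" where
  "shifted_monom xs ks = (\<Prod>i<length xs. (xs ! i) ^ (ks ! i - 1))"

text \<open>Raising each exponent from k - 1 to k costs a factor 1/r for each variable, which later
  goes into the constant.\<close>

lemma norm_shifted_monom_le:
  assumes ks: "ks \<in> part_lists (length xs) K" and r: "0 < r" "\<And>x. x \<in> set xs \<Longrightarrow> norm x \<le> r"
  shows "norm (shifted_monom xs ks) \<le> r ^ sum_list ks / r ^ length xs"
proof -
  have k: "1 \<le> ks ! i" if "i < length xs" for i
  proof -
    have "ks ! i \<in> set ks" using ks that by (simp add: part_lists_def)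
    hence "ks ! i \<in> {1..K}" using ks unfolding part_lists_def by blast
    thus ?thesis by simp
  qed
  have "norm (shifted_monom xs ks) \<le> (\<Prod>i<length xs. r ^ (ks ! i - 1))"
    unfolding shifted_monom_def prod_norm[symmetric]
    using r by (intro prod_mono) (auto simp: norm_power intro!: power_mono)
  also have "\<dots> = (\<Prod>i<length xs. r ^ (ks ! i) / r)"
    using r k by (intro prod.cong refl) (simp add: power_diff)
  also have "\<dots> = r ^ sum_list ks / r ^ length xs"
    using ks by (simp add: prod_dividef sum_list_sum_nth part_lists_def power_sum lessThan_atLeast0)
  finally show ?thesis .
qed

text \<open>Given the total, the first entry is determined by the others, which lie between 1 and
  \<open>n\<close>. For \<open>p = 0\<close> truncated subtraction gives n^0 = 1, matching the empty
  list; here the terms (l - 1)^+ of the two lengths originate.\<close>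

lemma card_part_lists_sum_le: "card {ks \<in> part_lists p K. sum_list ks = n} \<le> n ^ (p - 1)"
proof (cases p)
  case 0
  have "{ks \<in> part_lists p K. sum_list ks = n} \<subseteq> {[]}" using 0 by (auto simp: part_lists_def)
  from card_mono[OF _ this] show ?thesis using 0 by simp
next
  case (Suc m)
  let ?A = "{ks \<in> part_lists p K. sum_list ks = n}"
  let ?B = "{ks. set ks \<subseteq> {1..n} \<and> length ks = m}"
  have "card ?A \<le> card ?B"
  proof (rule card_inj_on_le[of tl])
    show "inj_on tl ?A"
    proof (rule inj_onI)
      fix ks ls assume *: "ks \<in> ?A" "ls \<in> ?A" "tl ks = tl ls"
      from *(1,2) Suc obtain k ks' l ls' where "ks = k # ks'" "ls = l # ls'"
        by (cases ks; cases ls) (auto simp: part_lists_def)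
      thus "ks = ls" using * by simp
    qed
    show "tl ` ?A \<subseteq> ?B"
    proof safe
      fix ks x assume ks: "ks \<in> part_lists p K" "n = sum_list ks" and x: "x \<in> set (tl ks)"
      from ks Suc obtain k ks' where k: "ks = k # ks'" by (auto simp: part_lists_def length_Suc_conv)
      have "x \<le> sum_list ks'" using x k by (intro member_le_sum_list) auto
      thus "x \<in> {1..sum_list ks}" using ks x k by (auto simp: part_lists_def)
    qed (use Suc in \<open>auto simp: part_lists_def\<close>)
    show "finite ?B" by (rule finite_lists_length_eq) simp
  qed
  also have "\<dots> = n ^ m" by (simp add: card_lists_length_eq)
  finally show ?thesis using Suc by simp
qed

lemma summable_poly_geometric:
  fixes x :: real
  assumes "0 < x" "x < 1"
  shows "summable (\<lambda>m. (1 + real m) ^ a * x ^ m)"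
proof -
  \<comment> \<open>The midpoint of \<open>x\<close> and 1: successive ratios tend to
    \<open>x\<close> and so are eventually below it.\<close>
  define c where "c = (1 + x) / 2"
  have c: "x < c" "c < 1" using assms by (auto simp: c_def)
  have "(\<lambda>m. ((2 + real m) / (1 + real m)) ^ a * x) \<longlonglongrightarrow> 1 ^ a * x"
  proof (intro tendsto_intros)
    have "(\<lambda>m. 1 + inverse (real (Suc m))) \<longlonglongrightarrow> 1 + 0"
      by (intro tendsto_intros LIMSEQ_inverse_real_of_nat)
    moreover have "(2 + real m) / (1 + real m) = 1 + inverse (real (Suc m))" for m
      by (simp add: field_simps)
    ultimately show "(\<lambda>m. (2 + real m) / (1 + real m)) \<longlonglongrightarrow> 1" by simp
  qed
  hence "eventually (\<lambda>m. ((2 + real m) / (1 + real m)) ^ a * x < c) sequentially"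
    using c by (intro order_tendstoD(2)) auto
  then obtain M where M: "\<And>m. m \<ge> M \<Longrightarrow> ((2 + real m) / (1 + real m)) ^ a * x < c"
    by (auto simp: eventually_sequentially)
  show ?thesis
  proof (rule summable_ratio_test[OF c(2)])
    fix m assume m: "m \<ge> M"
    have "(1 + real (Suc m)) ^ a * x ^ Suc m = ((2 + real m) / (1 + real m)) ^ a * x * ((1 + real m) ^ a * x ^ m)"
      by (simp add: power_divide)
    also have "\<dots> \<le> c * ((1 + real m) ^ a * x ^ m)"
      using M[OF m] assms by (intro mult_right_mono) auto
    finally show "norm ((1 + real (Suc m)) ^ a * x ^ Suc m) \<le> c * norm ((1 + real m) ^ a * x ^ m)"
      using assms by simp
  qed
qed

text \<open>For \<open>n0 = N\<close> these are the pairs on which moments and \<open>orth\<close>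
  may disagree; with \<open>n0 = 0\<close> the same sums control convergence of the main
  term.\<close>

definition tail_pairs :: "nat \<Rightarrow> nat \<Rightarrow> nat \<Rightarrow> nat \<Rightarrow> (nat list \<times> nat list) set" where
  "tail_pairs p q K n0 = {(ks, ls) \<in> part_lists p K \<times> part_lists q K. sum_list ks = sum_list ls \<and> n0 < sum_list ks}"

lemma finite_tail_pairs: "finite (tail_pairs p q K n0)"
  by (rule finite_subset[of _ "part_lists p K \<times> part_lists q K"]) (auto simp: tail_pairs_def finite_part_lists)

text \<open>Grouping by the common degree leaves n^a r^(2n). Writing n = n0 + m, the inequality n0 +
  m <= max 1 n0 * (1 + m) splits the dependence on \<open>n0\<close> off from a convergent series in
  m, whose sum is the witness for \<open>D\<close>.\<close>

lemma tail_sum_le: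
  fixes r :: real
  assumes r: "0 < r" "r < 1"
  shows "\<exists>D\<ge>0. \<forall>K n0. (\<Sum>(ks, ls)\<in>tail_pairs p q K n0. r ^ sum_list ks * r ^ sum_list ls * real (sum_list ks) ^ (p + q))
     \<le> D * real (max 1 n0) ^ ((p + q) + (p - 1) + (q - 1)) * r ^ (2 * n0)"
proof -
  define a where "a = (p + q) + (p - 1) + (q - 1)"
  define c where "c m = (1 + real m) ^ a * (r\<^sup>2) ^ m" for m
  have sc: "summable c"
    unfolding c_def using r by (intro summable_poly_geometric) (auto simp: power_less_one_iff)
  have c0: "c m \<ge> 0" for m by (simp add: c_def)
  show ?thesis
  proof (intro exI[of _ "suminf c"] conjI allI)
    show "suminf c \<ge> 0" by (rule suminf_nonneg[OF sc c0])
    fix K n0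
    define T where "T = tail_pairs p q K n0"
    define W where "W n = r ^ n * r ^ n * real n ^ (p + q)" for n
    define s where "s = (\<lambda>(ks :: nat list, ls :: nat list). sum_list ks)"
    have finT: "finite T" unfolding T_def by (rule finite_tail_pairs)
    \<comment> \<open>An upper end for the degrees that occur; adding \<open>n0\<close> keeps it at
      least \<open>n0\<close>, as the later shift requires.\<close>
    define Mx where "Mx = n0 + Max (insert 0 (s ` T))"
    have sT: "s ` T \<subseteq> {n0<..Mx}"
    proof
      fix n assume n: "n \<in> s ` T"
      hence "n \<le> Max (insert 0 (s ` T))" using finT by (intro Max_ge) auto
      moreover have "n0 < n" using n by (auto simp: s_def T_def tail_pairs_def)
      ultimately show "n \<in> {n0<..Mx}" by (auto simp: Mx_def)
    qed
    have "(\<Sum>(ks, ls)\<in>T. r ^ sum_list ks * r ^ sum_list ls * real (sum_list ks) ^ (p + q)) = (\<Sum>x\<in>T. W (s x))"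
      by (intro sum.cong) (auto simp: T_def tail_pairs_def W_def s_def)
    also have "\<dots> = (\<Sum>n\<in>{n0<..Mx}. \<Sum>x\<in>{x\<in>T. s x = n}. W (s x))"
      by (rule sum.group[OF finT _ sT, symmetric]) simp
    also have "\<dots> \<le> (\<Sum>n\<in>{n0<..Mx}. real n ^ a * (r\<^sup>2) ^ n)"
    proof (rule sum_mono)
      fix n
      have "card {x\<in>T. s x = n} \<le> card ({ks \<in> part_lists p K. sum_list ks = n} \<times> {ls \<in> part_lists q K. sum_list ls = n})"
        by (intro card_mono) (auto simp: T_def tail_pairs_def s_def finite_part_lists)
      also have "\<dots> \<le> n ^ (p - 1) * n ^ (q - 1)"
        unfolding card_cartesian_product by (intro mult_mono card_part_lists_sum_le) auto
      finally have "real (card {x\<in>T. s x = n}) \<le> real n ^ (p - 1) * real n ^ (q - 1)"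
        by (simp flip: of_nat_mult of_nat_power)
      hence "real (card {x\<in>T. s x = n}) * W n \<le> (real n ^ (p - 1) * real n ^ (q - 1)) * W n"
        using r by (intro mult_right_mono) (auto simp: W_def)
      also have "\<dots> = real n ^ a * (r\<^sup>2) ^ n"
        by (simp add: W_def a_def power_add power2_eq_square power_mult_distrib mult_ac)
      finally show "(\<Sum>x\<in>{x\<in>T. s x = n}. W (s x)) \<le> real n ^ a * (r\<^sup>2) ^ n" by simp
    qed
    also have "\<dots> \<le> (\<Sum>m\<in>{..Mx - n0}. real (max 1 n0) ^ a * r ^ (2 * n0) * c m)"
    proof -
      have "(\<Sum>n\<in>{n0<..Mx}. real n ^ a * (r\<^sup>2) ^ n) \<le> (\<Sum>n\<in>{n0..Mx}. real n ^ a * (r\<^sup>2) ^ n)"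
        by (intro sum_mono2) auto
      also have "\<dots> = (\<Sum>m\<in>{..Mx - n0}. real (n0 + m) ^ a * (r\<^sup>2) ^ (n0 + m))"
        by (rule sum.reindex_bij_witness[of _ "\<lambda>m. n0 + m" "\<lambda>n. n - n0"]) (auto simp: Mx_def)
      also have "\<dots> \<le> (\<Sum>m\<in>{..Mx - n0}. real (max 1 n0) ^ a * r ^ (2 * n0) * c m)"
      proof (rule sum_mono)
        fix m
        have "real (n0 + m) \<le> real (max 1 n0) * (1 + real m)"
        proof -
          have "n0 + m \<le> max 1 n0 * (1 + m)"
            by (cases n0) (auto simp: max_def algebra_simps)
          thus ?thesis by (metis of_nat_le_iff of_nat_mult of_nat_1 of_nat_add)
        qed
        hence "real (n0 + m) ^ a \<le> (real (max 1 n0) * (1 + real m)) ^ a"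
          by (intro power_mono) auto
        hence "real (n0 + m) ^ a * (r\<^sup>2) ^ (n0 + m) \<le> (real (max 1 n0) * (1 + real m)) ^ a * (r\<^sup>2) ^ (n0 + m)"
          using r by (intro mult_right_mono) auto
        also have "\<dots> = real (max 1 n0) ^ a * r ^ (2 * n0) * c m"
          by (simp add: c_def power_mult_distrib power_add power_mult)
        finally show "real (n0 + m) ^ a * (r\<^sup>2) ^ (n0 + m) \<le> real (max 1 n0) ^ a * r ^ (2 * n0) * c m" .
      qed
      finally show ?thesis .
    qed
    also have "\<dots> = real (max 1 n0) ^ a * r ^ (2 * n0) * (\<Sum>m\<in>{..Mx - n0}. c m)"
      by (simp add: sum_distrib_left)
    also have "\<dots> \<le> real (max 1 n0) ^ a * r ^ (2 * n0) * suminf c"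
      using r c0 by (intro mult_left_mono sum_le_suminf sc) auto
    finally show "(\<Sum>(ks, ls)\<in>tail_pairs p q K n0. r ^ sum_list ks * r ^ sum_list ls * real (sum_list ks) ^ (p + q))
     \<le> suminf c * real (max 1 n0) ^ ((p + q) + (p - 1) + (q - 1)) * r ^ (2 * n0)"
      unfolding T_def a_def by (simp add: mult_ac)
  qed
qed

subsection \<open>The main term\<close>

text \<open>\<open>monomial_sym\<close> compares positive parts only; the size then fixes how many
  zeros were used as padding.\<close>

lemma multiset_eq_of_pos_parts:
  fixes X Y :: "nat multiset"
  assumes f: "filter_mset (\<lambda>i. 0 < i) X = filter_mset (\<lambda>i. 0 < i) Y" and s: "size X = size Y"
  shows "X = Y"
proof -
  have *: "X = filter_mset (\<lambda>i. 0 < i) X + replicate_mset (count X 0) 0" for X :: "nat multiset"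
    by (rule multiset_eqI) auto
  have "size (filter_mset (\<lambda>i. 0 < i) X) + count X 0 = size X" for X :: "nat multiset"
    by (subst (3) *[of X]) (simp only: size_union size_replicate_mset)
  from this[of X] this[of Y] have "count X 0 = count Y 0" using f s by simp
  thus ?thesis using *[of X] *[of Y] f by simp
qed

text \<open>Because the length of the partition equals the number of variables, lowering every entry
  of its rearrangements by 1 gives exactly the zero-padded rearrangements of
  \<open>subtract_ones pt\<close>.\<close>

lemma monomial_sym_subtract_ones:
  assumes pt: "pt \<in> partitions" "size pt = length xs"
  shows "monomial_sym (subtract_ones pt) xs = (\<Sum>ks | mset ks = pt. shifted_monom xs ks)"
  unfolding monomial_sym_def
proof (rule sum.reindex_bij_witness[of _ "map (\<lambda>k. k - 1)" "map Suc"])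
  fix \<alpha> assume "\<alpha> \<in> {\<alpha>. length \<alpha> = length xs \<and> filter_mset (\<lambda>i. 0 < i) (mset \<alpha>) = subtract_ones pt}"
  hence a: "length \<alpha> = length xs" "filter_mset (\<lambda>i. 0 < i) (mset \<alpha>) = subtract_ones pt" by auto
  have "mset \<alpha> = image_mset (\<lambda>i. i - 1) pt"
    by (rule multiset_eq_of_pos_parts) (use a pt in \<open>auto simp: subtract_ones_def\<close>)
  hence "mset (map Suc \<alpha>) = image_mset (\<lambda>i. Suc (i - 1)) pt"
    by (simp add: image_mset.compositionality o_def)
  also have "\<dots> = image_mset (\<lambda>i. i) pt"
    using pt by (intro image_mset_cong) (auto simp: partitions_def intro!: Suc_pred gr0I)
  finally show "map Suc \<alpha> \<in> {ks. mset ks = pt}" by simp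
  show "map (\<lambda>k. k - 1) (map Suc \<alpha>) = \<alpha>" by (simp add: o_def)
  show "shifted_monom xs (map Suc \<alpha>) = (\<Prod>i<length xs. xs ! i ^ \<alpha> ! i)"
    using a by (simp add: shifted_monom_def)
next
  fix ks assume ks: "ks \<in> {ks. mset ks = pt}"
  hence l: "length ks = length xs" using pt by auto
  have pos: "0 < k" if "k \<in> set ks" for k
    using ks pt that by (auto simp: partitions_def intro!: gr0I)
  show "map Suc (map (\<lambda>k. k - 1) ks) = ks"
    using pos by (simp add: o_def map_idI)
  show "map (\<lambda>k. k - 1) ks \<in> {\<alpha>. length \<alpha> = length xs \<and> filter_mset (\<lambda>i. 0 < i) (mset \<alpha>) = subtract_ones pt}"
    using ks l by (auto simp: subtract_ones_def)
qed

text \<open>Translates between the main term, indexed by partitions, and pairs of tuples tied by the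
  Kronecker delta of \<open>orth\<close>. The ring is left general because complex terms and their
  real norms are both regrouped.\<close>

lemma sum_part_lists_group:
  fixes u v :: "nat list \<Rightarrow> 'a::comm_ring_1" and c :: "nat multiset \<Rightarrow> 'a"
  shows "(\<Sum>pt\<in>mset ` part_lists p K. c pt * (\<Sum>ks | mset ks = pt. u ks) * (\<Sum>ls | mset ls = pt. v ls)) =
         (\<Sum>ks\<in>part_lists p K. \<Sum>ls\<in>part_lists p K. if mset ls = mset ks then c (mset ks) * u ks * v ls else 0)"
proof -
  have fib: "{ks. mset ks = pt} = {ks \<in> part_lists p K. mset ks = pt}" if "pt \<in> mset ` part_lists p K" for pt
    using that by (auto simp: part_lists_def dest: mset_eq_setD mset_eq_length)
  have "(\<Sum>pt\<in>mset ` part_lists p K. c pt * (\<Sum>ks | mset ks = pt. u ks) * (\<Sum>ls | mset ls = pt. v ls)) =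
    (\<Sum>pt\<in>mset ` part_lists p K. \<Sum>ks\<in>{ks \<in> part_lists p K. mset ks = pt}. c (mset ks) * u ks * (\<Sum>ls\<in>{ls \<in> part_lists p K. mset ls = mset ks}. v ls))"
  proof (rule sum.cong[OF refl])
    fix pt assume pt: "pt \<in> mset ` part_lists p K"
    have "c pt * (\<Sum>ks\<in>{ks \<in> part_lists p K. mset ks = pt}. u ks) * V =
        (\<Sum>ks\<in>{ks \<in> part_lists p K. mset ks = pt}. c pt * u ks * V)" for V
      by (simp add: sum_distrib_left sum_distrib_right)
    thus "c pt * (\<Sum>ks | mset ks = pt. u ks) * (\<Sum>ls | mset ls = pt. v ls) =
      (\<Sum>ks\<in>{ks \<in> part_lists p K. mset ks = pt}. c (mset ks) * u ks * (\<Sum>ls\<in>{ls \<in> part_lists p K. mset ls = mset ks}. v ls))"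
      unfolding fib[OF pt] by (auto intro: sum.cong)
  qed
  also have "\<dots> = (\<Sum>ks\<in>part_lists p K. c (mset ks) * u ks * (\<Sum>ls\<in>{ls \<in> part_lists p K. mset ls = mset ks}. v ls))"
    by (rule sum.image_gen[OF finite_part_lists, symmetric])
  also have "\<dots> = (\<Sum>ks\<in>part_lists p K. \<Sum>ls\<in>part_lists p K. if mset ls = mset ks then c (mset ks) * u ks * v ls else 0)"
    unfolding sum_distrib_left sum.inter_filter[OF finite_part_lists] by (intro sum.cong refl) auto
  finally show ?thesis .
qed

definition main_summand :: "complex list \<Rightarrow> complex list \<Rightarrow> nat multiset \<Rightarrow> complex" where
  "main_summand E F pt = of_nat (z_part pt) * monomial_sym (subtract_ones pt) E
                     * monomial_sym (subtract_ones pt) F"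

definition parts_of_length :: "nat \<Rightarrow> nat multiset set" where
  "parts_of_length p = {pt \<in> partitions. size pt = p}"

lemma mset_part_lists_subset: "mset ` part_lists p K \<subseteq> parts_of_length p"
  by (auto simp: part_lists_def parts_of_length_def partitions_def)

text \<open>A finite set of partitions has bounded parts, so the truncated families are cofinal
  among finite sets. They therefore decide both summability and the value of the infinite
  sum.\<close>

lemma mset_part_lists_exhausts:
  assumes "finite X" "X \<subseteq> parts_of_length p"
  shows "\<exists>K0. \<forall>K\<ge>K0. X \<subseteq> mset ` part_lists p K"
proof (intro exI allI impI subsetI)
  fix K pt assume K: "K \<ge> Max (insert 0 (\<Union>(set_mset ` X)))" and pt: "pt \<in> X"
  obtain ks where ks: "pt = mset ks" by (metis ex_mset)
  have "k \<in> {1..K}" if k: "k \<in> set ks" for k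
  proof -
    have "k \<in># pt" using ks k by simp
    hence "k \<in> \<Union>(set_mset ` X)" using pt by blast
    hence "k \<le> Max (insert 0 (\<Union>(set_mset ` X)))"
      using assms(1) by (intro Max_ge) auto
    moreover have "0 \<notin># pt" using assms(2) pt by (auto simp: parts_of_length_def partitions_def)
    hence "k \<noteq> 0" using ks k by (metis set_mset_mset)
    ultimately show ?thesis using K by auto
  qed
  moreover have "length ks = p" using assms(2) pt ks by (auto simp: parts_of_length_def)
  ultimately show "pt \<in> mset ` part_lists p K" using ks by (auto simp: part_lists_def)
qed

lemma sum_main_summand:
  assumes "length E = p" "length F = p"
  shows "(\<Sum>pt\<in>mset ` part_lists p K. main_summand E F pt) =
    (\<Sum>ks\<in>part_lists p K. \<Sum>ls\<in>part_lists p K. shifted_monom E ks * shifted_monom F ls * orth (mset ls) (mset ks))"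
proof -
  have "(\<Sum>pt\<in>mset ` part_lists p K. main_summand E F pt) =
    (\<Sum>pt\<in>mset ` part_lists p K. of_nat (z_part pt) * (\<Sum>ks | mset ks = pt. shifted_monom E ks) * (\<Sum>ls | mset ls = pt. shifted_monom F ls))"
    using mset_part_lists_subset[of p K] assms
    by (intro sum.cong refl) (auto simp: main_summand_def monomial_sym_subtract_ones parts_of_length_def)
  also have "\<dots> = (\<Sum>ks\<in>part_lists p K. \<Sum>ls\<in>part_lists p K. if mset ls = mset ks then of_nat (z_part (mset ks)) * shifted_monom E ks * shifted_monom F ls else 0)"
    by (rule sum_part_lists_group)
  also have "\<dots> = (\<Sum>ks\<in>part_lists p K. \<Sum>ls\<in>part_lists p K. shifted_monom E ks * shifted_monom F ls * orth (mset ls) (mset ks))"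
    by (intro sum.cong refl) (auto simp: orth_def)
  finally show ?thesis .
qed

lemma z_part_part_lists_le:
  assumes "ks \<in> part_lists p K" "n \<ge> sum_list ks"
  shows "real (z_part (mset ks)) \<le> fact p * real n ^ p"
proof -
  have "x \<le> n" if "x \<in># mset ks" for x
    using that assms(2) by (intro order_trans[OF member_le_sum_list assms(2)]) auto
  hence "z_part (mset ks) \<le> fact (size (mset ks)) * n ^ size (mset ks)" by (rule z_part_le)
  hence "z_part (mset ks) \<le> fact p * n ^ p"
    using assms(1) by (simp add: part_lists_def)
  hence "real (z_part (mset ks)) \<le> real (fact p * n ^ p)" by (rule of_nat_mono)
  thus ?thesis by simp
qed

text \<open>An infinite sum takes the default value 0 when it does not converge, so convergence
  gives the main term its meaning. Sums of norms over finite sets are dominated by truncated pair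
  sums, which the tail estimate at \<open>n0 = 0\<close> bounds uniformly in
  \<open>K\<close>.\<close>

lemma main_summand_summable:
  assumes len: "length E = p" "length F = p"
    and r: "0 < r" "r < 1" "\<And>x. x \<in> set E \<union> set F \<Longrightarrow> norm x \<le> r"
  shows "main_summand E F summable_on parts_of_length p"
proof (cases "p = 0")
  \<comment> \<open>The empty partition has degree 0, which \<open>tail_pairs\<close> with
    \<open>n0 = 0\<close> leaves out.\<close>
  case True
  have "parts_of_length p = {{#}}" using True by (auto simp: parts_of_length_def partitions_def)
  thus ?thesis by (simp add: summable_on_finite)
next
  case False
  obtain D where D: "D \<ge> 0" "\<And>K n0. (\<Sum>(ks, ls)\<in>tail_pairs p p K n0. r ^ sum_list ks * r ^ sum_list ls * real (sum_list ks) ^ (p + p))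
     \<le> D * real (max 1 n0) ^ ((p + p) + (p - 1) + (p - 1)) * r ^ (2 * n0)"
    using tail_sum_le[OF r(1,2), of p p] by blast
  define B where "B = fact p / (r ^ p * r ^ p) * D"
  have part_lists_bound: "(\<Sum>pt\<in>mset ` part_lists p K. norm (main_summand E F pt)) \<le> B" for K
  proof -
    have "(\<Sum>pt\<in>mset ` part_lists p K. norm (main_summand E F pt)) \<le>
      (\<Sum>pt\<in>mset ` part_lists p K. real (z_part pt) * (\<Sum>ks | mset ks = pt. norm (shifted_monom E ks)) * (\<Sum>ls | mset ls = pt. norm (shifted_monom F ls)))"
    proof (rule sum_mono)
      fix pt assume "pt \<in> mset ` part_lists p K"
      hence pt: "pt \<in> partitions" "size pt = p" using mset_part_lists_subset[of p K] by (auto simp: parts_of_length_def)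
      show "norm (main_summand E F pt) \<le> real (z_part pt) * (\<Sum>ks | mset ks = pt. norm (shifted_monom E ks)) * (\<Sum>ls | mset ls = pt. norm (shifted_monom F ls))"
        using pt len
        by (auto simp: main_summand_def monomial_sym_subtract_ones norm_mult
            intro!: mult_mono norm_sum sum_nonneg mult_nonneg_nonneg)
    qed
    also have "\<dots> = (\<Sum>ks\<in>part_lists p K. \<Sum>ls\<in>part_lists p K. if mset ls = mset ks then real (z_part (mset ks)) * norm (shifted_monom E ks) * norm (shifted_monom F ls) else 0)"
      by (rule sum_part_lists_group)
    also have "\<dots> = (\<Sum>(ks, ls)\<in>part_lists p K \<times> part_lists p K. if mset ls = mset ks then real (z_part (mset ks)) * norm (shifted_monom E ks) * norm (shifted_monom F ls) else 0)"
      by (rule sum.cartesian_product)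
    also have "\<dots> = (\<Sum>(ks, ls)\<in>tail_pairs p p K 0. if mset ls = mset ks then real (z_part (mset ks)) * norm (shifted_monom E ks) * norm (shifted_monom F ls) else 0)"
    proof (rule sum.mono_neutral_right)
      show "finite (part_lists p K \<times> part_lists p K)" by (simp add: finite_part_lists)
      show "tail_pairs p p K 0 \<subseteq> part_lists p K \<times> part_lists p K" by (auto simp: tail_pairs_def)
      show "\<forall>x\<in>part_lists p K \<times> part_lists p K - tail_pairs p p K 0.
         (case x of (ks, ls) \<Rightarrow> if mset ls = mset ks then real (z_part (mset ks)) * norm (shifted_monom E ks) * norm (shifted_monom F ls) else 0) = 0"
      proof
        fix x assume x: "x \<in> part_lists p K \<times> part_lists p K - tail_pairs p p K 0"
        obtain ks ls where xl: "x = (ks, ls)" by fastforce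
        have b: "ks \<in> part_lists p K" "ls \<in> part_lists p K" and n: "(ks, ls) \<notin> tail_pairs p p K 0"
          using x xl by auto
        have "0 < sum_list ks"
          using b False by (cases ks) (auto simp: part_lists_def)
        hence "sum_list ks \<noteq> sum_list ls" using n b by (simp add: tail_pairs_def)
        hence "mset ls \<noteq> mset ks" by (metis sum_mset_sum_list)
        thus "(case x of (ks, ls) \<Rightarrow> if mset ls = mset ks then real (z_part (mset ks)) * norm (shifted_monom E ks) * norm (shifted_monom F ls) else 0) = 0"
          by (simp add: xl)
      qed
    qed
    also have "\<dots> \<le> (\<Sum>(ks, ls)\<in>tail_pairs p p K 0. fact p / (r ^ p * r ^ p) * (r ^ sum_list ks * r ^ sum_list ls * real (sum_list ks) ^ (p + p)))"
    proof (rule sum_mono, clarify)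
      fix ks ls assume "(ks, ls) \<in> tail_pairs p p K 0"
      hence b: "ks \<in> part_lists p K" "ls \<in> part_lists p K" and s: "sum_list ks = sum_list ls" "0 < sum_list ks"
        by (auto simp: tail_pairs_def)
      have "real (z_part (mset ks)) \<le> fact p * real (sum_list ks) ^ p"
        by (rule z_part_part_lists_le[OF b(1)]) simp
      \<comment> \<open>The exponent grows to \<open>p + p\<close> to fit the tail estimate; the
        degree is at least 1.\<close>
      also have "\<dots> \<le> fact p * real (sum_list ks) ^ (p + p)"
        using s by (intro mult_left_mono power_increasing) auto
      finally have "real (z_part (mset ks)) * norm (shifted_monom E ks) * norm (shifted_monom F ls) \<le>
        fact p * real (sum_list ks) ^ (p + p) * (r ^ sum_list ks / r ^ p) * (r ^ sum_list ls / r ^ p)"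
        using norm_shifted_monom_le[of ks E K r] norm_shifted_monom_le[of ls F K r] b r len
        by (intro mult_mono) auto
      also have "\<dots> = fact p / (r ^ p * r ^ p) * (r ^ sum_list ks * r ^ sum_list ls * real (sum_list ks) ^ (p + p))"
        by simp
      finally show "(if mset ls = mset ks then real (z_part (mset ks)) * norm (shifted_monom E ks) * norm (shifted_monom F ls) else 0)
        \<le> fact p / (r ^ p * r ^ p) * (r ^ sum_list ks * r ^ sum_list ls * real (sum_list ks) ^ (p + p))"
        using r by auto
    qed
    also have "\<dots> = fact p / (r ^ p * r ^ p) * (\<Sum>(ks, ls)\<in>tail_pairs p p K 0. r ^ sum_list ks * r ^ sum_list ls * real (sum_list ks) ^ (p + p))"
      by (simp add: sum_distrib_left case_prod_beta)
    also have "\<dots> \<le> B"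
      unfolding B_def using D(2)[of K 0] r by (intro mult_left_mono) auto
    finally show ?thesis .
  qed
  have "(\<lambda>pt. norm (main_summand E F pt)) summable_on parts_of_length p"
  proof (rule nonneg_bdd_above_summable_on)
    show "bdd_above (sum (\<lambda>pt. norm (main_summand E F pt)) ` {X. X \<subseteq> parts_of_length p \<and> finite X})"
    proof (rule bdd_aboveI2)
      fix X assume "X \<in> {X. X \<subseteq> parts_of_length p \<and> finite X}"
      then obtain K where K: "X \<subseteq> mset ` part_lists p K" using mset_part_lists_exhausts[of X p] by blast
      have "(\<Sum>pt\<in>X. norm (main_summand E F pt)) \<le> (\<Sum>pt\<in>mset ` part_lists p K. norm (main_summand E F pt))"
        using K by (intro sum_mono2) (auto simp: finite_part_lists)
      also have "\<dots> \<le> B" by (rule part_lists_bound)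
      finally show "(\<Sum>pt\<in>X. norm (main_summand E F pt)) \<le> B" .
    qed
  qed simp
  thus ?thesis by (rule abs_summable_summable)
qed

lemma main_summand_tendsto:
  assumes "length E = p" "length F = p" "0 < r" "r < 1" "\<And>x. x \<in> set E \<union> set F \<Longrightarrow> norm x \<le> r"
  shows "(\<lambda>K. \<Sum>pt\<in>mset ` part_lists p K. main_summand E F pt) \<longlonglongrightarrow> infsum (main_summand E F) (parts_of_length p)"
proof -
  have "(main_summand E F has_sum infsum (main_summand E F) (parts_of_length p)) (parts_of_length p)"
    using main_summand_summable[OF assms] by (rule has_sum_infsum)
  hence "(sum (main_summand E F) \<longlongrightarrow> infsum (main_summand E F) (parts_of_length p))
      (finite_subsets_at_top (parts_of_length p))"
    by (simp add: has_sum_def)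
  moreover have "filterlim (\<lambda>K. mset ` part_lists p K) (finite_subsets_at_top (parts_of_length p)) sequentially"
    unfolding filterlim_finite_subsets_at_top
  proof (intro allI impI)
    fix X assume "finite X \<and> X \<subseteq> parts_of_length p"
    then obtain K0 where "\<And>K. K \<ge> K0 \<Longrightarrow> X \<subseteq> mset ` part_lists p K" using mset_part_lists_exhausts[of X p] by blast
    thus "\<forall>\<^sub>F K in sequentially. finite (mset ` part_lists p K) \<and> X \<subseteq> mset ` part_lists p K \<and> mset ` part_lists p K \<subseteq> parts_of_length p"
      using mset_part_lists_subset by (auto simp: eventually_sequentially finite_part_lists)
  qed
  ultimately show ?thesis by (rule filterlim_compose)
qed

subsection \<open>The truncated ratios\<close>

context haar
begin

definition trunc :: "nat \<Rightarrow> complex list \<Rightarrow> complex list \<Rightarrow> complex mat \<Rightarrow> complex" where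
  "trunc K E F g = (\<Prod>e\<leftarrow>E. \<Sum>k\<in>{1..K}. - cnj (ptr g k) * e ^ (k - 1)) *
                   (\<Prod>f\<leftarrow>F. \<Sum>k\<in>{1..K}. - ptr g k * f ^ (k - 1))"

lemma prod_neg_ptr:
  assumes "length ks = length xs"
  shows "(\<Prod>i<length xs. - ptr g (ks ! i) * (xs ! i) ^ (ks ! i - 1)) =
     (- 1) ^ length xs * shifted_monom xs ks * pms (mset ks) g"
proof -
  have "pms (mset ks) g = (\<Prod>i<length xs. ptr g (ks ! i))"
    using assms by (simp add: pms_def prod_mset_prod_list prod.list_conv_set_nth lessThan_atLeast0 flip: mset_map)
  moreover have "(\<Prod>i<length xs. - ptr g (ks ! i) * (xs ! i) ^ (ks ! i - 1)) =
     (\<Prod>i<length xs. - 1) * (\<Prod>i<length xs. (xs ! i) ^ (ks ! i - 1)) * (\<Prod>i<length xs. ptr g (ks ! i))"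
    unfolding prod.distrib[symmetric] by (intro prod.cong) auto
  ultimately show ?thesis by (simp add: shifted_monom_def)
qed

lemma trunc_expand:
  "trunc K E F g = (- 1) ^ (length E + length F) *
    (\<Sum>ks\<in>part_lists (length E) K. \<Sum>ls\<in>part_lists (length F) K.
       shifted_monom E ks * shifted_monom F ls * (pms (mset ls) g * cnj (pms (mset ks) g)))"
proof -
  have "(\<Prod>e\<leftarrow>E. \<Sum>k\<in>{1..K}. - cnj (ptr g k) * e ^ (k - 1)) =
      (\<Sum>ks\<in>part_lists (length E) K. \<Prod>i<length E. - cnj (ptr g (ks ! i)) * (E ! i) ^ (ks ! i - 1))"
    by (rule prod_list_sum_expand)
  also have "\<dots> = (\<Sum>ks\<in>part_lists (length E) K. (- 1) ^ length E * shifted_monom E ks * cnj (pms (mset ks) g))"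
  proof (rule sum.cong[OF refl])
    fix ks assume "ks \<in> part_lists (length E) K"
    hence l: "length ks = length (map cnj E)" by (simp add: part_lists_def)
    \<comment> \<open>Here the traces are conjugated and the variables are not; conjugating the
      whole product brings it into the form of \<open>prod_neg_ptr\<close> with variables
      \<open>map cnj E\<close>.\<close>
    have "(\<Prod>i<length E. - cnj (ptr g (ks ! i)) * (E ! i) ^ (ks ! i - 1)) =
      cnj (\<Prod>i<length (map cnj E). - ptr g (ks ! i) * (map cnj E ! i) ^ (ks ! i - 1))"
      by simp
    also have "\<dots> = cnj ((- 1) ^ length (map cnj E) * shifted_monom (map cnj E) ks * pms (mset ks) g)"
      unfolding prod_neg_ptr[OF l] ..
    also have "\<dots> = (- 1) ^ length E * shifted_monom E ks * cnj (pms (mset ks) g)"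
      by (simp add: shifted_monom_def)
    finally show "(\<Prod>i<length E. - cnj (ptr g (ks ! i)) * (E ! i) ^ (ks ! i - 1)) =
        (- 1) ^ length E * shifted_monom E ks * cnj (pms (mset ks) g)" .
  qed
  finally have 1: "(\<Prod>e\<leftarrow>E. \<Sum>k\<in>{1..K}. - cnj (ptr g k) * e ^ (k - 1)) = \<dots>" .
  have "(\<Prod>f\<leftarrow>F. \<Sum>k\<in>{1..K}. - ptr g k * f ^ (k - 1)) =
      (\<Sum>ls\<in>part_lists (length F) K. \<Prod>i<length F. - ptr g (ls ! i) * (F ! i) ^ (ls ! i - 1))"
    by (rule prod_list_sum_expand)
  also have "\<dots> = (\<Sum>ls\<in>part_lists (length F) K. (- 1) ^ length F * shifted_monom F ls * pms (mset ls) g)"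
    by (intro sum.cong refl prod_neg_ptr) (simp add: part_lists_def)
  finally have 2: "(\<Prod>f\<leftarrow>F. \<Sum>k\<in>{1..K}. - ptr g k * f ^ (k - 1)) = \<dots>" .
  show ?thesis
    unfolding trunc_def 1 2 sum_product unfolding sum_distrib_left
    by (intro sum.cong refl) (simp add: power_add mult_ac)
qed

lemma bdd_meas_trunc: "bdd_meas (trunc K E F)"
  unfolding trunc_expand[abs_def]
  by (intro bdd_meas_mult bdd_meas_sum bdd_meas_const bdd_meas_cnj bdd_meas_pms)

lemma integral_trunc:
  "(\<integral>g. trunc K E F g \<partial>\<mu>) = (- 1) ^ (length E + length F) *
    (\<Sum>ks\<in>part_lists (length E) K. \<Sum>ls\<in>part_lists (length F) K. shifted_monom E ks * shifted_monom F ls * Ev (mset ls) (mset ks))"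
proof -
  have i: "integrable \<mu> (\<lambda>g. shifted_monom E ks * shifted_monom F ls * (pms (mset ls) g * cnj (pms (mset ks) g)))" for ks ls
    by (intro integrable_mult_right bdd_meas_integrable bdd_meas_pair)
  have "(\<integral>g. trunc K E F g \<partial>\<mu>) = (- 1) ^ (length E + length F) *
    (\<integral>g. (\<Sum>ks\<in>part_lists (length E) K. \<Sum>ls\<in>part_lists (length F) K.
       shifted_monom E ks * shifted_monom F ls * (pms (mset ls) g * cnj (pms (mset ks) g))) \<partial>\<mu>)"
    unfolding trunc_expand by simp
  also have "(\<integral>g. (\<Sum>ks\<in>part_lists (length E) K. \<Sum>ls\<in>part_lists (length F) K.
       shifted_monom E ks * shifted_monom F ls * (pms (mset ls) g * cnj (pms (mset ks) g))) \<partial>\<mu>) =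
     (\<Sum>ks\<in>part_lists (length E) K. \<integral>g. (\<Sum>ls\<in>part_lists (length F) K.
       shifted_monom E ks * shifted_monom F ls * (pms (mset ls) g * cnj (pms (mset ks) g))) \<partial>\<mu>)"
    by (intro Bochner_Integration.integral_sum Bochner_Integration.integrable_sum i)
  also have "\<dots> = (\<Sum>ks\<in>part_lists (length E) K. \<Sum>ls\<in>part_lists (length F) K. \<integral>g.
       shifted_monom E ks * shifted_monom F ls * (pms (mset ls) g * cnj (pms (mset ks) g)) \<partial>\<mu>)"
    by (intro sum.cong refl Bochner_Integration.integral_sum i)
  also have "\<dots> = (\<Sum>ks\<in>part_lists (length E) K. \<Sum>ls\<in>part_lists (length F) K. shifted_monom E ks * shifted_monom F ls * Ev (mset ls) (mset ks))"
    by (simp add: Ev_def)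
  finally show ?thesis .
qed

text \<open>Off \<open>tail_pairs\<close> moments and \<open>orth\<close> agree: both vanish for
  unequal degrees, and degree at most \<open>N\<close> is the exact range. On the tail they are
  estimated separately, the moment by N^(p+q) <= n^(p+q) and the z-value by p! n^p, whence the
  factor 1 + p!.\<close>

lemma trunc_error:
  assumes len: "length E = p" "length F = q"
    and r: "0 < r" "\<And>x. x \<in> set E \<union> set F \<Longrightarrow> norm x \<le> r"
  shows "norm ((\<integral>g. trunc K E F g \<partial>\<mu>) - (- 1) ^ (p + q) *
       (\<Sum>ks\<in>part_lists p K. \<Sum>ls\<in>part_lists q K. shifted_monom E ks * shifted_monom F ls * orth (mset ls) (mset ks)))
     \<le> (1 + fact p) / (r ^ p * r ^ q) *
       (\<Sum>(ks, ls)\<in>tail_pairs p q K N. r ^ sum_list ks * r ^ sum_list ls * real (sum_list ks) ^ (p + q))"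
proof -
  define d where "d ks ls = Ev (mset ls) (mset ks) - orth (mset ls) (mset ks)" for ks ls
  have d0: "d ks ls = 0" if "ks \<in> part_lists p K" "ls \<in> part_lists q K" "(ks, ls) \<notin> tail_pairs p q K N" for ks ls
  proof (cases "sum_list ks = sum_list ls")
    case True
    with that have "sum_list ks \<le> N" by (auto simp: tail_pairs_def)
    with True that have "Ev (mset ls) (mset ks) = orth (mset ls) (mset ks)"
      by (intro Ev_eq_orth[of _ _ "sum_list ks"]) (auto simp: part_lists_def sum_mset_sum_list)
    thus ?thesis by (simp add: d_def)
  next
    case False
    hence "\<Sum>\<^sub># (mset ls) \<noteq> \<Sum>\<^sub># (mset ks)" by (simp add: sum_mset_sum_list)
    from Ev_eq_0[OF this] this show ?thesis by (auto simp: d_def orth_def)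
  qed
  have "(\<integral>g. trunc K E F g \<partial>\<mu>) - (- 1) ^ (p + q) *
       (\<Sum>ks\<in>part_lists p K. \<Sum>ls\<in>part_lists q K. shifted_monom E ks * shifted_monom F ls * orth (mset ls) (mset ks)) =
     (- 1) ^ (p + q) * (\<Sum>ks\<in>part_lists p K. \<Sum>ls\<in>part_lists q K. shifted_monom E ks * shifted_monom F ls * d ks ls)"
    unfolding integral_trunc len d_def by (simp add: algebra_simps sum_subtractf)
  hence "norm ((\<integral>g. trunc K E F g \<partial>\<mu>) - (- 1) ^ (p + q) *
       (\<Sum>ks\<in>part_lists p K. \<Sum>ls\<in>part_lists q K. shifted_monom E ks * shifted_monom F ls * orth (mset ls) (mset ks))) =
     norm (\<Sum>(ks, ls)\<in>part_lists p K \<times> part_lists q K. shifted_monom E ks * shifted_monom F ls * d ks ls)"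
    by (simp add: norm_mult norm_power sum.cartesian_product)
  also have "(\<Sum>(ks, ls)\<in>part_lists p K \<times> part_lists q K. shifted_monom E ks * shifted_monom F ls * d ks ls) =
     (\<Sum>(ks, ls)\<in>tail_pairs p q K N. shifted_monom E ks * shifted_monom F ls * d ks ls)"
  proof (rule sum.mono_neutral_right)
    show "tail_pairs p q K N \<subseteq> part_lists p K \<times> part_lists q K" by (auto simp: tail_pairs_def)
  qed (auto simp: finite_part_lists d0)
  also have "norm \<dots> \<le> (\<Sum>(ks, ls)\<in>tail_pairs p q K N. (1 + fact p) / (r ^ p * r ^ q) *
       (r ^ sum_list ks * r ^ sum_list ls * real (sum_list ks) ^ (p + q)))"
  proof (rule sum_norm_le, clarify)
    fix ks ls assume "(ks, ls) \<in> tail_pairs p q K N"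
    hence b: "ks \<in> part_lists p K" "ls \<in> part_lists q K" and s: "sum_list ks = sum_list ls" "N < sum_list ks"
      by (auto simp: tail_pairs_def)
    define n where "n = sum_list ks"
    have sz: "size (mset ls) + size (mset ks) = p + q" using b by (simp add: part_lists_def)
    have n1: "1 \<le> real n" using s by (simp add: n_def)
    have "norm (d ks ls) \<le> norm (Ev (mset ls) (mset ks)) + norm (orth (mset ls) (mset ks))"
      unfolding d_def by (rule norm_triangle_ineq4)
    also have "\<dots> \<le> real n ^ (p + q) + fact p * real n ^ (p + q)"
    proof (rule add_mono)
      have "norm (Ev (mset ls) (mset ks)) \<le> real N ^ (p + q)"
        using norm_Ev_le[of "mset ls" "mset ks"] unfolding sz .
      also have "\<dots> \<le> real n ^ (p + q)" using s by (intro power_mono) (auto simp: n_def)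
      finally show "norm (Ev (mset ls) (mset ks)) \<le> real n ^ (p + q)" .
      have "norm (orth (mset ls) (mset ks)) \<le> real (z_part (mset ks))" by (simp add: orth_def)
      also have "\<dots> \<le> fact p * real n ^ p" by (rule z_part_part_lists_le[OF b(1)]) (simp add: n_def)
      also have "\<dots> \<le> fact p * real n ^ (p + q)"
        using n1 by (intro mult_left_mono power_increasing) auto
      finally show "norm (orth (mset ls) (mset ks)) \<le> fact p * real n ^ (p + q)" .
    qed
    finally have nd: "norm (d ks ls) \<le> (1 + fact p) * real n ^ (p + q)" by (simp add: algebra_simps)
    have "norm (shifted_monom E ks * shifted_monom F ls * d ks ls) \<le>
        (r ^ sum_list ks / r ^ p) * (r ^ sum_list ls / r ^ q) * ((1 + fact p) * real n ^ (p + q))"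
      unfolding norm_mult
      using norm_shifted_monom_le[of ks E K r] norm_shifted_monom_le[of ls F K r] b r len nd
      by (intro mult_mono) auto
    also have "\<dots> = (1 + fact p) / (r ^ p * r ^ q) * (r ^ sum_list ks * r ^ sum_list ls * real (sum_list ks) ^ (p + q))"
      by (simp add: n_def)
    finally show "norm (shifted_monom E ks * shifted_monom F ls * d ks ls) \<le> (1 + fact p) / (r ^ p * r ^ q) *
       (r ^ sum_list ks * r ^ sum_list ls * real (sum_list ks) ^ (p + q))" .
  qed
  also have "\<dots> = (1 + fact p) / (r ^ p * r ^ q) *
       (\<Sum>(ks, ls)\<in>tail_pairs p q K N. r ^ sum_list ks * r ^ sum_list ls * real (sum_list ks) ^ (p + q))"
    by (simp add: sum_distrib_left case_prod_beta)
  finally show ?thesis .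
qed

section \<open>Passage from truncated series to the integral\<close>

definition ratio :: "complex list \<Rightarrow> complex list \<Rightarrow> complex mat \<Rightarrow> complex" where
  "ratio E F g = (\<Prod>\<epsilon>\<leftarrow>E. deriv (chi N g) \<epsilon> / chi N g \<epsilon>)
     * (\<Prod>\<phi>\<leftarrow>F. deriv (chi N (inv\<^bsub>unitary_group N\<^esub> g)) \<phi> / chi N (inv\<^bsub>unitary_group N\<^esub> g) \<phi>)"

lemma logderiv_tendsto:
  assumes g: "g \<in> U" and z: "norm z < 1"
  shows "(\<lambda>K. \<Sum>k\<in>{1..K}. - cnj (ptr g k) * z ^ (k - 1)) \<longlonglongrightarrow> deriv (chi N g) z / chi N g z"
    and "(\<lambda>K. \<Sum>k\<in>{1..K}. - ptr g k * z ^ (k - 1)) \<longlonglongrightarrow>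
       deriv (chi N (inv\<^bsub>unitary_group N\<^esub> g)) z / chi N (inv\<^bsub>unitary_group N\<^esub> g) z"
proof -
  have *: "(\<Sum>k\<in>{1..K}. h k) = (\<Sum>k<K. h (Suc k))" for h :: "nat \<Rightarrow> complex" and K
    by (simp add: sum.atLeast1_atMost_eq lessThan_atLeast0)
  show "(\<lambda>K. \<Sum>k\<in>{1..K}. - cnj (ptr g k) * z ^ (k - 1)) \<longlonglongrightarrow> deriv (chi N g) z / chi N g z"
    using logderiv_chi_sums[OF g z] unfolding sums_def * by simp
  define h where "h = inv\<^bsub>unitary_group N\<^esub> g"
  have h: "h \<in> U" unfolding h_def by (rule group.inv_closed[OF group_unitary_group g])
  have "ptr h k = cnj (ptr g k)" for k
    unfolding h_def inv_unitary_group[OF g] by (rule ptr_adjoint[OF U_carrier[OF g]])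
  thus "(\<lambda>K. \<Sum>k\<in>{1..K}. - ptr g k * z ^ (k - 1)) \<longlonglongrightarrow>
       deriv (chi N (inv\<^bsub>unitary_group N\<^esub> g)) z / chi N (inv\<^bsub>unitary_group N\<^esub> g) z"
    using logderiv_chi_sums[OF h z] unfolding sums_def * h_def[symmetric] by simp
qed

lemma tendsto_prod_list:
  fixes f :: "'a \<Rightarrow> nat \<Rightarrow> complex"
  assumes "\<And>x. x \<in> set xs \<Longrightarrow> f x \<longlonglongrightarrow> l x"
  shows "(\<lambda>K. \<Prod>x\<leftarrow>xs. f x K) \<longlonglongrightarrow> (\<Prod>x\<leftarrow>xs. l x)"
  using assms by (induction xs) (auto intro: tendsto_mult)

lemma norm_prod_list_le:
  fixes f :: "'a \<Rightarrow> complex"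
  assumes "\<And>x. x \<in> set xs \<Longrightarrow> norm (f x) \<le> B"
  shows "norm (\<Prod>x\<leftarrow>xs. f x) \<le> B ^ length xs"
  using assms
proof (induction xs)
  case (Cons x xs)
  have "0 \<le> B" using Cons.prems[of x] norm_ge_zero[of "f x"] by (simp del: norm_ge_zero)
  with Cons show ?case by (auto simp: norm_mult intro!: mult_mono)
qed simp

text \<open>\<open>h\<close> covers both -p_k and its conjugate. The bound is free of
  \<open>K\<close>, as a dominating constant must be.\<close>

lemma norm_truncated_series_le:
  fixes z :: complex and h :: "nat \<Rightarrow> complex"
  assumes g: "g \<in> U" and z: "norm z \<le> r" and r: "0 < r" "r < 1"
    and h: "\<And>k. norm (h k) = norm (ptr g k)"
  shows "norm (\<Sum>k\<in>{1..K}. h k * z ^ (k - 1)) \<le> real N / (1 - r)"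
proof -
  have "norm (\<Sum>k\<in>{1..K}. h k * z ^ (k - 1)) \<le> (\<Sum>k\<in>{1..K}. real N * r ^ (k - 1))"
  proof (rule sum_norm_le)
    fix k
    show "norm (h k * z ^ (k - 1)) \<le> real N * r ^ (k - 1)"
      unfolding norm_mult norm_power h
      by (intro mult_mono power_mono norm_ptr_unitary_le[OF g] z) auto
  qed
  also have "\<dots> = real N * (\<Sum>k<K. r ^ k)"
    by (simp add: sum.atLeast1_atMost_eq lessThan_atLeast0 sum_distrib_left)
  also have "\<dots> \<le> real N * (1 / (1 - r))"
    using r sum_le_suminf[OF summable_geometric[of r], of "{..<K}"]
    by (intro mult_left_mono) (auto simp: suminf_geometric)
  finally show ?thesis by simp
qed

lemma integral_trunc_tendsto:
  assumes r: "0 < r" "r < 1" "\<And>x. x \<in> set E \<union> set F \<Longrightarrow> norm x \<le> r"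
  shows "(\<lambda>K. \<integral>g. trunc K E F g \<partial>\<mu>) \<longlonglongrightarrow> (\<integral>g. ratio E F g \<partial>\<mu>)"
proof -
  have lim: "(\<lambda>K. trunc K E F g) \<longlonglongrightarrow> ratio E F g" if "g \<in> space \<mu>" for g
  proof -
    have g: "g \<in> U" using that by simp
    have "norm x < 1" if "x \<in> set E \<union> set F" for x using r(2) r(3)[OF that] by simp
    thus ?thesis
      unfolding trunc_def ratio_def by (intro tendsto_mult tendsto_prod_list logderiv_tendsto[OF g]) auto
  qed
  have meas: "trunc K E F \<in> borel_measurable \<mu>" for K
    using bdd_meas_trunc by (simp add: bdd_meas_def)
  have bound: "norm (trunc K E F g) \<le> (real N / (1 - r)) ^ length E * (real N / (1 - r)) ^ length F"
    if "g \<in> space \<mu>" for K g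
    unfolding trunc_def norm_mult using that r
    by (intro mult_mono norm_prod_list_le norm_truncated_series_le) auto
  show ?thesis
  proof (rule integral_dominated_convergence)
    \<comment> \<open>As a pointwise limit the integrand inherits measurability from the
      truncations, so derivatives of \<open>chi\<close> need no separate treatment.\<close>
    show "ratio E F \<in> borel_measurable \<mu>"
      by (rule borel_measurable_LIMSEQ_metric[OF meas lim])
    show "AE g in \<mu>. (\<lambda>K. trunc K E F g) \<longlonglongrightarrow> ratio E F g" by (rule AE_I2[OF lim])
    show "AE g in \<mu>. norm (trunc K E F g) \<le> (real N / (1 - r)) ^ length E * (real N / (1 - r)) ^ length F" for K
      by (rule AE_I2[OF bound])
  qed (use meas in auto)
qed

text \<open>The estimate for truncations is uniform in \<open>K\<close> and survives the limit. The
  comparison sums tend to the main term, since the sign is +1 for p = q, and they vanish for p ~= q,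
  since multisets of different sizes differ.\<close>

lemma ratio_error:
  assumes len: "length E = p" "length F = q"
    and r: "0 < r" "r < 1" "\<And>x. x \<in> set E \<union> set F \<Longrightarrow> norm x \<le> r"
    and tail: "\<And>K. (\<Sum>(ks, ls)\<in>tail_pairs p q K N. r ^ sum_list ks * r ^ sum_list ls * real (sum_list ks) ^ (p + q)) \<le> T"
  shows "norm ((\<integral>g. ratio E F g \<partial>\<mu>) - (if p = q then infsum (main_summand E F) (parts_of_length p) else 0))
     \<le> (1 + fact p) / (r ^ p * r ^ q) * T"
proof -
  define M where "M = (if p = q then infsum (main_summand E F) (parts_of_length p) else 0)"
  define MK where "MK K = (- 1) ^ (p + q) *
       (\<Sum>ks\<in>part_lists p K. \<Sum>ls\<in>part_lists q K. shifted_monom E ks * shifted_monom F ls * orth (mset ls) (mset ks))" for K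
  have "MK \<longlonglongrightarrow> M"
  proof (cases "p = q")
    case True
    have "MK = (\<lambda>K. \<Sum>pt\<in>mset ` part_lists p K. main_summand E F pt)"
      using True len by (auto simp: MK_def sum_main_summand simp flip: mult_2)
    moreover have "(\<lambda>K. \<Sum>pt\<in>mset ` part_lists p K. main_summand E F pt) \<longlonglongrightarrow> infsum (main_summand E F) (parts_of_length p)"
      using True len r by (intro main_summand_tendsto[where r = r]) auto
    ultimately show ?thesis using True by (simp add: M_def)
  next
    case False
    have "orth (mset ls) (mset ks) = 0" if "ks \<in> part_lists p K" "ls \<in> part_lists q K" for ks ls K
      using that False by (auto simp: orth_def part_lists_def dest: mset_eq_length)
    hence "MK = (\<lambda>K. 0)" by (auto simp: MK_def)
    thus ?thesis using False by (simp add: M_def)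
  qed
  hence "(\<lambda>K. norm ((\<integral>g. trunc K E F g \<partial>\<mu>) - MK K)) \<longlonglongrightarrow> norm ((\<integral>g. ratio E F g \<partial>\<mu>) - M)"
    using integral_trunc_tendsto[OF r] by (intro tendsto_intros)
  moreover have "norm ((\<integral>g. trunc K E F g \<partial>\<mu>) - MK K) \<le> (1 + fact p) / (r ^ p * r ^ q) * T" for K
  proof -
    have "norm ((\<integral>g. trunc K E F g \<partial>\<mu>) - MK K) \<le> (1 + fact p) / (r ^ p * r ^ q) *
       (\<Sum>(ks, ls)\<in>tail_pairs p q K N. r ^ sum_list ks * r ^ sum_list ls * real (sum_list ks) ^ (p + q))"
      unfolding MK_def by (rule trunc_error[OF len r(1,3)])
    also have "\<dots> \<le> (1 + fact p) / (r ^ p * r ^ q) * T"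
      using r by (intro mult_left_mono tail) auto
    finally show ?thesis .
  qed
  ultimately show ?thesis
    unfolding M_def[symmetric] by (intro LIMSEQ_le_const2) auto
qed

end

section \<open>The uniform constant and the degenerate radii\<close>

theorem mainTheorem12:
  fixes r :: real and p q :: nat
  shows "\<exists>C :: real. \<forall>N \<ge> 1. \<forall>\<mu>. \<forall>\<E> \<F> :: complex list.
    normalized_haar_measure N \<mu> \<longrightarrow> length \<E> = p \<longrightarrow> length \<F> = q \<longrightarrow>
    (\<forall>x \<in> set \<E> \<union> set \<F>. 0 < norm x \<and> norm x \<le> r \<and> r < 1) \<longrightarrow>
    (let M = (if p = q then
                \<Sum>\<^sub>\<infinity>pt \<in> {pt \<in> partitions. size pt = p}.
                   of_nat (z_part pt) * monomial_sym (subtract_ones pt) \<E>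
                     * monomial_sym (subtract_ones pt) \<F>
              else 0)
     in norm ((\<integral>g. (\<Prod>\<epsilon>\<leftarrow>\<E>. deriv (chi N g) \<epsilon> / chi N g \<epsilon>)
                  * (\<Prod>\<phi>\<leftarrow>\<F>. deriv (chi N (inv\<^bsub>unitary_group N\<^esub> g)) \<phi>
                               / chi N (inv\<^bsub>unitary_group N\<^esub> g) \<phi>) \<partial>\<mu>) - M)
        \<le> C * (r ^ (2 * N) * real N ^ ((p - 1) + (q - 1) + (p + q - 1) + 2)))"
proof -
  have main: "\<exists>C\<ge>0. \<forall>N\<ge>1. \<forall>\<mu> E F. normalized_haar_measure N \<mu> \<longrightarrow> length E = p \<longrightarrow> length F = q \<longrightarrow>
      (\<forall>x\<in>set E \<union> set F. norm x \<le> s) \<longrightarrow>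
      norm ((\<integral>g. haar.ratio N E F g \<partial>\<mu>) - (if p = q then infsum (main_summand E F) (parts_of_length p) else 0))
       \<le> C * (s ^ (2 * N) * real N ^ ((p - 1) + (q - 1) + (p + q - 1) + 2))"
    if s: "0 < s" "s < 1" for s
  proof -
    obtain D where D: "D \<ge> 0" "\<And>K n0. (\<Sum>(ks, ls)\<in>tail_pairs p q K n0. s ^ sum_list ks * s ^ sum_list ls * real (sum_list ks) ^ (p + q))
       \<le> D * real (max 1 n0) ^ ((p + q) + (p - 1) + (q - 1)) * s ^ (2 * n0)"
      using tail_sum_le[OF s, of p q] by blast
    \<comment> \<open>The powers of \<open>s\<close> undo the shift of exponents,
      \<open>1 + fact p\<close> comes from the two tail bounds and \<open>D\<close> from the tail
      series; none of them involves \<open>N\<close> or the sequences.\<close>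
    define C where "C = (1 + fact p) / (s ^ p * s ^ q) * D"
    show ?thesis
    proof (intro exI[of _ C] conjI allI impI)
      show "C \<ge> 0" using s D by (simp add: C_def)
      fix N :: nat and \<mu> and E F :: "complex list"
      assume N: "N \<ge> 1" and \<mu>: "normalized_haar_measure N \<mu>" and len: "length E = p" "length F = q"
        and x: "\<forall>x\<in>set E \<union> set F. norm x \<le> s"
      interpret haar N \<mu> by unfold_locales (rule \<mu>)
      define e where "e = (p - 1) + (q - 1) + (p + q - 1) + 2"
      have tail: "(\<Sum>(ks, ls)\<in>tail_pairs p q K N. s ^ sum_list ks * s ^ sum_list ls * real (sum_list ks) ^ (p + q))
          \<le> D * (s ^ (2 * N) * real N ^ e)" for K
      proof -
        have "real (max 1 N) ^ ((p + q) + (p - 1) + (q - 1)) \<le> real N ^ e"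
        proof -
          have "max 1 N = N" using N by simp
          \<comment> \<open>As p + q <= (p + q - 1) + 1 even with truncated subtraction, the stated
            exponent is larger by at least 1.\<close>
          moreover have "(p + q) + (p - 1) + (q - 1) \<le> e" unfolding e_def by linarith
          ultimately show ?thesis using N by (simp only:) (intro power_increasing, auto)
        qed
        hence "D * real (max 1 N) ^ ((p + q) + (p - 1) + (q - 1)) * s ^ (2 * N) \<le> D * real N ^ e * s ^ (2 * N)"
          using D(1) s by (intro mult_right_mono mult_left_mono) auto
        with D(2)[of K N] show ?thesis by (simp add: mult_ac)
      qed
      show "norm ((\<integral>g. ratio E F g \<partial>\<mu>) - (if p = q then infsum (main_summand E F) (parts_of_length p) else 0))
         \<le> C * (s ^ (2 * N) * real N ^ ((p - 1) + (q - 1) + (p + q - 1) + 2))"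
        using ratio_error[OF len s _ tail] x unfolding e_def[symmetric] C_def by simp
    qed
  qed
  show ?thesis
  proof (cases "0 < r \<and> r < 1")
    case True
    from main[of r] True obtain C where C: "\<forall>N\<ge>1. \<forall>\<mu> E F. normalized_haar_measure N \<mu> \<longrightarrow> length E = p \<longrightarrow> length F = q \<longrightarrow>
      (\<forall>x\<in>set E \<union> set F. norm x \<le> r) \<longrightarrow>
      norm ((\<integral>g. haar.ratio N E F g \<partial>\<mu>) - (if p = q then infsum (main_summand E F) (parts_of_length p) else 0))
       \<le> C * (r ^ (2 * N) * real N ^ ((p - 1) + (q - 1) + (p + q - 1) + 2))" by auto
    show ?thesis
    proof (intro exI[of _ C] allI impI, unfold Let_def)
      fix N :: nat and \<mu> and \<E> \<F> :: "complex list"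
      assume a: "N \<ge> 1" "normalized_haar_measure N \<mu>" "length \<E> = p" "length \<F> = q"
        "\<forall>x \<in> set \<E> \<union> set \<F>. 0 < norm x \<and> norm x \<le> r \<and> r < 1"
      interpret haar N \<mu> by unfold_locales (rule a)
      show "norm ((\<integral>g. (\<Prod>\<epsilon>\<leftarrow>\<E>. deriv (chi N g) \<epsilon> / chi N g \<epsilon>)
                  * (\<Prod>\<phi>\<leftarrow>\<F>. deriv (chi N (inv\<^bsub>unitary_group N\<^esub> g)) \<phi>
                               / chi N (inv\<^bsub>unitary_group N\<^esub> g) \<phi>) \<partial>\<mu>) -
            (if p = q then
                \<Sum>\<^sub>\<infinity>pt \<in> {pt \<in> partitions. size pt = p}.
                   of_nat (z_part pt) * monomial_sym (subtract_ones pt) \<E>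
                     * monomial_sym (subtract_ones pt) \<F>
              else 0))
        \<le> C * (r ^ (2 * N) * real N ^ ((p - 1) + (q - 1) + (p + q - 1) + 2))"
        using C[rule_format, OF a(1,2,3,4)] a(5)
        unfolding ratio_def main_summand_def[abs_def] parts_of_length_def by simp
    qed
  next
    case False
    show ?thesis
    proof (cases "p = 0 \<and> q = 0")
      \<comment> \<open>With both sequences empty the hypothesis puts no condition on
        \<open>r\<close>. The integral is 1 and the empty partition alone contributes 1, so the
        constant 0 works.\<close>
      case True
      show ?thesis
      proof (intro exI[of _ 0] allI impI, unfold Let_def)
        fix N :: nat and \<mu> and \<E> \<F> :: "complex list"
        assume a: "normalized_haar_measure N \<mu>" "length \<E> = p" "length \<F> = q"
        interpret haar N \<mu> by unfold_locales (rule a)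
        have "{pt \<in> partitions. size pt = 0} = {{#}}" by (auto simp: partitions_def)
        moreover have "{\<alpha> :: nat list. \<alpha> = [] \<and> (\<forall>x. x \<in> set \<alpha> \<longrightarrow> x = 0)} = {[]}" by auto
        hence "monomial_sym (subtract_ones {#}) [] = 1"
          by (simp add: monomial_sym_def subtract_ones_def)
        ultimately show "norm ((\<integral>g. (\<Prod>\<epsilon>\<leftarrow>\<E>. deriv (chi N g) \<epsilon> / chi N g \<epsilon>)
                  * (\<Prod>\<phi>\<leftarrow>\<F>. deriv (chi N (inv\<^bsub>unitary_group N\<^esub> g)) \<phi>
                               / chi N (inv\<^bsub>unitary_group N\<^esub> g) \<phi>) \<partial>\<mu>) -
            (if p = q then
                \<Sum>\<^sub>\<infinity>pt \<in> {pt \<in> partitions. size pt = p}.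
                   of_nat (z_part pt) * monomial_sym (subtract_ones pt) \<E>
                     * monomial_sym (subtract_ones pt) \<F>
              else 0))
          \<le> 0 * (r ^ (2 * N) * real N ^ ((p - 1) + (q - 1) + (p + q - 1) + 2))"
          using True a prob_space by simp
      qed
    next
      case nonempty: False
      \<comment> \<open>Any entry would force 0 < |x| <= r < 1, so for such \<open>r\<close> the
        claim is vacuous.\<close>
      have "\<not> (\<forall>x \<in> set \<E> \<union> set \<F>. 0 < norm x \<and> norm x \<le> r \<and> r < 1)"
        if len: "length \<E> = p" "length \<F> = q" for \<E> \<F> :: "complex list"
      proof -
        have "\<E> \<noteq> [] \<or> \<F> \<noteq> []" using len nonempty by auto
        then obtain x where x: "x \<in> set \<E> \<union> set \<F>"
          by (metis UnCI list.set_intros(1) neq_Nil_conv)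
        show ?thesis
        proof
          assume "\<forall>x \<in> set \<E> \<union> set \<F>. 0 < norm x \<and> norm x \<le> r \<and> r < 1"
          with x have "0 < norm x" "norm x \<le> r" "r < 1" by blast+
          thus False using False by linarith
        qed
      qed
      thus ?thesis by blast
    qed
  qed
qed

end
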